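(* Let $n\ge1$, $\alpha\in(0,1)$ and $p\in[1,+\infty)$. The set $C^\infty_c(\mathbb{R}^n)$ is dense in $S^{\alpha,p}(\mathbb{R}^n)$.
   Context: For $\alpha\in(0,1)$ set $\mu_{n,\alpha}:=2^{\alpha}\pi^{-\frac n2}\frac{\Gamma\left(\frac{n+\alpha+1}{2}\right)}{\Gamma\left(\frac{1-\alpha}{2}\right)}$ and, for $\varphi\in C^\infty_c(\mathbb{R}^n;\mathbb{R}^n)$, $$\mathrm{div}^\alpha\varphi(x):=\mu_{n,\alpha}\int_{\mathbb{R}^n}\frac{(y-x)\cdot(\varphi(y)-\varphi(x))}{|y-x|^{n+\alpha+1}}\,dy,\quad x\in\mathbb{R}^n$$ (this belongs to $L^q(\mathbb{R}^n)$ for all $q\in[1,+\infty]$). A function $f\in L^p(\mathbb{R}^n)$ has weak fractional $\alpha$-gradient $\nabla^\alpha f\in L^1_{\mathrm{loc}}(\mathbb{R}^n;\mathbb{R}^n)$ if $\int_{\mathbb{R}^n}f\,\mathrm{div}^\alpha\varphi\,dx=-\int_{\mathbb{R}^n}\nabla^\alpha f\cdot\varphi\,dx$ for all $\varphi\in C^\infty_c(\mathbb{R}^n;\mathbb{R}^n)$. The distributional fractional Sobolev space is $$S^{\alpha,p}(\mathbb{R}^n):=\{f\in L^p(\mathbb{R}^n):\exists\,\nabla^\alpha f\in L^p(\mathbb{R}^n;\mathbb{R}^n)\},$$ endowed with the norm $\|f\|_{S^{\alpha,p}(\mathbb{R}^n)}:=\|f\|_{L^p(\mathbb{R}^n)}+\|\nabla^\alpha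 f\|_{L^p(\mathbb{R}^n;\mathbb{R}^n)}$. *)

theory Defs
  imports "HOL-Analysis.Analysis"
begin

text \<open>
  The space \<open>\<real>\<^sup>n\<close> is the type \<^typ>\<open>real ^ 'n\<close>, with \<open>n = CARD('n) \<ge> 1\<close>.
  Elements of the function spaces below are functions rather than classes modulo equality
  almost everywhere, so the "norms" are seminorms that vanish on null functions.
\<close>

primrec C_k :: "nat \<Rightarrow> ('a::real_normed_vector \<Rightarrow> 'b::real_normed_vector) \<Rightarrow> bool" where
  "C_k 0 f \<longleftrightarrow> continuous_on UNIV f"
| "C_k (Suc k) f \<longleftrightarrow>
     (\<forall>x. f differentiable (at x)) \<and> (\<forall>v. C_k k (\<lambda>x. frechet_derivative f (at x) v))"

definition Cc_infinity :: "('a::real_normed_vector \<Rightarrow> 'b::real_normed_vector) set" where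
  "Cc_infinity = {f. (\<forall>k. C_k k f) \<and> compact (closure {x. f x \<noteq> 0})}"

definition Lp_space :: "real \<Rightarrow> ('a::euclidean_space \<Rightarrow> 'b::euclidean_space) set" where
  "Lp_space p = {f. f \<in> borel_measurable lebesgue \<and> integrable lebesgue (\<lambda>x. norm (f x) powr p)}"

definition Lp_norm :: "real \<Rightarrow> ('a::euclidean_space \<Rightarrow> 'b::euclidean_space) \<Rightarrow> real" where
  "Lp_norm p f = (\<integral>x. norm (f x) powr p \<partial>lebesgue) powr (1 / p)"

definition L1_loc :: "('a::euclidean_space \<Rightarrow> 'b::euclidean_space) set" where
  "L1_loc = {f. f \<in> borel_measurable lebesgue \<and> (\<forall>K. compact K \<longrightarrow> set_integrable lebesgue K f)}"

definition frac_mu :: "nat \<Rightarrow> real \<Rightarrow> real" where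
  "frac_mu n \<alpha> = 2 powr \<alpha> * pi powr (- real n / 2)
      * (Gamma ((real n + \<alpha> + 1) / 2) / Gamma ((1 - \<alpha>) / 2))"

text \<open>For smooth compactly supported \<open>\<phi>\<close> the integral converges absolutely; at \<open>y = x\<close> the integrand
  has the value \<open>0\<close>, by the convention \<open>0 / 0 = 0\<close>.\<close>

definition frac_div :: "real \<Rightarrow> (real ^ 'n \<Rightarrow> real ^ 'n) \<Rightarrow> real ^ 'n \<Rightarrow> real" where
  "frac_div \<alpha> \<phi> x = frac_mu CARD('n) \<alpha> *
     (\<integral>y. ((y - x) \<bullet> (\<phi> y - \<phi> x)) / norm (y - x) powr (real CARD('n) + \<alpha> + 1) \<partial>lebesgue)"

definition has_weak_frac_grad ::
    "real \<Rightarrow> (real ^ 'n \<Rightarrow> real) \<Rightarrow> (real ^ 'n \<Rightarrow> real ^ 'n) \<Rightarrow> bool" where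
  "has_weak_frac_grad \<alpha> f g \<longleftrightarrow> g \<in> L1_loc \<and>
     (\<forall>\<phi>\<in>Cc_infinity.
        (\<integral>x. f x * frac_div \<alpha> \<phi> x \<partial>lebesgue) = - (\<integral>x. g x \<bullet> \<phi> x \<partial>lebesgue))"

definition frac_sobolev :: "real \<Rightarrow> real \<Rightarrow> (real ^ 'n \<Rightarrow> real) set" where
  "frac_sobolev \<alpha> p = {f \<in> Lp_space p. \<exists>g\<in>Lp_space p. has_weak_frac_grad \<alpha> f g}"

text \<open>The weak fractional gradient is unique up to a null set; the choice below
  picks a representative, and \<open>Lp_norm\<close> does not depend on which one.\<close>

definition frac_grad :: "real \<Rightarrow> (real ^ 'n \<Rightarrow> real) \<Rightarrow> real ^ 'n \<Rightarrow> real ^ 'n" where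
  "frac_grad \<alpha> f = (SOME g. has_weak_frac_grad \<alpha> f g)"

definition frac_sobolev_norm :: "real \<Rightarrow> real \<Rightarrow> (real ^ 'n \<Rightarrow> real) \<Rightarrow> real" where
  "frac_sobolev_norm \<alpha> p f = Lp_norm p f + Lp_norm p (frac_grad \<alpha> f)"

end

theory Submission imports Defs "HOL-Real_Asymp.Real_Asymp" begin

text \<open>
  The approximation is by cutoff and then mollification. Write \<open>k z = z / norm z powr (n + \<alpha> + 1)\<close>. For a smooth
  compactly supported \<open>\<eta>\<close> the identity
  \<open>\<eta> x (\<phi> y - \<phi> x) = (\<eta> y \<phi> y - \<eta> x \<phi> x) - (\<eta> y - \<eta> x) \<phi> y\<close>
  and Fubini's theorem show that \<open>\<eta> f\<close> has the weak gradient \<open>\<eta> \<nabla>\<^sup>\<alpha>f + \<mu> T f\<close> with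
  \<open>T f y = \<integral> f x (\<eta> x - \<eta> y) k (x - y) dx\<close>. If \<open>\<eta>\<close> is a bump function dilated by a factor \<open>R\<close>, then \<open>T f\<close> is
  dominated by the convolution of \<open>norm f\<close> with a multiple of
  \<open>w z = min 1 (norm z / R) / norm z powr (n + \<alpha>)\<close>, so by Young's inequality its \<open>L\<^sup>p\<close> norm is at most that of
  \<open>f\<close> times the integral of \<open>w\<close>, which tends to \<open>0\<close> as \<open>R\<close> grows. The same identity with \<open>f = 1\<close> shows that smooth
  compactly supported functions belong to the space, because the fractional divergence of a test field has integral \<open>0\<close>.
  Mollification commutes with the fractional divergence, hence with the weak gradient. The norm is
  defined with an arbitrary choice of the weak gradient, so uniqueness almost everywhere is needed as well.
\<close>

section \<open>Smooth functions of compact support\<close>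

text \<open>Near the origin the kernel has size \<open>norm z powr (- (n + \<alpha>))\<close> and is
  not integrable, so in every integral it must stay attached to an increment of a smooth function.
  The increment contributes the factor \<open>min 1 (norm z)\<close>, and the product is integrable
  at the origin because \<alpha> < 1 and at infinity because \<alpha> > 0. The gradient is nonlocal:
  the gradients of \<open>\<eta> f\<close> and \<open>f\<close> may differ even where
  \<open>\<eta>\<close> is locally 1, and \<open>T f\<close> accounts for that difference. A bump
  dilated by \<open>R\<close> has slope of order \<open>1 / R\<close>; by scaling, the integral of
  \<open>w\<close> is \<open>R powr (- \<alpha>)\<close> times its value for \<open>R = 1\<close>,
  which explains the limit. Cutting off first makes \<open>\<eta> f\<close> integrable and not
  merely in L^p, so that its mollification can be differentiated as the convolution of an integrable
  function with a test function, and has compact support. Finiteness of \<open>p\<close> enters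
  through dominated convergence of p-th powers.\<close>

lemma C_k_imp_continuous: "C_k k f \<Longrightarrow> continuous_on UNIV f"
  by (cases k) (auto intro!: differentiable_imp_continuous_on simp: differentiable_on_def)

text \<open>\<open>C_k\<close> recurses through directional derivatives, so any class of
  differentiable functions that is closed under them consists of smooth functions. This spares
  explicit formulas for higher derivatives, both for the bump functions and for
  convolutions.\<close>

lemma C_k_coinduct:
  assumes "S f"
    and "\<And>f x. S f \<Longrightarrow> f differentiable (at x)"
    and "\<And>f v. S f \<Longrightarrow> S (\<lambda>x. frechet_derivative f (at x) v)"
  shows "C_k k f"
  using assms(1)
proof (induction k arbitrary: f)
  case 0
  then show ?case
    using assms(2) by (auto intro!: differentiable_imp_continuous_on simp: differentiable_on_def)
next
  case (Suc k)
  then show ?case using assms(2,3) by auto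
qed

lemma C_k_SucI:
  assumes "\<And>x. (f has_derivative f' x) (at x)" and "\<And>v. C_k k (\<lambda>x. f' x v)"
  shows "C_k (Suc k) f"
proof -
  have "frechet_derivative f (at x) = f' x" for x
    using assms(1) by (metis frechet_derivative_at)
  then show ?thesis using assms by (auto simp: differentiable_def)
qed

lemma C_k_SucD:
  assumes "C_k (Suc k) f"
  shows "(f has_derivative frechet_derivative f (at x)) (at x)"
    and "C_k k (\<lambda>x. frechet_derivative f (at x) v)"
  using assms by (auto simp: frechet_derivative_works[symmetric])

text \<open>Needed for the product rule: the derivative of a product still contains the
  undifferentiated factors, about which the induction knows only \<open>C_k (Suc k)\<close>.\<close>

lemma C_k_decrease: "C_k (Suc k) f \<Longrightarrow> C_k k f"
proof (induction k arbitrary: f)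
  case 0
  then show ?case using C_k_imp_continuous[of "Suc 0" f] by simp
next
  case (Suc k)
  from Suc.prems show ?case
    by (intro C_k_SucI[of f "\<lambda>x. frechet_derivative f (at x)"] C_k_SucD(1)[OF Suc.prems]
        Suc.IH C_k_SucD(2)[OF Suc.prems])
qed

lemma C_k_const: "C_k k (\<lambda>x. c)"
proof (induction k arbitrary: c)
  case (Suc k)
  show ?case by (rule C_k_SucI[where f' = "\<lambda>x v. 0"]) (auto intro: Suc derivative_eq_intros)
qed simp

lemma C_k_add: "C_k k f \<Longrightarrow> C_k k g \<Longrightarrow> C_k k (\<lambda>x. f x + g x)"
proof (induction k arbitrary: f g)
  case 0
  then show ?case by (simp add: continuous_on_add)
next
  case (Suc k)
  show ?case
    by (rule C_k_SucI[where
          f' = "\<lambda>x v. frechet_derivative f (at x) v + frechet_derivative g (at x) v"])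
      (intro has_derivative_add Suc.IH C_k_SucD(1)[OF Suc.prems(1)]
        C_k_SucD(1)[OF Suc.prems(2)] C_k_SucD(2)[OF Suc.prems(1)] C_k_SucD(2)[OF Suc.prems(2)])+
qed

lemma C_k_scaleR: "C_k k f \<Longrightarrow> C_k k g \<Longrightarrow> C_k k (\<lambda>x. f x *\<^sub>R g x)"
proof (induction k arbitrary: f g)
  case 0
  then show ?case by (simp add: continuous_on_scaleR)
next
  case (Suc k)
  show ?case
    by (rule C_k_SucI[where f' = "\<lambda>x v. f x *\<^sub>R frechet_derivative g (at x) v +
          frechet_derivative f (at x) v *\<^sub>R g x"])
      (intro has_derivative_scaleR C_k_add Suc.IH C_k_SucD(1)[OF Suc.prems(1)]
        C_k_SucD(1)[OF Suc.prems(2)] C_k_SucD(2)[OF Suc.prems(1)] C_k_SucD(2)[OF Suc.prems(2)]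
        C_k_decrease[OF Suc.prems(1)] C_k_decrease[OF Suc.prems(2)])+
qed

lemma C_k_affine: "C_k k f \<Longrightarrow> C_k k (\<lambda>x. f (a + c *\<^sub>R x))"
proof (induction k arbitrary: f)
  case 0
  then show ?case
    by (auto intro!: continuous_on_compose2[of UNIV f] continuous_intros)
next
  case (Suc k)
  show ?case
  proof (rule C_k_SucI[where f' = "\<lambda>x v. frechet_derivative f (at (a + c *\<^sub>R x)) (c *\<^sub>R v)"])
    show "((\<lambda>x. f (a + c *\<^sub>R x)) has_derivative
        (\<lambda>v. frechet_derivative f (at (a + c *\<^sub>R x)) (c *\<^sub>R v))) (at x)" for x
      by (rule has_derivative_compose[of "\<lambda>x. a + c *\<^sub>R x", OF _ C_k_SucD(1)[OF Suc.prems]])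
        (auto intro!: derivative_eq_intros)
    show "C_k k (\<lambda>x. frechet_derivative f (at (a + c *\<^sub>R x)) (c *\<^sub>R v))" for v
      by (rule Suc.IH) (rule C_k_SucD(2)[OF Suc.prems])
  qed
qed

text \<open>For \<open>m = 0\<close> this is the classical flat function. The extra powers of
  \<open>t\<close> in the denominator make the linear span of the family closed under
  differentiation.\<close>

definition exp_bump :: "nat \<Rightarrow> real \<Rightarrow> real" where
  "exp_bump m t = (if t > 0 then exp (- 1 / t) / t ^ m else 0)"

lemma exp_bump_has_derivative:
  "(exp_bump m has_real_derivative exp_bump (m + 2) t - m * exp_bump (m + 1) t) (at t)"
proof -
  consider "t > 0" | "t < 0" | "t = 0" by linarith
  then show ?thesis
  proof cases
    case 1
    have "((\<lambda>t. exp (- 1 / t)) has_real_derivative exp (- 1 / t) / t\<^sup>2) (at t)"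
      using 1 by (auto intro!: derivative_eq_intros simp: power2_eq_square)
    from DERIV_divide[OF this DERIV_pow[of m]] 1
    have "((\<lambda>t. exp (- 1 / t) / t ^ m) has_real_derivative
        (exp (- 1 / t) / t\<^sup>2 * t ^ m - exp (- 1 / t) * (m * t ^ (m - Suc 0))) / (t ^ m * t ^ m)) (at t)"
      by simp
    moreover have "(exp (- 1 / t) / t\<^sup>2 * t ^ m - exp (- 1 / t) * (m * t ^ (m - Suc 0))) / (t ^ m * t ^ m)
        = exp_bump (m + 2) t - m * exp_bump (m + 1) t"
    proof -
      \<comment> \<open>The exponent \<open>m - Suc 0\<close> is truncated at \<open>m = 0\<close>,
        where the factor \<open>m\<close> makes both sides 0.\<close>
      have "real m * t ^ (m - Suc 0) * t = m * t ^ m" by (cases m) auto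
      moreover have "(e / t\<^sup>2 * q - e * r) / (q * q) = e / (q * t\<^sup>2) - s * (e / (q * t))"
        if "r * t = s * q" "q > 0" for e q r s :: real
      proof -
        have "r = s * q / t" using that 1 by (simp add: field_simps)
        then show ?thesis using 1 that(2) by (simp add: field_simps power2_eq_square)
      qed
      from this[OF calculation, of "exp (- 1 / t)"] show ?thesis
        using 1 by (simp add: exp_bump_def power_add power2_eq_square mult_ac)
    qed
    ultimately have "((\<lambda>t. exp (- 1 / t) / t ^ m) has_real_derivative
        exp_bump (m + 2) t - m * exp_bump (m + 1) t) (at t)"
      by simp
    then show ?thesis
      by (rule has_field_derivative_transform_within_open[of _ _ _ "{0<..}"])
        (use 1 in \<open>auto simp: exp_bump_def\<close>)
  next
    case 2
    have "((\<lambda>t. 0) has_real_derivative exp_bump (m + 2) t - m * exp_bump (m + 1) t) (at t)"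
      using 2 by (auto simp: exp_bump_def)
    then show ?thesis
      by (rule has_field_derivative_transform_within_open[of _ _ _ "{..<0}"])
        (use 2 in \<open>auto simp: exp_bump_def\<close>)
  next
    case 3
    have "((\<lambda>h. exp_bump m h / h) \<longlongrightarrow> 0) (at_left 0)"
      by (rule tendsto_eventually) (auto simp: exp_bump_def eventually_at_filter)
    moreover have "((\<lambda>h. exp_bump m h / h) \<longlongrightarrow> 0) (at_right 0)"
    proof (rule Lim_transform_eventually)
      show "((\<lambda>h::real. exp (- 1 / h) / h ^ m / h) \<longlongrightarrow> 0) (at_right 0)"
        by real_asymp
      show "\<forall>\<^sub>F h in at_right 0. exp (- 1 / h) / h ^ m / h = exp_bump m h / h"
        by (auto simp: exp_bump_def eventually_at_filter)
    qed
    ultimately show ?thesis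
      using 3 by (simp add: has_field_derivative_iff exp_bump_def filterlim_split_at)
  qed
qed

text \<open>The factors \<open>x \<bullet> v\<close> are what the chain rule produces from
  \<open>1 - x \<bullet> x\<close>; with them and all orders \<open>m\<close> present, the class is
  closed under directional derivatives, as \<open>C_k_coinduct\<close> requires.\<close>

inductive bump_algebra :: "('a::euclidean_space \<Rightarrow> real) \<Rightarrow> bool" where
  const: "bump_algebra (\<lambda>x. c)"
| inner: "bump_algebra (\<lambda>x. x \<bullet> v)"
| bump: "bump_algebra (\<lambda>x. exp_bump m (1 - x \<bullet> x))"
| add: "bump_algebra f \<Longrightarrow> bump_algebra g \<Longrightarrow> bump_algebra (\<lambda>x. f x + g x)"
| mult: "bump_algebra f \<Longrightarrow> bump_algebra g \<Longrightarrow> bump_algebra (\<lambda>x. f x * g x)"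

lemma bump_algebra_has_derivative:
  assumes "bump_algebra f"
  shows "\<exists>f'. (\<forall>x. (f has_derivative f' x) (at x)) \<and> (\<forall>v. bump_algebra (\<lambda>x. f' x v))"
  using assms
proof induction
  case (const c)
  show ?case
    by (rule exI[of _ "\<lambda>x v. 0"]) (auto intro: bump_algebra.intros)
next
  case (inner v)
  show ?case
    by (rule exI[of _ "\<lambda>x w. w \<bullet> v"])
      (auto intro: bump_algebra.intros bounded_linear_imp_has_derivative bounded_linear_inner_left)
next
  case (bump m)
  let ?f = "\<lambda>(x::'a) v. (exp_bump (m + 2) (1 - x \<bullet> x) + (- real m) * exp_bump (m + 1) (1 - x \<bullet> x)) *
      ((-2) * (x \<bullet> v))"
  have "((\<lambda>x. exp_bump m (1 - x \<bullet> x)) has_derivative ?f x) (at x)" for x :: 'a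
  proof -
    have "((\<lambda>x. 1 - x \<bullet> x) has_derivative (\<lambda>v. (-2) * (x \<bullet> v))) (at x)"
      by (auto intro!: derivative_eq_intros simp: inner_commute)
    from has_derivative_compose[OF this exp_bump_has_derivative[unfolded has_field_derivative_def]]
    show ?thesis by simp
  qed
  moreover have "bump_algebra (\<lambda>x. ?f x v)" for v
    by (intro bump_algebra.intros)
  ultimately show ?case by (intro exI[of _ ?f] conjI allI)
next
  case (add f g)
  then obtain f' g' where "\<forall>x. (f has_derivative f' x) (at x)" "\<forall>v. bump_algebra (\<lambda>x. f' x v)"
    "\<forall>x. (g has_derivative g' x) (at x)" "\<forall>v. bump_algebra (\<lambda>x. g' x v)" by blast
  then show ?case
    by (intro exI[of _ "\<lambda>x v. f' x v + g' x v"]) (auto intro: bump_algebra.intros has_derivative_add)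
next
  case (mult f g)
  then obtain f' g' where "\<forall>x. (f has_derivative f' x) (at x)" "\<forall>v. bump_algebra (\<lambda>x. f' x v)"
    "\<forall>x. (g has_derivative g' x) (at x)" "\<forall>v. bump_algebra (\<lambda>x. g' x v)" by blast
  then show ?case
    using mult.hyps
    by (intro exI[of _ "\<lambda>x v. f x * g' x v + f' x v * g x"] conjI allI has_derivative_mult
        bump_algebra.add bump_algebra.mult) auto
qed

lemma bump_algebra_C_k: "bump_algebra f \<Longrightarrow> C_k k f"
proof (erule C_k_coinduct)
  fix f :: "'a \<Rightarrow> real" and x v
  assume "bump_algebra f"
  from bump_algebra_has_derivative[OF this] obtain f' where
    f': "\<And>x. (f has_derivative f' x) (at x)" "\<And>v. bump_algebra (\<lambda>x. f' x v)" by blast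
  then have "frechet_derivative f (at x) = f' x" for x
    by (metis frechet_derivative_at)
  with f' show "f differentiable (at x)" "bump_algebra (\<lambda>x. frechet_derivative f (at x) v)"
    by (auto simp: differentiable_def)
qed

section \<open>Closure properties of test functions\<close>

lemma Cc_infinity_iff:
  fixes f :: "'a::euclidean_space \<Rightarrow> 'b::real_normed_vector"
  shows "f \<in> Cc_infinity \<longleftrightarrow> (\<forall>k. C_k k f) \<and> (\<exists>R. \<forall>x. norm x > R \<longrightarrow> f x = 0)"
proof -
  have "compact (closure {x. f x \<noteq> 0}) \<longleftrightarrow> (\<exists>R. \<forall>x. norm x > R \<longrightarrow> f x = 0)"
    unfolding compact_closure bounded_iff by (auto simp: not_le[symmetric])
  then show ?thesis by (simp add: Cc_infinity_def)
qed

lemma Cc_infinityE: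
  fixes f :: "'a::euclidean_space \<Rightarrow> 'b::real_normed_vector"
  assumes "f \<in> Cc_infinity"
  obtains R where "R > 0" "\<And>x. norm x > R \<Longrightarrow> f x = 0"
proof -
  obtain R where "\<forall>x. norm x > R \<longrightarrow> f x = 0" using assms by (auto simp: Cc_infinity_iff)
  then show thesis by (intro that[of "max R 1"]) auto
qed

lemma smooth_bump_exists:
  obtains \<eta> :: "'a::euclidean_space \<Rightarrow> real"
  where "\<eta> \<in> Cc_infinity" "\<And>x. \<eta> x \<ge> 0" "\<And>x. \<eta> x \<le> 1" "\<eta> 0 = 1" "\<And>x. norm x \<ge> 1 \<Longrightarrow> \<eta> x = 0"
proof
  \<comment> \<open>Since \<open>exp_bump 0 1 = exp (- 1)\<close>, the factor \<open>exp 1\<close>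
    normalises the value at the origin, which is the maximum, to 1.\<close>
  let ?\<eta> = "\<lambda>x::'a. exp 1 * exp_bump 0 (1 - x \<bullet> x)"
  have z: "?\<eta> x = 0" if "norm x \<ge> 1" for x
  proof -
    have "x \<bullet> x \<ge> 1" using that power_mono[of 1 "norm x" 2] by (simp add: dot_square_norm)
    then show ?thesis by (simp add: exp_bump_def)
  qed
  have "C_k k ?\<eta>" for k
    by (intro bump_algebra_C_k bump_algebra.intros)
  then show "?\<eta> \<in> Cc_infinity" using z by (force simp: Cc_infinity_iff intro!: exI[of _ 1])
  show "?\<eta> 0 = 1" by (simp add: exp_bump_def exp_minus)
  show "?\<eta> x = 0" if "norm x \<ge> 1" for x using z that .
  show "?\<eta> x \<ge> 0" for x by (simp add: exp_bump_def)
  show "?\<eta> x \<le> 1" for x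
  proof (cases "x \<bullet> x < 1")
    case True
    then have "1 \<le> 1 / (1 - x \<bullet> x)" by (simp add: field_simps)
    then have "exp (1 - 1 / (1 - x \<bullet> x)) \<le> 1" by simp
    then show ?thesis using True by (simp add: exp_bump_def exp_diff exp_minus divide_inverse)
  qed (simp add: exp_bump_def)
qed

lemma Cc_infinity_scaleR:
  fixes f :: "'a::euclidean_space \<Rightarrow> real" and g :: "'a \<Rightarrow> 'b::real_normed_vector"
  assumes "f \<in> Cc_infinity" "g \<in> Cc_infinity"
  shows "(\<lambda>x. f x *\<^sub>R g x) \<in> Cc_infinity"
  using assms C_k_scaleR[of _ f g] by (force simp: Cc_infinity_iff)

lemma Cc_infinity_affine:
  fixes f :: "'a::euclidean_space \<Rightarrow> 'b::real_normed_vector"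
  assumes "f \<in> Cc_infinity" "c \<noteq> 0"
  shows "(\<lambda>x. f (a + c *\<^sub>R x)) \<in> Cc_infinity"
proof -
  obtain R where R: "\<And>x. norm x > R \<Longrightarrow> f x = 0" using Cc_infinityE[OF assms(1)] by blast
  have "f (a + c *\<^sub>R x) = 0" if "norm x > (R + norm a) / \<bar>c\<bar>" for x
  proof (rule R)
    have "R + norm a < norm (c *\<^sub>R x)" using that assms(2) by (simp add: field_simps)
    also have "norm (c *\<^sub>R x) \<le> norm (a + c *\<^sub>R x) + norm a"
      using norm_triangle_ineq4[of "a + c *\<^sub>R x" a] by simp
    finally show "norm (a + c *\<^sub>R x) > R" by simp
  qed
  then show ?thesis using assms C_k_affine[of _ f a c] by (force simp: Cc_infinity_iff)
qed

lemma Cc_infinity_derivative: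
  fixes f :: "'a::euclidean_space \<Rightarrow> 'b::real_normed_vector"
  assumes "f \<in> Cc_infinity"
  shows "(f has_derivative frechet_derivative f (at x)) (at x)"
    and "(\<lambda>x. frechet_derivative f (at x) v) \<in> Cc_infinity"
proof -
  have C: "C_k k f" for k using assms by (simp add: Cc_infinity_iff)
  show "(f has_derivative frechet_derivative f (at x)) (at x)"
    by (rule C_k_SucD(1)[OF C])
  obtain R where R: "\<And>x. norm x > R \<Longrightarrow> f x = 0" using Cc_infinityE[OF assms(1)] by blast
  have "frechet_derivative f (at x) v = 0" if "norm x > R" for x
  proof -
    have "open {x::'a. norm x > R}" by (intro open_Collect_less continuous_intros)
    then have "\<forall>\<^sub>F y in nhds x. f y = 0"
      using eventually_nhds_in_open[of "{x. norm x > R}" x] that R by (auto elim!: eventually_mono)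
    then have ev: "\<forall>\<^sub>F y in at x. 0 = f y"
      by (auto simp: eventually_at_filter elim!: eventually_mono)
    have "((\<lambda>x. 0) has_derivative (\<lambda>v. 0)) (at x)" by simp
    from has_derivative_transform_eventually[OF this ev] that R
    have "(f has_derivative (\<lambda>v. 0)) (at x)" by simp
    then have "frechet_derivative f (at x) = (\<lambda>v. 0)" by (metis frechet_derivative_at)
    then show ?thesis by simp
  qed
  then show "(\<lambda>x. frechet_derivative f (at x) v) \<in> Cc_infinity"
    using C_k_SucD(2)[OF C] by (force simp: Cc_infinity_iff)
qed

section \<open>Increments of test functions and the kernel weight\<close>

lemma Cc_infinity_continuous: "f \<in> Cc_infinity \<Longrightarrow> continuous_on S f"
  by (auto simp: Cc_infinity_def intro: C_k_imp_continuous continuous_on_subset)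

lemma Cc_infinity_borel [measurable_dest]: "f \<in> Cc_infinity \<Longrightarrow> f \<in> borel_measurable borel"
  by (intro borel_measurable_continuous_onI Cc_infinity_continuous)

lemma uniformly_continuous_compact_support:
  fixes f :: "'a::euclidean_space \<Rightarrow> 'b::real_normed_vector"
  assumes f: "continuous_on UNIV f" "\<And>x. norm x > R \<Longrightarrow> f x = 0" and e: "e > 0"
  obtains d where "d > 0" "\<And>x y. norm (y - x) < d \<Longrightarrow> norm (f y - f x) < e"
proof -
  \<comment> \<open>Two points at distance below 1 either both lie outside the ball of radius
    \<open>R\<close>, where \<open>f\<close> vanishes, or both lie in the ball of radius
    \<open>R + 1\<close>.\<close>
  have "uniformly_continuous_on (cball 0 (R + 1)) f"
    using f by (intro compact_uniformly_continuous) (auto intro: continuous_on_subset)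
  then obtain d where d: "d > 0" "\<And>x y. \<lbrakk>x \<in> cball 0 (R + 1); y \<in> cball 0 (R + 1); dist y x < d\<rbrakk>
      \<Longrightarrow> dist (f y) (f x) < e"
    using e unfolding uniformly_continuous_on_def by metis
  show thesis
  proof (rule that[of "min d 1"])
    fix x y :: 'a
    assume xy: "norm (y - x) < min d 1"
    show "norm (f y - f x) < e"
    proof (cases "norm x > R \<and> norm y > R")
      case False
      then have "norm x \<le> R + 1" "norm y \<le> R + 1"
        using xy norm_triangle_sub[of x y] norm_triangle_sub[of y x] by (auto simp: norm_minus_commute)
      then show ?thesis using d(2)[of x y] xy by (auto simp: dist_norm)
    qed (use f e in auto)
  qed (use d in auto)
qed

lemma Cc_infinity_bounded:
  fixes f :: "'a::euclidean_space \<Rightarrow> 'b::real_normed_vector"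
  assumes "f \<in> Cc_infinity"
  obtains M where "M > 0" "\<And>x. norm (f x) \<le> M"
proof -
  obtain R where R: "R > 0" "\<And>x. norm x > R \<Longrightarrow> f x = 0" using Cc_infinityE[OF assms] by blast
  have "compact (f ` cball 0 R)"
    by (intro compact_continuous_image Cc_infinity_continuous assms compact_cball)
  then obtain M where M: "M > 0" "\<And>x. x \<in> cball 0 R \<Longrightarrow> norm (f x) \<le> M"
    using compact_imp_bounded bounded_pos by (metis imageI)
  then have "norm (f x) \<le> M" for x
    using R(2)[of x] by (cases "norm x \<le> R") auto
  with M(1) that show thesis by blast
qed

lemma integrable_compact_support:
  fixes f :: "'a::euclidean_space \<Rightarrow> 'b::{banach, second_countable_topology}"
  assumes "f \<in> borel_measurable borel" "\<And>x. norm (f x) \<le> M" "\<And>x. norm x > R \<Longrightarrow> f x = 0"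
  shows "integrable lborel f"
proof (rule Bochner_Integration.integrable_bound)
  show "integrable lborel (\<lambda>x::'a. M * indicator (cball 0 R) x)"
    using emeasure_bounded_finite[OF bounded_cball, of "0::'a" R]
    by (intro integrable_mult_right integrable_real_indicator) auto
  have "0 \<le> M" using assms(2) norm_ge_zero order_trans by blast
  then show "AE x in lborel. norm (f x) \<le> norm (M * indicator (cball 0 R) x :: real)"
    using assms(2,3) by (intro AE_I2) (auto simp: indicator_def not_le)
qed (use assms in simp)

lemma Cc_infinity_integrable:
  fixes f :: "'a::euclidean_space \<Rightarrow> 'b::{banach, second_countable_topology}"
  assumes "f \<in> Cc_infinity"
  shows "integrable lborel f"
proof -
  obtain M where M: "\<And>x. norm (f x) \<le> M" using Cc_infinity_bounded[OF assms] by blast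
  obtain R where R: "\<And>x. norm x > R \<Longrightarrow> f x = 0" using Cc_infinityE[OF assms] by blast
  show ?thesis
    by (rule integrable_compact_support[OF Cc_infinity_borel[OF assms] M R])
qed

lemma Cc_infinity_lipschitz:
  fixes f :: "'a::euclidean_space \<Rightarrow> 'b::real_normed_vector"
  assumes f: "f \<in> Cc_infinity"
  obtains L where "L > 0" "\<And>x y. norm (f y - f x) \<le> L * norm (y - x)"
proof -
  let ?f' = "\<lambda>x. frechet_derivative f (at x)"
  have "\<exists>M. \<forall>x. norm (?f' x b) \<le> M" for b
    using Cc_infinity_bounded[OF Cc_infinity_derivative(2)[OF f, of b]] by metis
  then obtain M where M: "\<And>b x. norm (?f' x b) \<le> M b" by metis
  let ?L = "\<Sum>b\<in>Basis. M b"
  have "onorm (?f' x) \<le> ?L" for x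
    using M by (intro onorm_componentwise_le sum_mono
        has_derivative_bounded_linear[OF Cc_infinity_derivative(1)[OF f]]) auto
  then have "norm (f y - f x) \<le> ?L * norm (y - x)" for x y
    by (intro differentiable_bound[of UNIV f ?f'] Cc_infinity_derivative(1)[OF f]) auto
  then have "norm (f y - f x) \<le> (\<bar>?L\<bar> + 1) * norm (y - x)" for x y
    by (rule order_trans) (intro mult_right_mono, auto)
  then show thesis by (intro that[of "\<bar>?L\<bar> + 1"]) auto
qed

text \<open>The Lipschitz bound serves for close points and boundedness for distant ones. The two
  indicators record that the increment vanishes when both points leave the support; they supply the
  decay needed for integrability in \<open>x\<close> and \<open>y\<close> jointly.\<close>

lemma Cc_infinity_increment:
  fixes f :: "'a::euclidean_space \<Rightarrow> 'b::real_normed_vector"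
  assumes f: "f \<in> Cc_infinity"
  obtains C R where "C > 0"
    "\<And>x y. norm (f y - f x) \<le> C * min 1 (norm (y - x)) *
      (indicator (cball 0 R) x + indicator (cball 0 R) y)"
    "\<And>x. norm (f x) \<le> C * indicator (cball 0 R) x"
proof -
  obtain L where L: "L > 0" "\<And>x y. norm (f y - f x) \<le> L * norm (y - x)"
    using Cc_infinity_lipschitz[OF f] by blast
  obtain M where M: "M > 0" "\<And>x. norm (f x) \<le> M" using Cc_infinity_bounded[OF f] by blast
  obtain R where R: "R > 0" "\<And>x. norm x > R \<Longrightarrow> f x = 0" using Cc_infinityE[OF f] by blast
  let ?C = "L + 2 * M"
  have *: "norm (f y - f x) \<le> ?C * min 1 (norm (y - x))" for x y
  proof (cases "norm (y - x) \<le> 1")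
    case True
    have "L * norm (y - x) \<le> ?C * norm (y - x)" using M by (intro mult_right_mono) auto
    with L(2)[of y x] True show ?thesis by auto
  next
    case False
    have "norm (f y - f x) \<le> 2 * M" using M(2)[of x] M(2)[of y] norm_triangle_ineq4[of "f y" "f x"] by simp
    with False L(1) show ?thesis by auto
  qed
  show thesis
  proof (rule that[of ?C R])
    fix x y
    show "norm (f y - f x) \<le> ?C * min 1 (norm (y - x)) *
      (indicator (cball 0 R) x + indicator (cball 0 R) y)"
    proof (cases "norm x > R \<and> norm y > R")
      case False
      then have "(1::real) \<le> indicator (cball 0 R) x + indicator (cball 0 R) y"
        by (auto simp: indicator_def)
      then have "?C * min 1 (norm (y - x)) * 1 \<le> ?C * min 1 (norm (y - x)) *
          (indicator (cball 0 R) x + indicator (cball 0 R) y)"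
        using L M by (intro mult_left_mono) auto
      with * show ?thesis by (auto intro: order_trans)
    qed (simp add: R)
    show "norm (f x) \<le> ?C * indicator (cball 0 R) x"
      using M(2)[of x] L R(2)[of x] M(1) by (auto simp: indicator_def)
  qed (use L M in auto)
qed

lemma Cc_infinity_increment_le:
  fixes f :: "'a::euclidean_space \<Rightarrow> 'b::real_normed_vector"
  assumes "f \<in> Cc_infinity"
  obtains C where "C > 0" "\<And>x y. norm (f y - f x) \<le> C * min 1 (norm (y - x))"
proof -
  obtain C R where C: "C > 0" "\<And>x y. norm (f y - f x) \<le> C * min 1 (norm (y - x)) *
      (indicator (cball 0 R) x + indicator (cball 0 R) y)"
    using Cc_infinity_increment[OF assms] by metis
  have "norm (f y - f x) \<le> 2 * C * min 1 (norm (y - x))" for x y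
  proof -
    have "indicator (cball 0 R) x + indicator (cball 0 R) y \<le> (2 :: real)" by (simp add: indicator_def)
    then have "C * min 1 (norm (y - x)) * (indicator (cball 0 R) x + indicator (cball 0 R) y)
        \<le> C * min 1 (norm (y - x)) * 2"
      using C(1) by (intro mult_left_mono) auto
    with C(2)[of y x] show ?thesis by simp
  qed
  with C(1) show thesis by (intro that[of "2 * C"]) auto
qed

section \<open>Reflection and translation invariance of Lebesgue measure\<close>

lemma lborel_distr_reflect: "distr lborel borel (\<lambda>x. a - x) = (lborel :: 'a::euclidean_space measure)"
  using lborel_affine[of "- 1" a] by (simp add: density_1)

lemma lborel_distr_shift: "distr lborel borel (\<lambda>x. a + x) = (lborel :: 'a::euclidean_space measure)"
  using lborel_affine[of 1 a] by (simp add: density_1)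

lemma nn_integral_reflect:
  fixes a :: "'a::euclidean_space"
  assumes [measurable]: "f \<in> borel_measurable borel"
  shows "(\<integral>\<^sup>+x. f (a - x) \<partial>lborel) = (\<integral>\<^sup>+x. f x \<partial>lborel)"
  by (subst lborel_distr_reflect[of a, symmetric]) (simp add: nn_integral_distr)

lemma nn_integral_shift:
  fixes a :: "'a::euclidean_space"
  assumes [measurable]: "f \<in> borel_measurable borel"
  shows "(\<integral>\<^sup>+x. f (a + x) \<partial>lborel) = (\<integral>\<^sup>+x. f x \<partial>lborel)"
  by (subst (2) lborel_distr_shift[of a, symmetric]) (simp add: nn_integral_distr)

lemma integral_reflect:
  fixes a :: "'a::euclidean_space" and f :: "_ \<Rightarrow> 'b::{banach, second_countable_topology}"
  assumes [measurable]: "f \<in> borel_measurable borel"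
  shows "(\<integral>x. f (a - x) \<partial>lborel) = (\<integral>x. f x \<partial>lborel)"
    and "integrable lborel (\<lambda>x. f (a - x)) \<longleftrightarrow> integrable lborel f"
  by (subst (2) lborel_distr_reflect[of a, symmetric], simp add: integral_distr)
    (subst (2) lborel_distr_reflect[of a, symmetric], simp add: integrable_distr_eq)

lemma integral_shift:
  fixes a :: "'a::euclidean_space" and f :: "_ \<Rightarrow> 'b::{banach, second_countable_topology}"
  assumes [measurable]: "f \<in> borel_measurable borel"
  shows "(\<integral>x. f (a + x) \<partial>lborel) = (\<integral>x. f x \<partial>lborel)"
    and "integrable lborel (\<lambda>x. f (a + x)) \<longleftrightarrow> integrable lborel f"
  by (subst (2) lborel_distr_shift[of a, symmetric], simp add: integral_distr)
    (subst (2) lborel_distr_shift[of a, symmetric], simp add: integrable_distr_eq)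

text \<open>Size of the kernel times the largest increment of a function with slope \<open>t\<close>
  and oscillation 1, see \<open>norm_frac_kernel\<close>. Here \<open>1 / t\<close> is the dilation
  factor of the cutoff, and \<open>t = 1\<close> serves for fixed test functions. At the origin the
  value is 0 because \<open>0 / 0 = 0\<close>.\<close>

definition frac_weight :: "real \<Rightarrow> real \<Rightarrow> 'a::euclidean_space \<Rightarrow> real" where
  "frac_weight \<alpha> t z = min 1 (t * norm z) / norm z powr (real DIM('a) + \<alpha>)"

lemma frac_weight_borel [measurable]: "frac_weight \<alpha> t \<in> borel_measurable borel"
  unfolding frac_weight_def by measurable

lemma frac_weight_nonneg: "t \<ge> 0 \<Longrightarrow> frac_weight \<alpha> t z \<ge> 0"
  by (simp add: frac_weight_def)

lemma frac_weight_minus [simp]: "frac_weight \<alpha> t (- z) = frac_weight \<alpha> t z"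
  by (simp add: frac_weight_def)

lemma dyadic_shell:
  fixes r :: real
  assumes "1 \<le> r"
  obtains k :: nat where "2 ^ k \<le> r" "r < 2 ^ Suc k"
proof -
  define k where "k = nat \<lfloor>log 2 r\<rfloor>"
  have "0 \<le> log 2 r" using assms by simp
  then have k: "real k \<le> log 2 r" "log 2 r < real k + 1" by (auto simp: k_def)
  have "2 powr real k \<le> r" "r < 2 powr (real k + 1)"
    using k assms by (auto simp: le_log_iff log_less_iff)
  then show thesis by (intro that[of k]) (auto simp: powr_realpow powr_add)
qed

text \<open>A dyadic substitute for polar coordinates: the volume of the \<open>k\<close>-th ball is
  proportional to \<open>(r ^ DIM('a)) ^ k\<close>, so the integrals form a geometric series of
  ratio \<open>q * r ^ DIM('a)\<close>. It is applied with \<open>r = 2\<close> towards infinity and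
  with \<open>r = 1 / 2\<close> towards the origin.\<close>

lemma summable_ball_series_finite:
  fixes c q :: "real"
  assumes "c \<ge> 0" "0 < q" "0 < r" "q * r ^ DIM('a) < 1"
  shows "(\<integral>\<^sup>+z. (\<Sum>k. ennreal (c * q ^ k) * indicator (ball 0 (2 * r ^ k)) (z::'a::euclidean_space)) \<partial>lborel) < \<infinity>"
proof -
  let ?n = "DIM('a)" and ?V = "unit_ball_vol (DIM('a))"
  have "(\<integral>\<^sup>+z. (\<Sum>k. ennreal (c * q ^ k) * indicator (ball 0 (2 * r ^ k)) (z::'a)) \<partial>lborel)
      = (\<Sum>k. \<integral>\<^sup>+z. ennreal (c * q ^ k) * indicator (ball 0 (2 * r ^ k)) (z::'a) \<partial>lborel)"
    by (intro nn_integral_suminf borel_measurable_times_ennreal borel_measurable_const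
        borel_measurable_indicator) simp
  also have "\<dots> = (\<Sum>k. ennreal (c * ?V * 2 ^ ?n * (q * r ^ ?n) ^ k))"
  proof (intro suminf_cong)
    fix k
    have "(\<integral>\<^sup>+z. ennreal (c * q ^ k) * indicator (ball 0 (2 * r ^ k)) (z::'a) \<partial>lborel)
      = ennreal (c * q ^ k) * ennreal (?V * (2 * r ^ k) ^ ?n)"
      using assms by (subst nn_integral_cmult_indicator) (auto simp: emeasure_ball)
    also have "\<dots> = ennreal (c * ?V * 2 ^ ?n * (q * r ^ ?n) ^ k)"
      using assms by (subst ennreal_mult[symmetric])
        (auto simp: power_mult_distrib mult_ac simp flip: power_mult)
    finally show "(\<integral>\<^sup>+z. ennreal (c * q ^ k) * indicator (ball 0 (2 * r ^ k)) (z::'a) \<partial>lborel)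
      = ennreal (c * ?V * 2 ^ ?n * (q * r ^ ?n) ^ k)" .
  qed
  also have "\<dots> = ennreal (\<Sum>k. c * ?V * 2 ^ ?n * (q * r ^ ?n) ^ k)"
    using assms by (intro suminf_ennreal2 summable_mult summable_geometric) auto
  also have "\<dots> < \<infinity>" by simp
  finally show ?thesis .
qed

text \<open>On the shells going outwards the geometric ratio is \<open>2 powr (- \<alpha>)\<close>,
  on those going inwards it is \<open>2 powr (\<alpha> - 1)\<close>. The two bounds on \<alpha> say
  exactly that both are below 1.\<close>

lemma frac_weight_integrable_1:
  fixes \<alpha> :: real
  assumes \<alpha>: "0 < \<alpha>" "\<alpha> < 1"
  shows "integrable lborel (frac_weight \<alpha> 1 :: 'a::euclidean_space \<Rightarrow> real)"
proof (rule integrableI_bounded)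
  let ?n = "DIM('a)"
  have n: "1 \<le> real ?n" using DIM_positive[where 'a='a] by linarith
  \<comment> \<open>Factors by which the dyadic bounds of the weight change from one shell to the
    next, \<open>p\<close> outwards and \<open>q\<close> inwards.\<close>
  define p q where "p = 2 powr (- (?n + \<alpha>))" and "q = 2 powr (?n + \<alpha> - 1)"
  have pq: "0 < p" "0 < q" by (auto simp: p_def q_def)
  let ?S = "\<lambda>z::'a. \<Sum>k. ennreal (1 * p ^ k) * indicator (ball 0 (2 * 2 ^ k)) z"
  let ?T = "\<lambda>z::'a. \<Sum>k. ennreal (q * q ^ k) * indicator (ball 0 (2 * (1 / 2) ^ k)) z"
  have term_le: "f k \<le> (\<Sum>k. f k)" for f :: "nat \<Rightarrow> ennreal" and k
    using sum_le_suminf[of f "{k}"] by simp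
  have "ennreal (norm (frac_weight \<alpha> 1 z)) \<le> ?S z + ?T z" for z :: 'a
  proof -
    consider "z = 0" | "norm z \<ge> 1" | "z \<noteq> 0" "norm z < 1" by linarith
    then show ?thesis
    proof cases
      case 1
      then show ?thesis by (simp add: frac_weight_def)
    next
      case 2
      then obtain k where k: "2 ^ k \<le> norm z" "norm z < 2 ^ Suc k" using dyadic_shell by blast
      have "norm (frac_weight \<alpha> 1 z) = norm z powr (- (?n + \<alpha>))"
        using 2 unfolding powr_minus_divide by (simp add: frac_weight_def)
      also have "\<dots> \<le> (2 ^ k) powr (- (?n + \<alpha>))"
        using k(1) \<alpha> by (intro powr_mono2') auto
      also have "\<dots> = 1 * p ^ k"
        by (simp add: p_def powr_realpow[symmetric] powr_powr mult.commute)
      finally have "ennreal (norm (frac_weight \<alpha> 1 z)) \<le> ennreal (1 * p ^ k) * indicator (ball 0 (2 * 2 ^ k)) z"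
        using k by (simp add: ennreal_leI)
      also have "\<dots> \<le> ?S z"
        by (rule term_le)
      finally show ?thesis by (simp add: add_increasing2)
    next
      case 3
      then have "1 \<le> 1 / norm z" by simp
      then obtain k where k: "2 ^ k \<le> 1 / norm z" "1 / norm z < 2 ^ Suc k" using dyadic_shell by blast
      have "norm (frac_weight \<alpha> 1 z) = norm z powr 1 / norm z powr (?n + \<alpha>)"
        using 3 by (simp add: frac_weight_def)
      also have "\<dots> = (1 / norm z) powr (?n + \<alpha> - 1)"
        using 3 by (simp add: powr_divide powr_diff)
      also have "\<dots> \<le> (2 ^ Suc k) powr (?n + \<alpha> - 1)"
      proof (rule powr_mono2)
        show "0 \<le> real ?n + \<alpha> - 1" using n \<alpha> by linarith
      qed (use k(2) 3 in auto)
      also have "\<dots> = (2 powr real (Suc k)) powr (?n + \<alpha> - 1)"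
        by (subst powr_realpow) auto
      also have "\<dots> = 2 powr (real (Suc k) * (?n + \<alpha> - 1))"
        by (rule powr_powr)
      also have "\<dots> = q ^ Suc k"
        unfolding q_def by (rule powr_power[symmetric]) simp
      finally have "norm (frac_weight \<alpha> 1 z) \<le> q * q ^ k" by simp
      moreover have "norm z \<le> (1 / 2) ^ k"
        using k(1) 3 by (simp add: field_simps)
      then have "norm z < 2 * (1 / 2) ^ k"
        by (rule le_less_trans) simp
      ultimately have "ennreal (norm (frac_weight \<alpha> 1 z)) \<le> ennreal (q * q ^ k) * indicator (ball 0 (2 * (1 / 2) ^ k)) z"
        by (simp add: ennreal_leI)
      also have "\<dots> \<le> ?T z"
        by (rule term_le)
      finally show ?thesis by (simp add: add_increasing)
    qed
  qed
  then have "(\<integral>\<^sup>+z. ennreal (norm (frac_weight \<alpha> 1 (z::'a))) \<partial>lborel) \<le> (\<integral>\<^sup>+z. ?S z + ?T z \<partial>lborel)"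
    by (rule nn_integral_mono)
  also have "\<dots> = (\<integral>\<^sup>+z. ?S z \<partial>lborel) + (\<integral>\<^sup>+z. ?T z \<partial>lborel)"
    by (intro nn_integral_add borel_measurable_suminf_order borel_measurable_times_ennreal
        borel_measurable_const borel_measurable_indicator) simp_all
  also have "\<dots> < \<infinity>"
  proof -
    have n2: "(2::real) ^ ?n = 2 powr real ?n" by (simp add: powr_realpow)
    have "p * 2 ^ ?n = 2 powr (- (?n + \<alpha>) + ?n)"
      by (simp only: p_def n2 powr_add)
    also have "\<dots> < 1" using \<alpha> by (simp add: powr_less_one)
    finally have "p * 2 ^ ?n < 1" .
    from summable_ball_series_finite[OF _ pq(1) _ this, of 1]
    have S: "(\<integral>\<^sup>+z. ?S z \<partial>lborel) < \<infinity>" by simp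
    have "q * (1 / 2) ^ ?n = 2 powr (?n + \<alpha> - 1 - ?n)"
      by (simp only: q_def power_one_over n2 powr_diff times_divide_eq_right mult_1_right)
    also have "\<dots> < 1" using \<alpha> by (simp add: powr_less_one)
    finally have "q * (1 / 2) ^ ?n < 1" .
    from summable_ball_series_finite[OF _ pq(2) _ this, of q]
    have T: "(\<integral>\<^sup>+z. ?T z \<partial>lborel) < \<infinity>" using pq by simp
    show ?thesis using S T by (simp add: ennreal_add_less_top)
  qed
  finally show "(\<integral>\<^sup>+z. ennreal (norm (frac_weight \<alpha> 1 (z::'a))) \<partial>lborel) < \<infinity>" .
qed measurable

lemma frac_weight_mono: "0 \<le> s \<Longrightarrow> s \<le> t \<Longrightarrow> frac_weight \<alpha> s z \<le> frac_weight \<alpha> t z"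
  unfolding frac_weight_def by (intro divide_right_mono min.mono mult_right_mono) auto

lemma frac_weight_integrable:
  assumes "0 < \<alpha>" "\<alpha> < 1" "0 \<le> t" "t \<le> 1"
  shows "integrable lborel (frac_weight \<alpha> t :: 'a::euclidean_space \<Rightarrow> real)"
  by (rule Bochner_Integration.integrable_bound[OF frac_weight_integrable_1[OF assms(1,2)]])
    (use assms frac_weight_mono[of t 1 \<alpha>] in \<open>auto intro!: AE_I2 simp: frac_weight_nonneg\<close>)

text \<open>Dominated convergence: the weight for \<open>t = 1\<close> is a majorant, and at a fixed
  point the weight is at most a multiple of \<open>t\<close>.\<close>

lemma integral_frac_weight_tendsto_0:
  assumes \<alpha>: "0 < \<alpha>" "\<alpha> < 1"
  shows "(\<lambda>j. \<integral>z. frac_weight \<alpha> (1 / real (Suc j)) (z::'a::euclidean_space) \<partial>lborel) \<longlonglongrightarrow> 0"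
proof -
  have "(\<lambda>j. \<integral>z. frac_weight \<alpha> (1 / real (Suc j)) (z::'a) \<partial>lborel) \<longlonglongrightarrow> integral\<^sup>L lborel (\<lambda>z::'a. 0)"
  proof (rule integral_dominated_convergence[OF _ _ frac_weight_integrable_1[OF \<alpha>]])
    show "AE z in lborel. (\<lambda>j. frac_weight \<alpha> (1 / real (Suc j)) (z::'a)) \<longlonglongrightarrow> 0"
    proof (rule AE_I2)
      fix z :: 'a
      have lim: "(\<lambda>j. (1 / real (Suc j)) * (norm z / norm z powr (real DIM('a) + \<alpha>))) \<longlonglongrightarrow> 0"
        by (intro tendsto_mult_left_zero LIMSEQ_Suc lim_1_over_n)
      show "(\<lambda>j. frac_weight \<alpha> (1 / real (Suc j)) z) \<longlonglongrightarrow> 0"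
      proof (rule tendsto_sandwich[OF always_eventually always_eventually tendsto_const lim]; intro allI)
        show "frac_weight \<alpha> (1 / real (Suc j)) z
          \<le> (1 / real (Suc j)) * (norm z / norm z powr (real DIM('a) + \<alpha>))" for j
          unfolding frac_weight_def times_divide_eq_right by (intro divide_right_mono) auto
        show "0 \<le> frac_weight \<alpha> (1 / real (Suc j)) z" for j
          by (simp add: frac_weight_nonneg)
      qed
    qed
    have "frac_weight \<alpha> (1 / real (Suc j)) z \<le> frac_weight \<alpha> 1 z" for j and z :: 'a
      by (intro frac_weight_mono) auto
    then show "AE z in lborel. norm (frac_weight \<alpha> (1 / real (Suc j)) (z::'a)) \<le> frac_weight \<alpha> 1 z" for j
      by (intro AE_I2) (simp add: frac_weight_nonneg)
  qed simp_all
  then show ?thesis by simp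
qed

section \<open>Jensen's and Young's inequalities\<close>

text \<open>Convexity gives this on the open half-line. The endpoint \<open>t = 0\<close> lies
  outside its domain and amounts to \<open>1 - p \<le> 0\<close>.\<close>

lemma powr_above_tangent:
  fixes p m t :: real
  assumes p: "1 \<le> p" and m: "0 < m" and t: "0 \<le> t"
  shows "m powr p + p * m powr (p - 1) * (t - m) \<le> t powr p"
proof (cases "t = 0")
  case True
  have "m powr p = m powr (p - 1) * m" using m by (simp add: powr_diff)
  then have "m powr p + p * m powr (p - 1) * (t - m) = (1 - p) * m powr p"
    using True by (simp add: algebra_simps)
  also have "\<dots> \<le> 0" using p by (simp add: mult_nonpos_nonneg)
  finally show ?thesis using True by simp
next
  case False
  have "((\<lambda>x. x powr p) has_real_derivative p * m powr (p - 1)) (at m within {0<..})"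
    using m by (auto intro!: derivative_eq_intros)
  then have "p * m powr (p - 1) * (t - m) \<le> t powr p - m powr p"
    using m t False
    by (intro convex_on_imp_above_tangent[OF powr_convex[OF p]]) (auto simp: interior_open)
  then show ?thesis by simp
qed

text \<open>It majorises an L^p function by the sum of a bounded and an integrable one, and stands
  in for Hoelder's inequality in the integrability proofs below.\<close>

lemma le_one_plus_powr: "1 \<le> p \<Longrightarrow> 0 \<le> t \<Longrightarrow> t \<le> 1 + t powr p" for t p :: real
proof (cases "t \<le> 1")
  case False
  assume "1 \<le> p"
  with False have "t powr 1 \<le> t powr p" by (intro powr_mono) auto
  with False show ?thesis by simp
qed (simp add: add_increasing2)

lemma powr_add_le:
  fixes a b p :: real
  assumes "0 \<le> p" "0 \<le> a" "0 \<le> b"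
  shows "(a + b) powr p \<le> 2 powr p * (a powr p + b powr p)"
proof -
  have "(a + b) powr p \<le> (2 * max a b) powr p"
    using assms by (intro powr_mono2) auto
  also have "\<dots> = 2 powr p * max a b powr p"
    using assms by (simp add: powr_mult)
  also have "\<dots> \<le> 2 powr p * (a powr p + b powr p)"
    by (intro mult_left_mono) (auto simp: max_def)
  finally show ?thesis .
qed

text \<open>Jensen's inequality for a weight of arbitrary mass \<open>?W\<close>. The tangent of
  \<open>powr p\<close> at the weighted mean \<open>m = ?I / ?W\<close> lies below the graph;
  multiplied by \<open>w\<close> and integrated, its linear part cancels and leaves
  \<open>?W * m powr p\<close>. The factor \<open>?W powr (p - 1)\<close> then turns this into
  \<open>?I powr p\<close>.\<close>

lemma jensen_powr:
  fixes w h :: "'a \<Rightarrow> real"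
  assumes p: "1 \<le> p"
    and [measurable]: "w \<in> borel_measurable M" "h \<in> borel_measurable M"
    and w: "\<And>u. 0 \<le> w u" "integrable M w"
    and h: "\<And>u. 0 \<le> h u" "integrable M (\<lambda>u. w u * h u powr p)"
  shows "integrable M (\<lambda>u. w u * h u)"
    and "(\<integral>u. w u * h u \<partial>M) powr p \<le> (\<integral>u. w u \<partial>M) powr (p - 1) * (\<integral>u. w u * h u powr p \<partial>M)"
proof -
  let ?W = "\<integral>u. w u \<partial>M" and ?I = "\<integral>u. w u * h u \<partial>M"
  show int: "integrable M (\<lambda>u. w u * h u)"
  proof (rule Bochner_Integration.integrable_bound)
    show "integrable M (\<lambda>u. w u + w u * h u powr p)" using w h by simp
    have "w u * h u \<le> w u * (1 + h u powr p)" for u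
      using w h p by (intro mult_left_mono le_one_plus_powr) auto
    then show "AE u in M. norm (w u * h u) \<le> norm (w u + w u * h u powr p)"
      using w h by (intro AE_I2) (auto simp: algebra_simps)
  qed simp
  have W: "0 \<le> ?W" using w by simp
  have I: "0 \<le> ?I" using w h by (intro integral_nonneg_AE AE_I2) simp
  show "?I powr p \<le> ?W powr (p - 1) * (\<integral>u. w u * h u powr p \<partial>M)"
  proof (cases "?I = 0")
    case True
    then show ?thesis using w h by (auto intro!: mult_nonneg_nonneg integral_nonneg_AE)
  next
    case False
    have "?W \<noteq> 0"
    proof
      assume "?W = 0"
      then have "AE u in M. w u = 0" using w integral_nonneg_eq_0_iff_AE[OF w(2)] by simp
      then have "?I = (\<integral>u. 0 \<partial>M)" by (intro integral_cong_AE) auto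
      with False show False by simp
    qed
    with W have W: "0 < ?W" by simp
    from False I have I: "0 < ?I" by simp
    define m where "m = ?I / ?W"
    have m: "0 < m" using W I by (simp add: m_def)
    have "w u * (m powr p) + p * m powr (p - 1) * (w u * h u) - p * m powr (p - 1) * m * w u
        \<le> w u * h u powr p" for u
      using mult_left_mono[OF powr_above_tangent[OF p m h(1)[of u]] w(1)[of u]]
      by (simp add: algebra_simps)
    then have "(\<integral>u. w u * (m powr p) + p * m powr (p - 1) * (w u * h u) - p * m powr (p - 1) * m * w u \<partial>M)
        \<le> (\<integral>u. w u * h u powr p \<partial>M)"
      using w h int by (intro integral_mono) auto
    also have "(\<integral>u. w u * (m powr p) + p * m powr (p - 1) * (w u * h u) - p * m powr (p - 1) * m * w u \<partial>M)
        = ?W * m powr p + p * m powr (p - 1) * ?I - p * m powr (p - 1) * m * ?W"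
      using w int by simp
    also have "\<dots> = ?W * m powr p" using W by (simp add: m_def)
    finally have "?W powr (p - 1) * (?W * m powr p) \<le> ?W powr (p - 1) * (\<integral>u. w u * h u powr p \<partial>M)"
      by (intro mult_left_mono) auto
    moreover have "?W powr (p - 1) * (?W * m powr p) = ?I powr p"
      using W I by (simp add: m_def powr_divide powr_diff)
    ultimately show ?thesis by simp
  qed
qed

definition Lp_borel :: "real \<Rightarrow> ('a::euclidean_space \<Rightarrow> 'b::euclidean_space) set" where
  "Lp_borel p = {f \<in> borel_measurable borel. integrable lborel (\<lambda>x. norm (f x) powr p)}"

text \<open>Only the \<open>p\<close>-th power of the norm is used for estimates: the crude bound
  \<open>(a + b) powr p \<le> 2 powr p * (a powr p + b powr p)\<close> then replaces Minkowski's inequality.\<close>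

definition Lp_modular :: "real \<Rightarrow> ('a::euclidean_space \<Rightarrow> 'b::euclidean_space) \<Rightarrow> real" where
  "Lp_modular p f = (\<integral>x. norm (f x) powr p \<partial>lborel)"

lemma Lp_borelD:
  assumes "f \<in> Lp_borel p"
  shows "f \<in> borel_measurable borel" "integrable lborel (\<lambda>x. norm (f x) powr p)"
  using assms by (auto simp: Lp_borel_def)

lemma Lp_modular_nonneg: "0 \<le> Lp_modular p f"
  by (simp add: Lp_modular_def)

lemma Lp_borel_bound:
  fixes F :: "'a::euclidean_space \<Rightarrow> 'b::euclidean_space" and G :: "'a \<Rightarrow> 'c::euclidean_space"
  assumes F: "F \<in> borel_measurable borel" and le: "\<And>x. norm (F x) \<le> C * norm (G x)"
    and G: "G \<in> Lp_borel p" and C: "0 \<le> C" "0 \<le> p"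
  shows "F \<in> Lp_borel p" and "Lp_modular p F \<le> C powr p * Lp_modular p G"
proof -
  note [measurable] = F Lp_borelD(1)[OF G]
  have *: "norm (F x) powr p \<le> C powr p * norm (G x) powr p" for x
    using powr_mono2[OF C(2) norm_ge_zero le[of x]] C by (simp add: powr_mult)
  have "integrable lborel (\<lambda>x. norm (F x) powr p)"
    using * by (intro Bochner_Integration.integrable_bound[OF integrable_mult_right[OF Lp_borelD(2)[OF G], of "C powr p"]])
      auto
  then show "F \<in> Lp_borel p" using F by (simp add: Lp_borel_def)
  have "Lp_modular p F \<le> (\<integral>x. C powr p * norm (G x) powr p \<partial>lborel)"
    unfolding Lp_modular_def
    using * \<open>integrable lborel (\<lambda>x. norm (F x) powr p)\<close> Lp_borelD(2)[OF G]
    by (intro integral_mono) auto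
  then show "Lp_modular p F \<le> C powr p * Lp_modular p G" by (simp add: Lp_modular_def)
qed

lemma Lp_borel_add:
  fixes f g :: "'a::euclidean_space \<Rightarrow> 'b::euclidean_space"
  assumes f: "f \<in> Lp_borel p" and g: "g \<in> Lp_borel p" and p: "0 \<le> p"
  shows "(\<lambda>x. f x + g x) \<in> Lp_borel p"
    and "Lp_modular p (\<lambda>x. f x + g x) \<le> 2 powr p * (Lp_modular p f + Lp_modular p g)"
proof -
  note [measurable] = Lp_borelD(1)[OF f] Lp_borelD(1)[OF g]
  have *: "norm (f x + g x) powr p \<le> 2 powr p * (norm (f x) powr p + norm (g x) powr p)" for x
    using powr_mono2[OF p norm_ge_zero norm_triangle_ineq[of "f x" "g x"]]
      powr_add_le[OF p norm_ge_zero norm_ge_zero, of "f x" "g x"] by linarith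
  have int: "integrable lborel (\<lambda>x. 2 powr p * (norm (f x) powr p + norm (g x) powr p))"
    using Lp_borelD(2)[OF f] Lp_borelD(2)[OF g] by simp
  have int': "integrable lborel (\<lambda>x. norm (f x + g x) powr p)"
    using * by (intro Bochner_Integration.integrable_bound[OF int]) auto
  then show "(\<lambda>x. f x + g x) \<in> Lp_borel p" by (simp add: Lp_borel_def)
  have "Lp_modular p (\<lambda>x. f x + g x) \<le> (\<integral>x. 2 powr p * (norm (f x) powr p + norm (g x) powr p) \<partial>lborel)"
    unfolding Lp_modular_def using * int int' by (intro integral_mono) auto
  then show "Lp_modular p (\<lambda>x. f x + g x) \<le> 2 powr p * (Lp_modular p f + Lp_modular p g)"
    using Lp_borelD(2)[OF f] Lp_borelD(2)[OF g] by (simp add: Lp_modular_def)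
qed

lemma Lp_borel_uminus:
  assumes "f \<in> Lp_borel p"
  shows "(\<lambda>x. - f x) \<in> Lp_borel p" "Lp_modular p (\<lambda>x. - f x) = Lp_modular p f"
  using assms by (auto simp: Lp_borel_def Lp_modular_def)

lemma Lp_borel_diff:
  fixes f g :: "'a::euclidean_space \<Rightarrow> 'b::euclidean_space"
  assumes f: "f \<in> Lp_borel p" and g: "g \<in> Lp_borel p" and p: "0 \<le> p"
  shows "(\<lambda>x. f x - g x) \<in> Lp_borel p"
    and "Lp_modular p (\<lambda>x. f x - g x) \<le> 2 powr p * (Lp_modular p f + Lp_modular p g)"
  using Lp_borel_add[OF f Lp_borel_uminus(1)[OF g] p] Lp_borel_uminus(2)[OF g] by simp_all

lemma Lp_borel_of_bounded_integrable:
  fixes f :: "'a::euclidean_space \<Rightarrow> 'b::euclidean_space"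
  assumes f: "integrable lborel f" and M: "\<And>x. norm (f x) \<le> M" and p: "1 \<le> p"
  shows "f \<in> Lp_borel p"
proof -
  have [measurable]: "f \<in> borel_measurable borel" using f by (simp add: borel_measurable_integrable)
  have "norm (f x) powr p \<le> M powr (p - 1) * norm (f x)" for x
  proof (cases "f x = 0")
    case False
    then have "norm (f x) powr p = norm (f x) powr (p - 1) * norm (f x)"
      by (simp add: powr_diff)
    also have "\<dots> \<le> M powr (p - 1) * norm (f x)"
      using M p by (intro mult_right_mono powr_mono2) auto
    finally show ?thesis .
  qed simp
  then have "integrable lborel (\<lambda>x. norm (f x) powr p)"
    by (intro Bochner_Integration.integrable_bound[OF integrable_mult_right[OF integrable_norm[OF f], of "M powr (p - 1)"]])
      auto
  then show ?thesis by (simp add: Lp_borel_def)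
qed

text \<open>The product is at most \<open>(1 + norm (f x) powr p) * norm (g x)\<close>: in the first
  summand \<open>g\<close> is integrable, in the second it is bounded. In this way an L^p function
  is paired with a test field or with its fractional divergence.\<close>

lemma Lp_borel_times_bounded_integrable:
  fixes f :: "'a::euclidean_space \<Rightarrow> 'b::euclidean_space" and g :: "'a \<Rightarrow> 'c::euclidean_space"
    and F :: "'a \<Rightarrow> 'd::euclidean_space"
  assumes f: "f \<in> Lp_borel p" and g: "integrable lborel g" and M: "\<And>x. norm (g x) \<le> M"
    and p: "1 \<le> p" and F: "F \<in> borel_measurable borel" "\<And>x. norm (F x) \<le> norm (f x) * norm (g x)"
  shows "integrable lborel F"
proof (rule Bochner_Integration.integrable_bound)
  show "integrable lborel (\<lambda>x. M * norm (f x) powr p + norm (g x))"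
    using Lp_borelD(2)[OF f] g by simp
  have "norm (F x) \<le> M * norm (f x) powr p + norm (g x)" for x
  proof -
    have "norm (F x) \<le> (1 + norm (f x) powr p) * norm (g x)"
      using F(2)[of x] mult_right_mono[OF le_one_plus_powr[OF p norm_ge_zero[of "f x"]] norm_ge_zero[of "g x"]]
      by linarith
    also have "\<dots> \<le> M * norm (f x) powr p + norm (g x)"
      using mult_right_mono[OF M[of x], of "norm (f x) powr p"] by (simp add: algebra_simps)
    finally show ?thesis .
  qed
  then show "AE x in lborel. norm (F x) \<le> norm (M * norm (f x) powr p + norm (g x))"
    by (intro AE_I2) (simp add: order_trans[OF _ abs_ge_self])
qed (use F in simp)

text \<open>Jensen's inequality at almost every \<open>x\<close>, then Tonelli. Only domination of
  \<open>F\<close> by a convolution is asked, which covers mollification and the commutator alike.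
  The domination is demanded only where the convolution integral converges, since a divergent
  Bochner integral has the value 0 and would bound nothing.\<close>

lemma young_modular:
  fixes w :: "'a::euclidean_space \<Rightarrow> real" and f :: "'a \<Rightarrow> 'b::euclidean_space"
    and F :: "'a \<Rightarrow> 'c::euclidean_space"
  assumes p: "1 \<le> p" and w: "\<And>u. 0 \<le> w u" "integrable lborel w" and f: "f \<in> Lp_borel p"
    and F: "F \<in> borel_measurable borel"
    and le: "\<And>x. integrable lborel (\<lambda>u. w u * norm (f (x - u))) \<Longrightarrow>
      norm (F x) \<le> (\<integral>u. w u * norm (f (x - u)) \<partial>lborel)"
  shows "F \<in> Lp_borel p" and "Lp_modular p F \<le> (\<integral>u. w u \<partial>lborel) powr p * Lp_modular p f"
proof -
  let ?W = "\<integral>u. w u \<partial>lborel"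
  note [measurable] = F Lp_borelD(1)[OF f]
  have [measurable]: "w \<in> borel_measurable borel" using w by (simp add: borel_measurable_integrable)
  have W: "0 \<le> ?W" using w by simp
  have Wf: "0 \<le> Lp_modular p f" by (rule Lp_modular_nonneg)
  let ?G = "\<lambda>x. \<integral>\<^sup>+u. ennreal (w u * norm (f (x - u)) powr p) \<partial>lborel"
  have "(\<integral>\<^sup>+x. ?G x \<partial>lborel) = (\<integral>\<^sup>+u. \<integral>\<^sup>+x. ennreal (w u * norm (f (x - u)) powr p) \<partial>lborel \<partial>lborel)"
    by (rule lborel_pair.Fubini') simp
  also have "\<dots> = (\<integral>\<^sup>+u. ennreal (w u) * (\<integral>\<^sup>+x. ennreal (norm (f (- u + x)) powr p) \<partial>lborel) \<partial>lborel)"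
    using w(1) by (simp add: nn_integral_cmult[symmetric] ennreal_mult')
  also have "\<dots> = (\<integral>\<^sup>+u. ennreal (w u) * (\<integral>\<^sup>+x. ennreal (norm (f x) powr p) \<partial>lborel) \<partial>lborel)"
    by (subst nn_integral_shift[where f = "\<lambda>x. ennreal (norm (f x) powr p)"]) simp_all
  also have "\<dots> = ennreal ?W * ennreal (Lp_modular p f)"
    using w Lp_borelD(2)[OF f]
    by (simp add: nn_integral_multc nn_integral_eq_integral Lp_modular_def)
  finally have G: "(\<integral>\<^sup>+x. ?G x \<partial>lborel) = ennreal (?W * Lp_modular p f)"
    using W Wf by (simp add: ennreal_mult)
  have "AE x in lborel. ?G x \<noteq> \<infinity>"
    by (rule nn_integral_PInf_AE) (auto simp: G)
  then have "AE x in lborel. ennreal (norm (F x) powr p) \<le> ennreal (?W powr (p - 1)) * ?G x"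
  proof (rule AE_mp, intro AE_I2 impI)
    fix x assume "?G x \<noteq> \<infinity>"
    then have int: "integrable lborel (\<lambda>u. w u * norm (f (x - u)) powr p)"
      using w(1) by (intro integrableI_bounded) (auto simp: less_top)
    have J: "integrable lborel (\<lambda>u. w u * norm (f (x - u)))"
      "(\<integral>u. w u * norm (f (x - u)) \<partial>lborel) powr p
        \<le> ?W powr (p - 1) * (\<integral>u. w u * norm (f (x - u)) powr p \<partial>lborel)"
      by (rule jensen_powr[OF p _ _ w _ int]; simp)+
    have "norm (F x) powr p \<le> (\<integral>u. w u * norm (f (x - u)) \<partial>lborel) powr p"
      using le[OF J(1)] p by (intro powr_mono2) auto
    with J(2) have "norm (F x) powr p \<le> ?W powr (p - 1) * (\<integral>u. w u * norm (f (x - u)) powr p \<partial>lborel)"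
      by linarith
    also have "(\<integral>u. w u * norm (f (x - u)) powr p \<partial>lborel) = enn2real (?G x)"
      using w(1) int by (subst nn_integral_eq_integral) auto
    finally have "ennreal (norm (F x) powr p) \<le> ennreal (?W powr (p - 1) * enn2real (?G x))"
      by (rule ennreal_leI)
    also have "\<dots> = ennreal (?W powr (p - 1)) * ?G x"
      using \<open>?G x \<noteq> \<infinity>\<close> by (simp add: ennreal_mult less_top)
    finally show "ennreal (norm (F x) powr p) \<le> ennreal (?W powr (p - 1)) * ?G x" .
  qed
  then have "(\<integral>\<^sup>+x. ennreal (norm (F x) powr p) \<partial>lborel)
      \<le> (\<integral>\<^sup>+x. ennreal (?W powr (p - 1)) * ?G x \<partial>lborel)"
    by (rule nn_integral_mono_AE)
  also have "\<dots> = ennreal (?W powr (p - 1)) * ennreal (?W * Lp_modular p f)"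
    by (subst nn_integral_cmult) (simp_all add: G)
  also have "\<dots> = ennreal (?W powr p * Lp_modular p f)"
    using W Wf by (cases "?W = 0") (simp_all add: ennreal_mult[symmetric] powr_diff)
  finally have le: "(\<integral>\<^sup>+x. ennreal (norm (F x) powr p) \<partial>lborel) \<le> ennreal (?W powr p * Lp_modular p f)" .
  then have int: "integrable lborel (\<lambda>x. norm (F x) powr p)"
    by (intro integrableI_bounded) (auto intro: le_less_trans)
  then show "F \<in> Lp_borel p" using F by (simp add: Lp_borel_def)
  show "Lp_modular p F \<le> ?W powr p * Lp_modular p f"
    using le int Wf by (simp add: nn_integral_eq_integral Lp_modular_def)
qed

section \<open>Density of continuous functions and mollification\<close>

lemma Lp_modular_tendsto_0:
  fixes g :: "'a::euclidean_space \<Rightarrow> 'c::euclidean_space" and s :: "nat \<Rightarrow> 'a \<Rightarrow> 'b::euclidean_space"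
  assumes g: "g \<in> Lp_borel p" and p: "1 \<le> p"
    and s: "\<And>j. s j \<in> borel_measurable borel" "\<And>j x. norm (s j x) \<le> norm (g x)"
    and lim: "AE x in lborel. (\<lambda>j. s j x) \<longlonglongrightarrow> 0"
  shows "(\<lambda>j. Lp_modular p (s j)) \<longlonglongrightarrow> 0"
proof -
  note [measurable] = s(1)
  have "(\<lambda>j. \<integral>x. norm (s j x) powr p \<partial>lborel) \<longlonglongrightarrow> integral\<^sup>L lborel (\<lambda>x::'a. 0)"
  proof (rule integral_dominated_convergence[OF _ _ Lp_borelD(2)[OF g]])
    show "AE x in lborel. (\<lambda>j. norm (s j x) powr p) \<longlonglongrightarrow> 0"
      using lim
    proof (rule AE_mp, intro AE_I2 impI)
      fix x assume "(\<lambda>j. s j x) \<longlonglongrightarrow> 0"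
      then have "(\<lambda>j. norm (s j x)) \<longlonglongrightarrow> 0" by (rule tendsto_norm_zero)
      moreover have "\<forall>\<^sub>F j in sequentially. 0 \<le> norm (s j x)" by simp
      ultimately show "(\<lambda>j. norm (s j x) powr p) \<longlonglongrightarrow> 0"
        using tendsto_powr'[of "\<lambda>j. norm (s j x)" 0 sequentially "\<lambda>_. p" p] p by simp
    qed
    show "AE x in lborel. norm (norm (s j x) powr p) \<le> norm (g x) powr p" for j
      using s(2) p by (intro AE_I2) (simp add: powr_mono2)
  qed simp_all
  then show ?thesis by (simp add: Lp_modular_def)
qed

lemma Lp_borel_truncate:
  fixes f :: "'a::euclidean_space \<Rightarrow> 'b::euclidean_space"
  assumes f: "f \<in> Lp_borel p" and p: "1 \<le> p" and d: "0 < d"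
  obtains N where "0 < N"
    "Lp_modular p (\<lambda>x. f x - (if norm (f x) \<le> N \<and> norm x \<le> N then f x else 0)) < d"
proof -
  note [measurable] = Lp_borelD(1)[OF f]
  let ?s = "\<lambda>j x. f x - (if norm (f x) \<le> real (Suc j) \<and> norm x \<le> real (Suc j) then f x else 0)"
  have "(\<lambda>j. Lp_modular p (?s j)) \<longlonglongrightarrow> 0"
  proof (rule Lp_modular_tendsto_0[OF f p])
    show "AE x in lborel. (\<lambda>j. ?s j x) \<longlonglongrightarrow> 0"
    proof (intro AE_I2 tendsto_eventually)
      fix x
      obtain k where k: "real k \<ge> max (norm (f x)) (norm x)" using real_arch_simple by blast
      then show "\<forall>\<^sub>F j in sequentially. ?s j x = 0"
        by (intro eventually_sequentiallyI[of k]) auto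
    qed
  qed auto
  from order_tendstoD(2)[OF this d] obtain j where "Lp_modular p (?s j) < d"
    by (auto simp: eventually_sequentially)
  then show thesis by (intro that[of "real (Suc j)"]) auto
qed

lemma Lp_borel_compact_support:
  fixes h :: "'a::euclidean_space \<Rightarrow> 'b::euclidean_space"
  assumes h: "h \<in> borel_measurable borel" and M: "\<And>x. norm (h x) \<le> M"
    and R: "\<And>x. norm x > R \<Longrightarrow> h x = 0" and p: "1 \<le> p"
  shows "h \<in> Lp_borel p"
  by (rule Lp_borel_of_bounded_integrable[OF integrable_compact_support[OF h M R] M p])

text \<open>A measurable function is an almost everywhere limit of continuous ones, but these need
  not be dominated. Truncating \<open>f\<close> to a bounded \<open>F\<close> of bounded support
  first allows the approximants to be clipped to the same bounds without disturbing the
  limit.\<close>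

lemma Lp_borel_approx_continuous:
  fixes f :: "'a::euclidean_space \<Rightarrow> 'b::euclidean_space"
  assumes f: "f \<in> Lp_borel p" and p: "1 \<le> p" and d: "0 < d"
  obtains h R where "continuous_on UNIV h" "\<And>x. norm x > R \<Longrightarrow> h x = 0" "h \<in> Lp_borel p"
    "Lp_modular p (\<lambda>x. f x - h x) < d"
proof -
  \<comment> \<open>Two errors of this size, added with the factor \<open>2 powr p\<close> of
    \<open>Lp_borel_add\<close>, amount to \<open>d\<close>.\<close>
  have c: "0 < d / (2 * 2 powr p)" using d by simp
  obtain N where N: "0 < N"
    "Lp_modular p (\<lambda>x. f x - (if norm (f x) \<le> N \<and> norm x \<le> N then f x else 0)) < d / (2 * 2 powr p)"
    using Lp_borel_truncate[OF f p c] by blast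
  define F where "F = (\<lambda>x. if norm (f x) \<le> N \<and> norm x \<le> N then f x else 0)"
  note [measurable] = Lp_borelD(1)[OF f]
  have F[measurable]: "F \<in> borel_measurable borel" unfolding F_def by measurable
  have FN: "norm (F x) \<le> N" "norm x > N \<Longrightarrow> F x = 0" for x using N by (auto simp: F_def)
  have FL: "F \<in> Lp_borel p" by (rule Lp_borel_compact_support[OF F FN p])
  have "F \<in> borel_measurable lebesgue" by (intro measurable_completion) simp
  then have "F measurable_on UNIV" by (subst measurable_on_iff_borel_measurable) auto
  then obtain S g where S: "negligible S" and g: "\<And>n. continuous_on UNIV (g n)"
    "\<And>x. x \<notin> S \<Longrightarrow> (\<lambda>n. g n x) \<longlonglongrightarrow> F x"
    unfolding measurable_on_def by auto
  \<comment> \<open>\<open>cutoff\<close> is 1 on the ball of radius \<open>N\<close> and 0 beyond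
    \<open>N + 1\<close>; \<open>cl\<close> is the radial retraction onto the ball of radius
    \<open>N\<close>. Both leave \<open>F\<close> unchanged, and both are continuous.\<close>
  define cutoff where "cutoff = (\<lambda>x::'a. max 0 (min 1 (N + 1 - norm x)))"
  define cl where "cl = (\<lambda>v::'b. (1 / max 1 (norm v / N)) *\<^sub>R v)"
  define h where "h = (\<lambda>n x. cutoff x *\<^sub>R cl (g n x))"
  have cut01: "0 \<le> cutoff x" "cutoff x \<le> 1" "norm x > N + 1 \<Longrightarrow> cutoff x = 0" for x by (auto simp: cutoff_def)
  have cl: "norm (cl v) \<le> N" for v
    using N(1) by (auto simp: cl_def max_def field_simps)
  have cl_id: "cl v = v" if "norm v \<le> N" for v
    using that N(1) by (simp add: cl_def max_def)
  have cont_cl: "continuous_on UNIV cl"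
    unfolding cl_def using N(1) by (intro continuous_intros) auto
  have hc: "continuous_on UNIV (h n)" for n
  proof -
    have "continuous_on UNIV (\<lambda>x. cl (g n x))"
      by (rule continuous_on_compose2[OF cont_cl g(1)]) auto
    then show ?thesis unfolding h_def cutoff_def by (intro continuous_intros)
  qed
  then have hb[measurable]: "h n \<in> borel_measurable borel" for n by (rule borel_measurable_continuous_onI)
  have hN: "norm (h n x) \<le> N" for n x
    using mult_mono[OF cut01(2)[of x] cl[of "g n x"]] cut01(1)[of x] by (simp add: h_def)
  have h0: "norm x > N + 1 \<Longrightarrow> h n x = 0" for n x by (simp add: h_def cut01)
  have hL: "h n \<in> Lp_borel p" for n by (rule Lp_borel_compact_support[OF hb hN h0 p])
  have hF: "(\<lambda>n. h n x) \<longlonglongrightarrow> F x" if "x \<notin> S" for x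
  proof -
    have "isCont cl (F x)" using cont_cl by (simp add: continuous_on_eq_continuous_at)
    from isCont_tendsto_compose[OF this g(2)[OF that]]
    have "(\<lambda>n. h n x) \<longlonglongrightarrow> cutoff x *\<^sub>R cl (F x)" unfolding h_def by (intro tendsto_intros)
    moreover have "cutoff x *\<^sub>R cl (F x) = F x"
      using FN[of x] by (cases "norm x \<le> N") (auto simp: cl_id cutoff_def)
    ultimately show ?thesis by simp
  qed
  have "(\<lambda>n. Lp_modular p (\<lambda>x. F x - h n x)) \<longlonglongrightarrow> 0"
  proof (rule Lp_modular_tendsto_0[OF _ p])
    let ?g = "\<lambda>x::'a. 2 * N * indicator (cball 0 (N + 1)) x :: real"
    show "?g \<in> Lp_borel p"
      by (rule Lp_borel_compact_support[where M = "2 * N" and R = "N + 1", OF _ _ _ p])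
        (use N in \<open>auto simp: indicator_def\<close>)
    show "norm (F x - h n x) \<le> norm (?g x)" for n x
    proof (cases "norm x > N + 1")
      case False
      have "norm (F x - h n x) \<le> 2 * N"
        using norm_triangle_ineq4[of "F x" "h n x"] FN(1)[of x] hN[of n x] by linarith
      then show ?thesis using False N(1) by simp
    qed (simp add: FN h0)
    have "AE x in lebesgue. x \<notin> S"
      using S by (simp add: negligible_iff_null_sets AE_not_in)
    then have "AE x in lborel. x \<notin> S" by (simp add: AE_completion_iff)
    then show "AE x in lborel. (\<lambda>n. F x - h n x) \<longlonglongrightarrow> 0"
    proof (rule AE_mp, intro AE_I2 impI)
      fix x assume "x \<notin> S"
      from tendsto_diff[OF tendsto_const hF[OF this], of "F x"] show "(\<lambda>n. F x - h n x) \<longlonglongrightarrow> 0" by simp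
    qed
  qed simp
  from order_tendstoD(2)[OF this c] obtain n where n: "Lp_modular p (\<lambda>x. F x - h n x) < d / (2 * 2 powr p)"
    by (auto simp: eventually_sequentially)
  have "Lp_modular p (\<lambda>x. f x - h n x) = Lp_modular p (\<lambda>x. (f x - F x) + (F x - h n x))" by simp
  also have "\<dots> \<le> 2 powr p * (Lp_modular p (\<lambda>x. f x - F x) + Lp_modular p (\<lambda>x. F x - h n x))"
    using p by (intro Lp_borel_add Lp_borel_diff f FL hL) auto
  also have "\<dots> < 2 powr p * (d / (2 * 2 powr p) + d / (2 * 2 powr p))"
    using N(2) n by (intro mult_strict_left_mono add_strict_mono) (auto simp: F_def)
  also have "\<dots> = d" by (simp add: field_simps)
  finally show thesis using that[OF hc h0 hL] by blast
qed

section \<open>Convolution and mollifiers\<close>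

definition convolution :: "('a::euclidean_space \<Rightarrow> real) \<Rightarrow> ('a \<Rightarrow> 'b::euclidean_space) \<Rightarrow> 'a \<Rightarrow> 'b" where
  "convolution h f x = (\<integral>u. h u *\<^sub>R f (x - u) \<partial>lborel)"

definition mollifier :: "real \<Rightarrow> ('a::euclidean_space \<Rightarrow> real) \<Rightarrow> bool" where
  "mollifier r \<rho> \<longleftrightarrow> \<rho> \<in> Cc_infinity \<and> (\<forall>x. 0 \<le> \<rho> x) \<and> (\<integral>x. \<rho> x \<partial>lborel) = 1 \<and> (\<forall>x. norm x > r \<longrightarrow> \<rho> x = 0)"

lemma Cc_infinity_cmult:
  fixes f :: "'a::euclidean_space \<Rightarrow> 'b::real_normed_vector"
  assumes "f \<in> Cc_infinity"
  shows "(\<lambda>x. c *\<^sub>R f x) \<in> Cc_infinity"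
proof -
  obtain R where "\<forall>x. norm x > R \<longrightarrow> c *\<^sub>R f x = 0"
    using Cc_infinityE[OF assms] by (metis scaleR_zero_right)
  moreover have "C_k k (\<lambda>x. c *\<^sub>R f x)" for k
    using assms by (intro C_k_scaleR C_k_const) (simp add: Cc_infinity_iff)
  ultimately show ?thesis unfolding Cc_infinity_iff by blast
qed

lemma mollifier_exists:
  assumes r: "0 < r"
  obtains \<rho> :: "'a::euclidean_space \<Rightarrow> real" where "mollifier r \<rho>"
proof -
  obtain \<eta> :: "'a \<Rightarrow> real" where \<eta>: "\<eta> \<in> Cc_infinity" "\<And>x. \<eta> x \<ge> 0" "\<eta> 0 = 1"
    "\<And>x. norm x \<ge> 1 \<Longrightarrow> \<eta> x = 0"
    using smooth_bump_exists[where ?'a = 'a] by metis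
  define g where "g = (\<lambda>x. \<eta> (0 + (1 / r) *\<^sub>R x))"
  have g: "g \<in> Cc_infinity" unfolding g_def by (rule Cc_infinity_affine) (use \<eta> r in auto)
  note [measurable] = Cc_infinity_borel[OF g]
  have "isCont g 0" using Cc_infinity_continuous[OF g, of UNIV] by (simp add: continuous_on_eq_continuous_at)
  from this[unfolded continuous_at_eps_delta, rule_format, of "1 / 2"] obtain d where d: "0 < d" "\<And>x. norm x < d \<Longrightarrow> \<bar>g x - 1\<bar> < 1 / 2"
    using \<eta>(3) by (auto simp: g_def dist_norm)
  have "0 < 1 / 2 * measure lborel (ball (0::'a) d)" using content_ball_pos[OF d(1)] by simp
  also have "\<dots> = (\<integral>x. 1 / 2 * indicator (ball (0::'a) d) x \<partial>lborel)" by simp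
  also have "\<dots> \<le> (\<integral>x. g x \<partial>lborel)"
  proof (rule integral_mono)
    show "integrable lborel (\<lambda>x::'a. 1 / 2 * indicator (ball 0 d) x :: real)"
      using emeasure_bounded_finite[OF bounded_ball, of "0::'a" d]
      by (intro integrable_mult_right integrable_real_indicator) auto
    show "1 / 2 * indicator (ball 0 d) x \<le> g x" for x
    proof (cases "norm x < d")
      case True
      then have "1 / 2 \<le> g x" using d(2)[of x] by linarith
      with True show ?thesis by simp
    qed (use \<eta>(2) in \<open>simp add: g_def\<close>)
  qed (rule Cc_infinity_integrable[OF g])
  finally have I: "0 < (\<integral>x. g x \<partial>lborel)" .
  show thesis
  proof (rule that)
    let ?\<rho> = "\<lambda>x. (1 / (\<integral>x. g x \<partial>lborel)) *\<^sub>R g x"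
    have "?\<rho> \<in> Cc_infinity" by (rule Cc_infinity_cmult[OF g])
    moreover have "g x = 0" if "norm x > r" for x
      using \<eta>(4)[of "(1 / r) *\<^sub>R x"] that r by (simp add: g_def)
    ultimately show "mollifier r ?\<rho>"
      using I \<eta>(2) by (auto simp: mollifier_def g_def)
  qed
qed

lemma integrable_convolution:
  fixes f :: "'a::euclidean_space \<Rightarrow> 'b::euclidean_space"
  assumes \<rho>: "\<rho> \<in> Cc_infinity" and f: "f \<in> Lp_borel p" and p: "1 \<le> p"
  shows "integrable lborel (\<lambda>u. \<rho> u *\<^sub>R f (x - u))"
proof -
  note [measurable] = Cc_infinity_borel[OF \<rho>] Lp_borelD(1)[OF f]
  obtain M where M: "\<And>x. norm (\<rho> x) \<le> M" using Cc_infinity_bounded[OF \<rho>] by blast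
  have "(\<lambda>u. f (x - u)) \<in> Lp_borel p"
    using f integral_reflect(2)[of "\<lambda>x. norm (f x) powr p" x] by (simp add: Lp_borel_def)
  from this Cc_infinity_integrable[OF \<rho>] M p show ?thesis
    by (rule Lp_borel_times_bounded_integrable) (auto simp: mult.commute)
qed

lemma convolution_borel [measurable]:
  fixes f :: "'a::euclidean_space \<Rightarrow> 'b::euclidean_space"
  assumes [measurable]: "h \<in> borel_measurable borel" "f \<in> borel_measurable borel"
  shows "convolution h f \<in> borel_measurable borel"
  unfolding convolution_def[abs_def] by measurable

lemma mollify_contraction:
  fixes f :: "'a::euclidean_space \<Rightarrow> 'b::euclidean_space"
  assumes \<rho>: "mollifier r \<rho>" and f: "f \<in> Lp_borel p" and p: "1 \<le> p"
  shows "convolution \<rho> f \<in> Lp_borel p" "Lp_modular p (convolution \<rho> f) \<le> Lp_modular p f"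
proof -
  have \<rho>': "\<rho> \<in> Cc_infinity" "\<And>x. 0 \<le> \<rho> x" "(\<integral>x. \<rho> x \<partial>lborel) = 1"
    using \<rho> by (auto simp: mollifier_def)
  note [measurable] = Cc_infinity_borel[OF \<rho>'(1)] Lp_borelD(1)[OF f]
  have "norm (convolution \<rho> f x) \<le> (\<integral>u. \<rho> u * norm (f (x - u)) \<partial>lborel)" for x
    using integral_norm_bound[of lborel "\<lambda>u. \<rho> u *\<^sub>R f (x - u)"] \<rho>'(2) by (simp add: convolution_def)
  from young_modular[OF p \<rho>'(2) Cc_infinity_integrable[OF \<rho>'(1)] f _ this] \<rho>'(3)
  show "convolution \<rho> f \<in> Lp_borel p" "Lp_modular p (convolution \<rho> f) \<le> Lp_modular p f" by simp_all
qed

text \<open>For a continuous \<open>h\<close> of compact support the mollification is uniformly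
  close to \<open>h\<close>, with support enlarged by at most 1; on the remainder
  \<open>f - h\<close>, small in L^p, mollification is a contraction. The claim covers every
  mollifier of small radius, so that a single one can later serve a function and its
  gradient.\<close>

lemma mollify_approximates:
  fixes f :: "'a::euclidean_space \<Rightarrow> 'b::euclidean_space"
  assumes f: "f \<in> Lp_borel p" and p: "1 \<le> p" and d: "0 < d"
  obtains r0 where "0 < r0"
    "\<And>r \<rho>. r \<le> r0 \<Longrightarrow> mollifier r \<rho> \<Longrightarrow> Lp_modular p (\<lambda>x. convolution \<rho> f x - f x) < d"
proof -
  let ?c = "2 powr p"
  \<comment> \<open>One halving and one factor \<open>?c\<close> for each triangle inequality:
    \<open>?H\<close> and \<open>?G\<close> may each cost \<open>d1\<close>, and the two terms of
    \<open>?G\<close> may each cost \<open>d2\<close>.\<close>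
  define d1 where "d1 = d / (2 * ?c)"
  define d2 where "d2 = d1 / (2 * ?c)"
  have d12: "0 < d1" "0 < d2" using d by (auto simp: d1_def d2_def)
  obtain h R where h: "continuous_on UNIV h" "\<And>x. norm x > R \<Longrightarrow> h x = 0" "h \<in> Lp_borel p"
    and fh: "Lp_modular p (\<lambda>x. f x - h x) < d2"
    using Lp_borel_approx_continuous[OF f p d12(2)] by blast
  define V where "V = measure lborel (cball (0::'a) (R + 1))"
  have V: "0 \<le> V" by (simp add: V_def)
  \<comment> \<open>A uniform error \<open>e\<close> on a ball of volume \<open>V\<close> costs
    \<open>e powr p * V\<close>; the denominator \<open>V + 1\<close> keeps this below
    \<open>d1\<close> without dividing by 0.\<close>
  define e where "e = (d1 / (V + 1)) powr (1 / p)"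
  have e: "0 < e" using d12 V by (auto simp: e_def)
  have "e powr p * V = d1 * (V / (V + 1))" using p d12 V by (simp add: e_def powr_powr)
  also have "\<dots> < d1 * 1" using d12 V by (intro mult_strict_left_mono) auto
  finally have eV: "e powr p * V < d1" by simp
  obtain r1 where r1: "0 < r1" "\<And>x y. norm (y - x) < r1 \<Longrightarrow> norm (h y - h x) < e"
    using uniformly_continuous_compact_support[OF h(1,2) e] by blast
  show thesis
  \<comment> \<open>The half turns \<open>norm u \<le> r\<close> into the strict
    \<open>norm u < r1\<close>; the bound 1 keeps the support of the mollification inside radius
    \<open>R + 1\<close>.\<close>
  proof (rule that[of "min (r1 / 2) 1"])
    show "0 < min (r1 / 2) 1" using r1 by simp
    fix r and \<rho> :: "'a \<Rightarrow> real"
    assume r: "r \<le> min (r1 / 2) 1" and \<rho>: "mollifier r \<rho>"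
    have \<rho>': "\<rho> \<in> Cc_infinity" "\<And>x. 0 \<le> \<rho> x" "(\<integral>x. \<rho> x \<partial>lborel) = 1" "\<And>x. norm x > r \<Longrightarrow> \<rho> x = 0"
      using \<rho> by (auto simp: mollifier_def)
    note i\<rho> = Cc_infinity_integrable[OF \<rho>'(1)]
    have [measurable]: "h \<in> borel_measurable borel" by (rule Lp_borelD(1)[OF h(3)])
    note [measurable] = Cc_infinity_borel[OF \<rho>'(1)]
    let ?g = "\<lambda>x. f x - h x"
    have g: "?g \<in> Lp_borel p" using f h p by (intro Lp_borel_diff) auto
    let ?H = "\<lambda>x. convolution \<rho> h x - h x" and ?G = "\<lambda>x. convolution \<rho> ?g x - ?g x"
    have le: "norm (?H x) \<le> e * norm (indicator (cball 0 (R + 1)) x :: real)" for x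
    proof -
      have "?H x = (\<integral>u. \<rho> u *\<^sub>R h (x - u) \<partial>lborel) - (\<integral>u. \<rho> u *\<^sub>R h x \<partial>lborel)"
        using \<rho>'(3) by (simp add: convolution_def integral_scaleR_left i\<rho>)
      also have "\<dots> = (\<integral>u. \<rho> u *\<^sub>R (h (x - u) - h x) \<partial>lborel)"
        using i\<rho> integrable_convolution[OF \<rho>'(1) h(3) p, of x]
        by (simp add: scaleR_right_diff_distrib)
      finally have H: "?H x = (\<integral>u. \<rho> u *\<^sub>R (h (x - u) - h x) \<partial>lborel)" .
      have "norm (?H x) \<le> (\<integral>u. norm (\<rho> u *\<^sub>R (h (x - u) - h x)) \<partial>lborel)"
        unfolding H by (rule integral_norm_bound)
      also have "\<dots> \<le> (\<integral>u. \<rho> u * (e * norm (indicator (cball 0 (R + 1)) x :: real)) \<partial>lborel)"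
      proof (rule integral_mono')
        show "integrable lborel (\<lambda>u. \<rho> u * (e * norm (indicator (cball 0 (R + 1)) x :: real)))"
          using i\<rho> by simp
        fix u
        show "norm (\<rho> u *\<^sub>R (h (x - u) - h x)) \<le> \<rho> u * (e * norm (indicator (cball 0 (R + 1)) x :: real))"
        proof (cases "norm u > r")
          case False
          then have u: "norm u < r1" "norm u \<le> 1" using r r1(1) by auto
          have "norm (h (x - u) - h x) \<le> e * norm (indicator (cball 0 (R + 1)) x :: real)"
          proof (cases "norm x > R + 1")
            case True
            then have "norm (x - u) > R" using u norm_triangle_sub[of x u] by linarith
            with True show ?thesis by (simp add: h)
          next
            case False
            with r1(2)[of "x - u" x] u show ?thesis by simp
          qed
          then show ?thesis using \<rho>'(2)[of u] by (simp add: mult_left_mono)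
        qed (simp add: \<rho>'(4))
      qed (use \<rho>'(2) e in simp)
      also have "\<dots> = e * norm (indicator (cball 0 (R + 1)) x :: real)" using \<rho>'(3) by simp
      finally show ?thesis .
    qed
    have ind: "(indicator (cball 0 (R + 1)) :: 'a \<Rightarrow> real) \<in> Lp_borel p"
      by (rule Lp_borel_compact_support[where M = 1 and R = "R + 1", OF _ _ _ p])
        (auto intro!: borel_measurable_indicator)
    have "?H \<in> borel_measurable borel" by simp
    note H = Lp_borel_bound[OF this le ind less_imp_le[OF e] order_trans[OF zero_le_one p]]
    have "Lp_modular p (indicator (cball 0 (R + 1)) :: 'a \<Rightarrow> real) = V"
    proof -
      have "(\<lambda>x::'a. norm (indicator (cball 0 (R + 1)) x :: real) powr p) = indicator (cball 0 (R + 1))"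
        by (auto simp: indicator_def)
      then show ?thesis by (simp add: Lp_modular_def V_def)
    qed
    with H(2) eV have H2: "Lp_modular p ?H < d1" by simp
    have cg: "convolution \<rho> ?g \<in> Lp_borel p" "Lp_modular p (convolution \<rho> ?g) \<le> Lp_modular p ?g"
      by (rule mollify_contraction[OF \<rho> g p])+
    have G: "?G \<in> Lp_borel p"
      "Lp_modular p ?G \<le> ?c * (Lp_modular p (convolution \<rho> ?g) + Lp_modular p ?g)"
      using p by (intro Lp_borel_diff cg g; simp)+
    note G(2)
    also have "?c * (Lp_modular p (convolution \<rho> ?g) + Lp_modular p ?g) < ?c * (d2 + d2)"
      using cg(2) fh by (intro mult_strict_left_mono) auto
    also have "\<dots> = d1" by (simp add: d2_def field_simps)
    finally have G2: "Lp_modular p ?G < d1" .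
    have "convolution \<rho> f x = convolution \<rho> h x + convolution \<rho> ?g x" for x
      unfolding convolution_def
      using integrable_convolution[OF \<rho>'(1) h(3) p, of x] integrable_convolution[OF \<rho>'(1) f p, of x]
      by (simp add: scaleR_right_diff_distrib)
    then have "Lp_modular p (\<lambda>x. convolution \<rho> f x - f x) = Lp_modular p (\<lambda>x. ?H x + ?G x)"
      by (intro arg_cong[where f = "Lp_modular p"]) auto
    also have "\<dots> \<le> ?c * (Lp_modular p ?H + Lp_modular p ?G)"
      using p by (intro Lp_borel_add H G) auto
    also have "\<dots> < ?c * (d1 + d1)"
      using H2 G2 by (intro mult_strict_left_mono) auto
    also have "\<dots> = d" by (simp add: d1_def field_simps)
    finally show "Lp_modular p (\<lambda>x. convolution \<rho> f x - f x) < d" .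
  qed
qed

section \<open>Smoothness of convolutions and the fundamental lemma\<close>

lemma Cc_infinity_scaleR_const:
  fixes f :: "'a::euclidean_space \<Rightarrow> real" and b :: "'b::real_normed_vector"
  assumes "f \<in> Cc_infinity"
  shows "(\<lambda>x. f x *\<^sub>R b) \<in> Cc_infinity"
proof -
  obtain R where "\<forall>x. norm x > R \<longrightarrow> f x *\<^sub>R b = 0"
    using Cc_infinityE[OF assms] by (metis scaleR_zero_left)
  moreover have "C_k k (\<lambda>x. f x *\<^sub>R b)" for k
    using assms by (intro C_k_scaleR C_k_const) (simp add: Cc_infinity_iff)
  ultimately show ?thesis unfolding Cc_infinity_iff by blast
qed

text \<open>The directional derivatives are uniformly continuous, being test functions themselves,
  and the mean value inequality applies on the segment from \<open>z\<close>. Uniformity in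
  \<open>z\<close> is the point: it allows differentiation under an integral against any integrable
  function.\<close>

lemma Cc_infinity_uniform_derivative:
  fixes f :: "'a::euclidean_space \<Rightarrow> 'b::real_normed_vector"
  assumes f: "f \<in> Cc_infinity" and e: "0 < e"
  obtains d where "0 < d"
    "\<And>z w. norm w < d \<Longrightarrow> norm (f (z + w) - f z - frechet_derivative f (at z) w) \<le> e * norm w"
proof -
  let ?f' = "\<lambda>x. frechet_derivative f (at x)"
  \<comment> \<open>The operator norm is estimated by the sum over the basis vectors, each of which
    receives an equal share of \<open>e\<close>.\<close>
  let ?e = "e / DIM('a)"
  have e': "0 < ?e" using e by simp
  have "\<exists>d>0. \<forall>x y. norm (y - x) < d \<longrightarrow> norm (?f' y b - ?f' x b) < ?e" for b
  proof -
    note D = Cc_infinity_derivative(2)[OF f, of b]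
    obtain R where R: "\<And>x. norm x > R \<Longrightarrow> ?f' x b = 0" using Cc_infinityE[OF D] by blast
    from uniformly_continuous_compact_support[OF Cc_infinity_continuous[OF D] R e'] show ?thesis by metis
  qed
  then obtain d where d: "\<And>b. 0 < d b"
    "\<And>b x y. norm (y - x) < d b \<Longrightarrow> norm (?f' y b - ?f' x b) < ?e" by metis
  define d0 where "d0 = Min (d ` Basis)"
  show thesis
  proof (rule that[of d0])
    show "0 < d0" using d(1) by (simp add: d0_def)
    fix z w :: 'a
    assume w: "norm w < d0"
    let ?S = "(\<lambda>t. z + t *\<^sub>R w) ` {0..1}"
    have "onorm (?f' y - ?f' z) \<le> e" if y: "y \<in> ?S" for y
    proof -
      obtain t where t: "0 \<le> t" "t \<le> 1" "y = z + t *\<^sub>R w" using y by auto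
      have "norm (y - z) \<le> norm w" using t by (simp add: mult_left_le_one_le)
      then have yz: "norm (y - z) < d b" if "b \<in> Basis" for b
      proof -
        have "norm w < d b" using w that by (simp add: d0_def)
        with \<open>norm (y - z) \<le> norm w\<close> show ?thesis by linarith
      qed
      have "bounded_linear (?f' y - ?f' z)"
        unfolding fun_diff_def
        by (intro bounded_linear_sub has_derivative_bounded_linear[OF Cc_infinity_derivative(1)[OF f]])
      then have "onorm (?f' y - ?f' z) \<le> (\<Sum>b\<in>Basis. norm ((?f' y - ?f' z) b))"
        by (rule onorm_componentwise)
      also have "\<dots> \<le> (\<Sum>b\<in>(Basis::'a set). ?e)"
      proof (rule sum_mono)
        fix b :: 'a assume "b \<in> Basis"
        from d(2)[OF yz[OF this]] show "norm ((?f' y - ?f' z) b) \<le> ?e" by (simp add: fun_diff_def)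
      qed
      also have "\<dots> = e" by simp
      finally show ?thesis .
    qed
    note bd = this
    have "norm (f (z + w) - f z - ?f' z (z + w - z)) \<le> norm (z + w - z) * e"
    proof (rule differentiable_bound_linearization[where S = ?S and f' = ?f'])
      show "z + t *\<^sub>R (z + w - z) \<in> ?S" if "t \<in> {0..1}" for t
        using that by (intro image_eqI[of _ _ t]) auto
      show "z \<in> ?S" by (rule image_eqI[of _ _ 0]) auto
      show "(f has_derivative ?f' y) (at y within ?S)" for y
        by (rule has_derivative_at_withinI[OF Cc_infinity_derivative(1)[OF f]])
      show "onorm (?f' y - ?f' z) \<le> e" if "y \<in> ?S" for y by (rule bd[OF that])
    qed
    then show "norm (f (z + w) - f z - ?f' z w) \<le> e * norm w" by (simp add: mult.commute)
  qed
qed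

lemma integrable_convolution_smooth:
  fixes f :: "'a::euclidean_space \<Rightarrow> 'b::euclidean_space"
  assumes h: "integrable lborel h" and f: "f \<in> Cc_infinity"
  shows "integrable lborel (\<lambda>u. h u *\<^sub>R f (x - u))"
proof -
  obtain M where M: "0 < M" "\<And>x. norm (f x) \<le> M" using Cc_infinity_bounded[OF f] by blast
  note [measurable] = Cc_infinity_borel[OF f] borel_measurable_integrable[OF h]
  have "norm (h u *\<^sub>R f (x - u)) \<le> norm (M * h u)" for u
    using mult_left_mono[OF M(2)[of "x - u"], of "\<bar>h u\<bar>"] M(1) by (simp add: mult.commute abs_mult)
  then show ?thesis
    by (intro Bochner_Integration.integrable_bound[OF integrable_mult_right[OF h, of M]]) auto
qed

text \<open>The remainder of the first-order expansion of \<open>f\<close> is uniformly at most a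
  multiple of \<open>norm (y - x)\<close>, so after integration against \<open>h\<close> it is at
  most the L^1 norm of \<open>h\<close> times that multiple.\<close>

lemma convolution_has_derivative:
  fixes f :: "'a::euclidean_space \<Rightarrow> 'b::euclidean_space"
  assumes h: "integrable lborel h" and f: "f \<in> Cc_infinity"
  shows "(convolution h f has_derivative
    (\<lambda>v. convolution h (\<lambda>x. frechet_derivative f (at x) v) x)) (at x)"
proof -
  let ?f' = "\<lambda>x. frechet_derivative f (at x)"
  let ?D = "\<lambda>v. convolution h (\<lambda>x. ?f' x v) x"
  define I where "I = (\<integral>u. norm (h u) \<partial>lborel)"
  note f' = Cc_infinity_derivative[OF f]
  have I: "0 \<le> I" by (simp add: I_def)
  note int = integrable_convolution_smooth[OF h f]
  note int' = integrable_convolution_smooth[OF h f'(2)]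
  interpret L: bounded_linear "?f' y" for y by (rule has_derivative_bounded_linear[OF f'(1)])
  have le: "norm (\<integral>u. h u *\<^sub>R k u \<partial>lborel) \<le> I * c"
    if "\<And>u. norm (k u) \<le> c" for k :: "'a \<Rightarrow> 'b" and c
  proof -
    have "0 \<le> c" using that norm_ge_zero order_trans by blast
    then have "norm (\<integral>u. h u *\<^sub>R k u \<partial>lborel) \<le> (\<integral>u. norm (h u) * c \<partial>lborel)"
      using that h by (intro order_trans[OF integral_norm_bound] integral_mono') (auto intro: mult_left_mono)
    then show ?thesis using h by (simp add: I_def)
  qed
  obtain K where K: "\<And>y v. norm (?f' y v) \<le> K * norm v"
  proof -
    have "\<exists>M. \<forall>x. norm (?f' x b) \<le> M" for b using Cc_infinity_bounded[OF f'(2)[of b]] by metis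
    then obtain M where M: "\<And>b x. norm (?f' x b) \<le> M b" by metis
    have "norm (?f' y v) \<le> (\<Sum>b\<in>Basis. M b) * norm v" for y v
    proof -
      have "onorm (?f' y) \<le> (\<Sum>b\<in>Basis. M b)"
        using M by (intro onorm_componentwise_le[OF L.bounded_linear_axioms] sum_mono)
      then show ?thesis
        using onorm[OF L.bounded_linear_axioms, of y v] by (meson mult_right_mono norm_ge_zero order_trans)
    qed
    then show thesis by (rule that)
  qed
  have "bounded_linear ?D"
  proof (rule bounded_linear_intro[where K = "I * K"])
    show "?D (v + w) = ?D v + ?D w" for v w
      using int'[of x v] int'[of x w] by (simp add: convolution_def L.add scaleR_right_distrib)
    show "?D (c *\<^sub>R v) = c *\<^sub>R ?D v" for c v
    proof -
      have "?D (c *\<^sub>R v) = (\<integral>u. c *\<^sub>R (h u *\<^sub>R ?f' (x - u) v) \<partial>lborel)"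
        by (simp add: convolution_def L.scaleR mult.commute)
      also have "\<dots> = c *\<^sub>R ?D v" unfolding convolution_def by (rule integral_scaleR_right)
      finally show ?thesis .
    qed
    show "norm (?D v) \<le> norm v * (I * K)" for v
      using le[of "\<lambda>u. ?f' (x - u) v" "K * norm v"] K by (simp add: convolution_def mult_ac)
  qed
  moreover have "\<exists>d>0. \<forall>y. norm (y - x) < d \<longrightarrow>
      norm (convolution h f y - convolution h f x - ?D (y - x)) \<le> e * norm (y - x)" if e: "0 < e" for e
  proof -
    have "0 < e / (I + 1)" using e I by simp
    then obtain d where d: "0 < d"
      "\<And>z w. norm w < d \<Longrightarrow> norm (f (z + w) - f z - ?f' z w) \<le> e / (I + 1) * norm w"
      using Cc_infinity_uniform_derivative[OF f] by blast
    have "norm (convolution h f y - convolution h f x - ?D (y - x)) \<le> e * norm (y - x)"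
      if y: "norm (y - x) < d" for y
    proof -
      have "convolution h f y - convolution h f x - ?D (y - x)
          = (\<integral>u. h u *\<^sub>R f (y - u) - h u *\<^sub>R f (x - u) - h u *\<^sub>R ?f' (x - u) (y - x) \<partial>lborel)"
        unfolding convolution_def
        by (simp only: Bochner_Integration.integral_diff Bochner_Integration.integrable_diff int int')
      also have "\<dots> = (\<integral>u. h u *\<^sub>R (f ((x - u) + (y - x)) - f (x - u) - ?f' (x - u) (y - x)) \<partial>lborel)"
        by (intro Bochner_Integration.integral_cong) (simp_all add: scaleR_right_diff_distrib)
      also have "norm \<dots> \<le> I * (e / (I + 1) * norm (y - x))"
        by (rule le) (rule d(2)[OF y])
      also have "\<dots> = e * norm (y - x) * (I / (I + 1))" by simp
      also have "\<dots> \<le> e * norm (y - x) * 1" using e I by (intro mult_left_mono) auto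
      finally show ?thesis by simp
    qed
    with d(1) show ?thesis by blast
  qed
  ultimately show ?thesis by (simp add: has_derivative_at_alt)
qed

text \<open>The convolutions of the fixed \<open>h\<close> with all test functions form a class
  closed under directional derivatives, so \<open>C_k_coinduct\<close> applies.\<close>

lemma convolution_Cc_infinity:
  fixes f :: "'a::euclidean_space \<Rightarrow> 'b::euclidean_space"
  assumes h: "integrable lborel h" "\<And>x. norm x > R \<Longrightarrow> h x = 0" and f: "f \<in> Cc_infinity"
  shows "convolution h f \<in> Cc_infinity"
proof -
  let ?S = "\<lambda>g. \<exists>f\<in>Cc_infinity. g = convolution h (f :: 'a \<Rightarrow> 'b)"
  have "C_k k (convolution h f)" for k
  proof (rule C_k_coinduct[of ?S])
    show "?S (convolution h f)" using f by blast
  next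
    fix g :: "'a \<Rightarrow> 'b" and x
    assume "?S g"
    then show "g differentiable (at x)"
      using convolution_has_derivative[OF h(1)] by (auto simp: differentiable_def)
  next
    fix g :: "'a \<Rightarrow> 'b" and v
    assume "?S g"
    then obtain k where k: "k \<in> Cc_infinity" "g = convolution h k" by blast
    have "(\<lambda>x. frechet_derivative g (at x) v) = convolution h (\<lambda>x. frechet_derivative k (at x) v)"
      unfolding k(2) frechet_derivative_at[OF convolution_has_derivative[OF h(1) k(1)], symmetric] ..
    then show "?S (\<lambda>x. frechet_derivative g (at x) v)"
      using Cc_infinity_derivative(2)[OF k(1)] by blast
  qed
  moreover obtain r where r: "\<And>x. norm x > r \<Longrightarrow> f x = 0" using Cc_infinityE[OF f] by blast
  have "convolution h f x = 0" if "norm x > R + r" for x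
  proof -
    have "h u *\<^sub>R f (x - u) = 0" for u
    proof (cases "norm u > R")
      case False
      then have "norm (x - u) > r" using that norm_triangle_sub[of x u] by linarith
      then show ?thesis by (simp add: r)
    qed (simp add: h)
    then have "(\<lambda>u. h u *\<^sub>R f (x - u)) = (\<lambda>u. 0)" by (rule ext)
    then show ?thesis unfolding convolution_def by (simp only: Bochner_Integration.integral_zero)
  qed
  ultimately show ?thesis by (auto simp: Cc_infinity_iff)
qed

section \<open>Borel representatives and the fundamental lemma\<close>

lemma lebesgue_measurable_borel_version:
  fixes f :: "'a::euclidean_space \<Rightarrow> 'b::euclidean_space"
  assumes f: "f \<in> borel_measurable lebesgue"
  obtains f0 where "f0 \<in> borel_measurable borel" "AE x in lebesgue. f x = f0 x"
proof -
  have "\<exists>g. g \<in> borel_measurable borel \<and> (AE x in lborel. f x \<bullet> b = g x)" for b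
  proof -
    have "(\<lambda>x. f x \<bullet> b) \<in> borel_measurable lebesgue" using f by (rule borel_measurable_inner) simp
    from completion_ex_borel_measurable_real[OF this] show ?thesis by auto
  qed
  then obtain g where g: "\<And>b. g b \<in> borel_measurable borel" "\<And>b. AE x in lborel. f x \<bullet> b = g b x"
    by metis
  note [measurable] = g(1)
  have "AE x in lborel. \<forall>b\<in>Basis. f x \<bullet> b = g b x"
    using g(2) by (intro AE_finite_allI) auto
  then have "AE x in lborel. f x = (\<Sum>b\<in>Basis. g b x *\<^sub>R b)"
  proof (rule AE_mp, intro AE_I2 impI)
    fix x assume "\<forall>b\<in>Basis. f x \<bullet> b = g b x"
    then have "(\<Sum>b\<in>Basis. g b x *\<^sub>R b) = (\<Sum>b\<in>Basis. (f x \<bullet> b) *\<^sub>R b)" by (intro sum.cong) auto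
    then show "f x = (\<Sum>b\<in>Basis. g b x *\<^sub>R b)" by (simp add: euclidean_representation)
  qed
  then show thesis by (intro that[of "\<lambda>x. \<Sum>b\<in>Basis. g b x *\<^sub>R b"] AE_completion) measurable
qed

lemma integral_borel_version:
  fixes f f0 :: "'a::euclidean_space \<Rightarrow> 'b::euclidean_space"
  assumes f: "f \<in> borel_measurable lebesgue" and f0: "f0 \<in> borel_measurable borel"
    and eq: "AE x in lebesgue. f x = f0 x"
  shows "(\<integral>x. f x \<partial>lebesgue) = (\<integral>x. f0 x \<partial>lborel)"
    and "integrable lebesgue f \<longleftrightarrow> integrable lborel f0"
proof -
  have [measurable]: "f0 \<in> borel_measurable lebesgue" using f0 by (simp add: measurable_completion)
  show "(\<integral>x. f x \<partial>lebesgue) = (\<integral>x. f0 x \<partial>lborel)"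
    using integral_cong_AE[OF f _ eq] f0 by (simp add: integral_completion)
  show "integrable lebesgue f \<longleftrightarrow> integrable lborel f0"
    using integrable_cong_AE[OF f _ eq] f0 by (simp add: integrable_completion)
qed

text \<open>At a point \<open>x\<close> the mollification of \<open>g\<close> is, in each component,
  the pairing of \<open>g\<close> with a reflected and translated mollifier, hence 0. It also
  approximates \<open>g\<close> in L^1 on bounded sets, so \<open>g\<close> has arbitrarily small
  integral norm on every ball.\<close>

lemma borel_AE_zero:
  fixes g :: "'a::euclidean_space \<Rightarrow> 'b::euclidean_space"
  assumes [measurable]: "g \<in> borel_measurable borel"
    and loc: "\<And>R. integrable lborel (\<lambda>x. indicator (cball 0 R) x *\<^sub>R g x)"
    and zero: "\<And>\<phi>. \<phi> \<in> Cc_infinity \<Longrightarrow> (\<integral>x. g x \<bullet> \<phi> x \<partial>lborel) = 0"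
  shows "AE x in lborel. g x = 0"
proof -
  have "AE x in lborel. norm x \<le> R \<longrightarrow> g x = 0" for R
  proof -
    \<comment> \<open>The margin 1 exceeds the mollification radius or equals it, so for
      \<open>norm x \<le> R\<close> the mollifications of \<open>G\<close> and of \<open>g\<close>
      agree at \<open>x\<close>.\<close>
    define G where "G = (\<lambda>x. indicator (cball 0 (R + 1)) x *\<^sub>R g x)"
    have Gb: "G \<in> borel_measurable borel"
      unfolding G_def by (intro borel_measurable_scaleR borel_measurable_indicator) simp_all
    have "integrable lborel (\<lambda>x. norm (G x))" unfolding G_def by (rule integrable_norm[OF loc])
    then have G: "G \<in> Lp_borel 1" using Gb by (simp add: Lp_borel_def)
    let ?D = "\<lambda>x. indicator (cball 0 R) x * norm (g x)"
    have intD: "integrable lborel ?D" using integrable_norm[OF loc[of R]] by simp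
    have "(\<integral>x. ?D x \<partial>lborel) < d" if d: "0 < d" for d
    proof -
      obtain r0 where r0: "0 < r0" "\<And>r \<rho>. r \<le> r0 \<Longrightarrow> mollifier r \<rho> \<Longrightarrow>
          Lp_modular 1 (\<lambda>x. convolution \<rho> G x - G x) < d"
        using mollify_approximates[OF G _ d] by auto
      obtain \<rho> :: "'a \<Rightarrow> real" where \<rho>: "mollifier (min r0 1) \<rho>"
        using mollifier_exists[of "min r0 1"] r0(1) by auto
      have \<rho>': "\<rho> \<in> Cc_infinity" "\<And>x. norm x > min r0 1 \<Longrightarrow> \<rho> x = 0"
        using \<rho> by (auto simp: mollifier_def)
      note [measurable] = Cc_infinity_borel[OF \<rho>'(1)]
      have conv: "convolution \<rho> G x = 0" if x: "norm x \<le> R" for x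
      proof (rule euclidean_eqI)
        fix b :: 'b
        have eq: "\<rho> u *\<^sub>R G (x - u) = \<rho> u *\<^sub>R g (x - u)" for u
        proof (cases "norm u > min r0 1")
          case False
          then have "norm (x - u) \<le> R + 1" using x norm_triangle_ineq4[of x u] by linarith
          then show ?thesis by (simp add: G_def)
        qed (simp add: \<rho>')
        have "convolution \<rho> G x \<bullet> b = (\<integral>u. (\<rho> u *\<^sub>R G (x - u)) \<bullet> b \<partial>lborel)"
          unfolding convolution_def
          by (rule integral_inner_left[symmetric], rule integrable_convolution[OF \<rho>'(1) G]) simp
        also have "\<dots> = (\<integral>u. \<rho> u * (g (x - u) \<bullet> b) \<partial>lborel)" by (simp add: eq)
        also have "\<dots> = (\<integral>u. \<rho> (x - u) * (g (x - (x - u)) \<bullet> b) \<partial>lborel)"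
          by (rule integral_reflect(1)[symmetric]) measurable
        also have "\<dots> = (\<integral>u. g u \<bullet> (\<rho> (x + (- 1) *\<^sub>R u) *\<^sub>R b) \<partial>lborel)" by simp
        also have "\<dots> = 0"
          by (intro zero Cc_infinity_scaleR_const Cc_infinity_affine \<rho>'(1)) simp
        finally show "convolution \<rho> G x \<bullet> b = 0 \<bullet> b" by simp
      qed
      have "convolution \<rho> G \<in> Lp_borel 1" by (rule mollify_contraction(1)[OF \<rho> G]) simp
      from Lp_borel_diff(1)[OF this G]
      have "integrable lborel (\<lambda>x. norm (convolution \<rho> G x - G x))"
        by (simp add: Lp_borel_def)
      then have "(\<integral>x. ?D x \<partial>lborel) \<le> (\<integral>x. norm (convolution \<rho> G x - G x) \<partial>lborel)"
      proof (rule integral_mono[OF intD])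
        fix x
        show "?D x \<le> norm (convolution \<rho> G x - G x)"
        proof (cases "norm x \<le> R")
          case True
          then have "G x = g x" by (simp add: G_def)
          with True show ?thesis by (simp add: conv)
        qed simp
      qed
      also have "\<dots> = Lp_modular 1 (\<lambda>x. convolution \<rho> G x - G x)" by (simp add: Lp_modular_def)
      also have "\<dots> < d" by (rule r0(2)[OF _ \<rho>]) simp
      finally show ?thesis .
    qed
    then have "(\<integral>x. ?D x \<partial>lborel) \<le> 0" by (meson less_irrefl not_le)
    moreover have "0 \<le> (\<integral>x. ?D x \<partial>lborel)" by simp
    ultimately have "(\<integral>x. ?D x \<partial>lborel) = 0" by linarith
    then have "AE x in lborel. ?D x = 0"
      using integral_nonneg_eq_0_iff_AE[OF intD] by simp
    then show ?thesis by (auto elim!: AE_mp intro!: AE_I2 simp: indicator_def)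
  qed
  then have "AE x in lborel. \<forall>n::nat. norm x \<le> real n \<longrightarrow> g x = 0"
    unfolding AE_all_countable by blast
  then show ?thesis
  proof (rule AE_mp, intro AE_I2 impI)
    fix x assume "\<forall>n::nat. norm x \<le> real n \<longrightarrow> g x = 0"
    then show "g x = 0" using real_arch_simple by blast
  qed
qed

section \<open>Fubini identities for the fractional divergence\<close>

context
  fixes w H :: "'a::euclidean_space \<Rightarrow> real"
  assumes w: "integrable lborel w" and H: "integrable lborel H"
begin

private lemma meas [measurable]: "w \<in> borel_measurable borel" "H \<in> borel_measurable borel"
  using borel_measurable_integrable[OF w] borel_measurable_integrable[OF H] by simp_all

private lemma finite: "(\<integral>\<^sup>+x. ennreal \<bar>w x\<bar> \<partial>lborel) * (\<integral>\<^sup>+x. ennreal \<bar>H x\<bar> \<partial>lborel) < \<infinity>"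
  using w H by (simp add: integrable_iff_bounded ennreal_mult_less_top)

lemma integrable_pair_diff_fst: "integrable (lborel \<Otimes>\<^sub>M lborel) (\<lambda>(x, y). w (y - x) * H x)"
proof (rule integrableI_bounded)
  have "(\<integral>\<^sup>+ p. ennreal (norm (case p of (x, y) \<Rightarrow> w (y - x) * H x)) \<partial>(lborel \<Otimes>\<^sub>M lborel))
      = (\<integral>\<^sup>+x. \<integral>\<^sup>+y. ennreal \<bar>H x\<bar> * ennreal \<bar>w (- x + y)\<bar> \<partial>lborel \<partial>lborel)"
    by (subst lborel.nn_integral_fst[symmetric]) (simp_all add: abs_mult ennreal_mult mult.commute)
  also have "\<dots> = (\<integral>\<^sup>+x. ennreal \<bar>w x\<bar> \<partial>lborel) * (\<integral>\<^sup>+x. ennreal \<bar>H x\<bar> \<partial>lborel)"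
    by (simp add: nn_integral_cmult nn_integral_multc mult.commute
        nn_integral_shift[where f = "\<lambda>y. ennreal \<bar>w y\<bar>"] del: add_uminus_conv_diff uminus_add_conv_diff)
  also note finite
  finally show "(\<integral>\<^sup>+ p. ennreal (norm (case p of (x, y) \<Rightarrow> w (y - x) * H x)) \<partial>(lborel \<Otimes>\<^sub>M lborel)) < \<infinity>" .
qed measurable

lemma integrable_pair_diff_snd: "integrable (lborel \<Otimes>\<^sub>M lborel) (\<lambda>(x, y). w (y - x) * H y)"
proof (rule integrableI_bounded)
  have "(\<integral>\<^sup>+ p. ennreal (norm (case p of (x, y) \<Rightarrow> w (y - x) * H y)) \<partial>(lborel \<Otimes>\<^sub>M lborel))
      = (\<integral>\<^sup>+y. \<integral>\<^sup>+x. ennreal \<bar>H y\<bar> * ennreal \<bar>w (y - x)\<bar> \<partial>lborel \<partial>lborel)"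
    by (subst lborel_pair.nn_integral_snd[symmetric]) (simp_all add: abs_mult ennreal_mult mult.commute)
  also have "\<dots> = (\<integral>\<^sup>+x. ennreal \<bar>w x\<bar> \<partial>lborel) * (\<integral>\<^sup>+x. ennreal \<bar>H x\<bar> \<partial>lborel)"
    by (simp add: nn_integral_cmult nn_integral_multc mult.commute
        nn_integral_reflect[where f = "\<lambda>y. ennreal \<bar>w y\<bar>"])
  also note finite
  finally show "(\<integral>\<^sup>+ p. ennreal (norm (case p of (x, y) \<Rightarrow> w (y - x) * H y)) \<partial>(lborel \<Otimes>\<^sub>M lborel)) < \<infinity>" .
qed measurable

lemma integrable_pair_shifted: "integrable (lborel \<Otimes>\<^sub>M lborel) (\<lambda>(x, z). w z * H (x - z))"
proof (rule integrableI_bounded)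
  have "(\<integral>\<^sup>+ p. ennreal (norm (case p of (x, z) \<Rightarrow> w z * H (x - z))) \<partial>(lborel \<Otimes>\<^sub>M lborel))
      = (\<integral>\<^sup>+z. \<integral>\<^sup>+x. ennreal \<bar>w z\<bar> * ennreal \<bar>H (- z + x)\<bar> \<partial>lborel \<partial>lborel)"
    by (subst lborel_pair.nn_integral_snd[symmetric]) (simp_all add: abs_mult ennreal_mult)
  also have "\<dots> = (\<integral>\<^sup>+x. ennreal \<bar>w x\<bar> \<partial>lborel) * (\<integral>\<^sup>+x. ennreal \<bar>H x\<bar> \<partial>lborel)"
    by (simp add: nn_integral_cmult nn_integral_multc
        nn_integral_shift[where f = "\<lambda>y. ennreal \<bar>H y\<bar>"] del: add_uminus_conv_diff uminus_add_conv_diff)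
  also note finite
  finally show "(\<integral>\<^sup>+ p. ennreal (norm (case p of (x, z) \<Rightarrow> w z * H (x - z))) \<partial>(lborel \<Otimes>\<^sub>M lborel)) < \<infinity>" .
qed measurable

lemma integrable_pair_product: "integrable (lborel \<Otimes>\<^sub>M lborel) (\<lambda>(x, z). w z * H x)"
proof (rule integrableI_bounded)
  have "(\<integral>\<^sup>+ p. ennreal (norm (case p of (x, z) \<Rightarrow> w z * H x)) \<partial>(lborel \<Otimes>\<^sub>M lborel))
      = (\<integral>\<^sup>+z. \<integral>\<^sup>+x. ennreal \<bar>w z\<bar> * ennreal \<bar>H x\<bar> \<partial>lborel \<partial>lborel)"
    by (subst lborel_pair.nn_integral_snd[symmetric]) (simp_all add: abs_mult ennreal_mult)
  also have "\<dots> = (\<integral>\<^sup>+x. ennreal \<bar>w x\<bar> \<partial>lborel) * (\<integral>\<^sup>+x. ennreal \<bar>H x\<bar> \<partial>lborel)"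
    by (simp add: nn_integral_cmult nn_integral_multc)
  also note finite
  finally show "(\<integral>\<^sup>+ p. ennreal (norm (case p of (x, z) \<Rightarrow> w z * H x)) \<partial>(lborel \<Otimes>\<^sub>M lborel)) < \<infinity>" .
qed measurable

end

lemma integrable_pair_bound:
  fixes f :: "'a::euclidean_space \<Rightarrow> 'b::euclidean_space \<Rightarrow> 'c::{banach, second_countable_topology}"
  assumes "integrable (lborel \<Otimes>\<^sub>M lborel) (\<lambda>(x, y). D x y :: real)"
    and "(\<lambda>(x, y). f x y) \<in> borel_measurable (lborel \<Otimes>\<^sub>M lborel)"
    and "\<And>x y. norm (f x y) \<le> D x y"
  shows "integrable (lborel \<Otimes>\<^sub>M lborel) (\<lambda>(x, y). f x y)"
  by (rule Bochner_Integration.integrable_bound[OF assms(1,2)])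
    (use assms(3) in \<open>auto intro!: AE_I2 order_trans[OF _ abs_ge_self]\<close>)

lemma integrable_pair_lincomb:
  fixes D1 D2 :: "'a::euclidean_space \<Rightarrow> 'b::euclidean_space \<Rightarrow> real"
  assumes "integrable (lborel \<Otimes>\<^sub>M lborel) (\<lambda>(x, y). D1 x y)"
    and "integrable (lborel \<Otimes>\<^sub>M lborel) (\<lambda>(x, y). D2 x y)"
  shows "integrable (lborel \<Otimes>\<^sub>M lborel) (\<lambda>(x, y). C * (D1 x y + D2 x y))"
proof -
  have "integrable (lborel \<Otimes>\<^sub>M lborel) (\<lambda>p. C * ((case p of (x, y) \<Rightarrow> D1 x y) + (case p of (x, y) \<Rightarrow> D2 x y)))"
    using assms by (intro integrable_mult_right Bochner_Integration.integrable_add)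
  then show ?thesis by (simp add: case_prod_unfold)
qed

section \<open>The kernel, the divergence and the commutator\<close>

definition frac_kernel :: "real \<Rightarrow> 'a::euclidean_space \<Rightarrow> 'a" where
  "frac_kernel \<alpha> z = (1 / norm z powr (real DIM('a) + \<alpha> + 1)) *\<^sub>R z"

lemma frac_kernel_borel [measurable]: "frac_kernel \<alpha> \<in> borel_measurable borel"
  unfolding frac_kernel_def[abs_def] by measurable

lemma frac_kernel_minus: "frac_kernel \<alpha> (- z) = - frac_kernel \<alpha> z"
  by (simp add: frac_kernel_def)

lemma norm_frac_kernel: "norm (frac_kernel \<alpha> z) * min 1 (t * norm z) = frac_weight \<alpha> t z"
proof (cases "z = 0")
  case False
  then have "norm z powr (real DIM('a) + \<alpha> + 1) = norm z powr (real DIM('a) + \<alpha>) * norm z"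
    by (simp add: powr_add)
  with False have "norm (frac_kernel \<alpha> z) = 1 / norm z powr (real DIM('a) + \<alpha>)"
    by (simp add: frac_kernel_def)
  then show ?thesis by (simp add: frac_weight_def)
qed (simp add: frac_kernel_def frac_weight_def)

text \<open>All kernel estimates pass through this form. The factor \<open>s\<close> carries the
  indicators of the support where joint integrability is at stake, and is 1 where a bound uniform in
  the base point is wanted.\<close>

lemma frac_kernel_times_increment:
  assumes "d \<le> C * min 1 (t * norm z) * s"
  shows "norm (frac_kernel \<alpha> z) * d \<le> C * frac_weight \<alpha> t z * s"
proof -
  have "norm (frac_kernel \<alpha> z) * d \<le> norm (frac_kernel \<alpha> z) * (C * min 1 (t * norm z) * s)"
    using assms by (rule mult_left_mono) simp
  also have "\<dots> = C * (norm (frac_kernel \<alpha> z) * min 1 (t * norm z)) * s" by (simp only: mult_ac)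
  finally show ?thesis by (simp only: norm_frac_kernel)
qed

text \<open>\<open>frac_div\<close> without its constant, and over \<open>lborel\<close>: Fubini's theorem needs joint measurability of
  \<open>f (x - y)\<close>, which can fail for the uncompleted product of \<open>lebesgue\<close> with itself. For the same
  reason functions are replaced by Borel versions below.\<close>

definition frac_dvg :: "real \<Rightarrow> ('a::euclidean_space \<Rightarrow> 'a) \<Rightarrow> 'a \<Rightarrow> real" where
  "frac_dvg \<alpha> \<phi> x = (\<integral>y. frac_kernel \<alpha> (y - x) \<bullet> (\<phi> y - \<phi> x) \<partial>lborel)"

lemma frac_dvg_borel [measurable]:
  assumes [measurable]: "\<phi> \<in> borel_measurable borel"
  shows "frac_dvg \<alpha> \<phi> \<in> borel_measurable borel"
  unfolding frac_dvg_def[abs_def] by measurable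

text \<open>For compactly supported smooth \<open>\<eta>\<close> this is the commutator of the fractional gradient with
  multiplication by \<open>\<eta>\<close>, applied to \<open>f\<close>; for \<open>f = 1\<close> it is the fractional gradient of \<open>\<eta>\<close>.\<close>

definition frac_commutator ::
    "real \<Rightarrow> ('a::euclidean_space \<Rightarrow> real) \<Rightarrow> ('a \<Rightarrow> real) \<Rightarrow> 'a \<Rightarrow> 'a" where
  "frac_commutator \<alpha> \<eta> f y = (\<integral>x. (f x * (\<eta> x - \<eta> y)) *\<^sub>R frac_kernel \<alpha> (x - y) \<partial>lborel)"

lemma frac_commutator_borel [measurable]:
  assumes [measurable]: "\<eta> \<in> borel_measurable borel" "f \<in> borel_measurable borel"
  shows "frac_commutator \<alpha> \<eta> f \<in> borel_measurable borel"
  unfolding frac_commutator_def[abs_def] by measurable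

context
  fixes \<alpha> :: real
  assumes \<alpha>: "0 < \<alpha>" "\<alpha> < 1"
begin

text \<open>The majorant is a multiple of the weight at \<open>y - x\<close>, whose integral does
  not depend on \<open>x\<close>. The uniform bound \<open>B\<close> serves both for the divergence
  of a test field and for the commutator with the constant 1.\<close>

lemma frac_increment_integrable:
  fixes \<phi> :: "'a::euclidean_space \<Rightarrow> 'b::euclidean_space"
  assumes \<phi>: "\<phi> \<in> Cc_infinity"
  obtains B where
    "\<And>x. integrable lborel (\<lambda>y. norm (frac_kernel \<alpha> (y - x)) * norm (\<phi> y - \<phi> x))"
    "\<And>x. (\<integral>y. norm (frac_kernel \<alpha> (y - x)) * norm (\<phi> y - \<phi> x) \<partial>lborel) \<le> B"
proof -
  let ?w = "frac_weight \<alpha> 1 :: 'a \<Rightarrow> real"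
  note [measurable] = Cc_infinity_borel[OF \<phi>]
  obtain C where C: "0 < C" "\<And>x y. norm (\<phi> y - \<phi> x) \<le> C * min 1 (norm (y - x))"
    using Cc_infinity_increment_le[OF \<phi>] by metis
  have "norm (\<phi> y - \<phi> x) \<le> C * min 1 (1 * norm (y - x)) * 1" for x y
    using C(2)[of y x] by simp
  then have le: "norm (frac_kernel \<alpha> (y - x)) * norm (\<phi> y - \<phi> x) \<le> C * ?w (y - x) * 1" for x y
    by (rule frac_kernel_times_increment)
  have int: "integrable lborel (\<lambda>y. C * ?w (- x + y))" for x
    using integral_shift(2)[of ?w "- x"] frac_weight_integrable_1[OF \<alpha>, where ?'a = 'a]
    by (intro integrable_mult_right) simp
  have int': "integrable lborel (\<lambda>y. norm (frac_kernel \<alpha> (y - x)) * norm (\<phi> y - \<phi> x))" for x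
    using le[of _ x] by (intro Bochner_Integration.integrable_bound[OF int[of x]])
      (auto intro!: AE_I2 order_trans[OF _ abs_ge_self])
  have "(\<integral>y. norm (frac_kernel \<alpha> (y - x)) * norm (\<phi> y - \<phi> x) \<partial>lborel) \<le> (\<integral>y. C * ?w (- x + y) \<partial>lborel)" for x
    using le[of _ x] by (intro integral_mono int int') simp
  also have "(\<integral>y. C * ?w (- x + y) \<partial>lborel) = C * (\<integral>y. ?w y \<partial>lborel)" for x
    using integral_shift(1)[of ?w "- x"] by simp
  finally show thesis using that int' by blast
qed

lemma frac_dvg_integrand_integrable:
  fixes \<phi> :: "'a::euclidean_space \<Rightarrow> 'a"
  assumes \<phi>: "\<phi> \<in> Cc_infinity"
  shows "integrable lborel (\<lambda>y. frac_kernel \<alpha> (y - x) \<bullet> (\<phi> y - \<phi> x))"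
proof -
  note [measurable] = Cc_infinity_borel[OF \<phi>]
  obtain B where "\<And>x. integrable lborel (\<lambda>y. norm (frac_kernel \<alpha> (y - x)) * norm (\<phi> y - \<phi> x))"
    using frac_increment_integrable[OF \<phi>] by metis
  from this[of x] show ?thesis
    by (rule Bochner_Integration.integrable_bound) (auto intro!: AE_I2 simp: Cauchy_Schwarz_ineq2)
qed

lemma frac_dvg_bounded:
  fixes \<phi> :: "'a::euclidean_space \<Rightarrow> 'a"
  assumes \<phi>: "\<phi> \<in> Cc_infinity"
  obtains B where "\<And>x. norm (frac_dvg \<alpha> \<phi> x) \<le> B"
proof -
  obtain B where B: "\<And>x. integrable lborel (\<lambda>y. norm (frac_kernel \<alpha> (y - x)) * norm (\<phi> y - \<phi> x))"
    "\<And>x. (\<integral>y. norm (frac_kernel \<alpha> (y - x)) * norm (\<phi> y - \<phi> x) \<partial>lborel) \<le> B"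
    using frac_increment_integrable[OF \<phi>] by metis
  have "norm (frac_dvg \<alpha> \<phi> x) \<le> B" for x
  proof -
    have "norm (frac_dvg \<alpha> \<phi> x) \<le> (\<integral>y. norm (frac_kernel \<alpha> (y - x)) * norm (\<phi> y - \<phi> x) \<partial>lborel)"
      unfolding frac_dvg_def
      by (intro Bochner_Integration.integral_norm_bound_integral B frac_dvg_integrand_integrable \<phi>) (simp add: Cauchy_Schwarz_ineq2)
    with B(2)[of x] show ?thesis by linarith
  qed
  then show thesis by (rule that)
qed

lemma frac_commutator_one_bounded:
  fixes \<eta> :: "'a::euclidean_space \<Rightarrow> real"
  assumes \<eta>: "\<eta> \<in> Cc_infinity"
  obtains B where "\<And>x. norm (frac_commutator \<alpha> \<eta> (\<lambda>_. 1) x) \<le> B"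
proof -
  obtain B where B: "\<And>x. integrable lborel (\<lambda>y. norm (frac_kernel \<alpha> (y - x)) * norm (\<eta> y - \<eta> x))"
    "\<And>x. (\<integral>y. norm (frac_kernel \<alpha> (y - x)) * norm (\<eta> y - \<eta> x) \<partial>lborel) \<le> B"
    using frac_increment_integrable[OF \<eta>] by metis
  have "norm (frac_commutator \<alpha> \<eta> (\<lambda>_. 1) x) \<le> B" for x
  proof -
    have "norm (frac_commutator \<alpha> \<eta> (\<lambda>_. 1) x)
        \<le> (\<integral>y. norm ((1 * (\<eta> y - \<eta> x)) *\<^sub>R frac_kernel \<alpha> (y - x)) \<partial>lborel)"
      unfolding frac_commutator_def by (rule integral_norm_bound)
    also have "\<dots> = (\<integral>y. norm (frac_kernel \<alpha> (y - x)) * norm (\<eta> y - \<eta> x) \<partial>lborel)"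
      by (simp add: mult.commute)
    finally show ?thesis using B(2)[of x] by linarith
  qed
  then show thesis by (rule that)
qed

text \<open>The hypothesis \<open>norm (f x) \<le> 1 + F x\<close> covers both \<open>f = 1\<close> and \<open>f\<close> in \<open>L\<^sup>p\<close>.\<close>

lemma frac_increment_pair_integrable:
  fixes \<phi> :: "'a::euclidean_space \<Rightarrow> 'b::euclidean_space" and f F :: "'a \<Rightarrow> real"
  assumes \<phi>: "\<phi> \<in> Cc_infinity" and f: "f \<in> borel_measurable borel"
    and F: "integrable lborel F" "\<And>x. 0 \<le> F x" "\<And>x. norm (f x) \<le> 1 + F x"
  shows "integrable (lborel \<Otimes>\<^sub>M lborel)
    (\<lambda>(x, y). norm (f x) * (norm (frac_kernel \<alpha> (y - x)) * norm (\<phi> y - \<phi> x)))"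
proof -
  let ?w = "frac_weight \<alpha> 1 :: 'a \<Rightarrow> real"
  note [measurable] = Cc_infinity_borel[OF \<phi>] f
  obtain C R where C: "0 < C" "\<And>x y. norm (\<phi> y - \<phi> x) \<le> C * min 1 (norm (y - x)) *
      (indicator (cball 0 R) x + indicator (cball 0 R) y)"
    using Cc_infinity_increment[OF \<phi>] by metis
  let ?i = "indicator (cball (0::'a) R) :: 'a \<Rightarrow> real"
  have "norm (\<phi> y - \<phi> x) \<le> C * min 1 (1 * norm (y - x)) * (?i x + ?i y)" for x y
    using C(2)[of y x] by simp
  then have le: "norm (frac_kernel \<alpha> (y - x)) * norm (\<phi> y - \<phi> x) \<le> C * ?w (y - x) * (?i x + ?i y)" for x y
    by (rule frac_kernel_times_increment)
  have w: "integrable lborel ?w" by (rule frac_weight_integrable_1[OF \<alpha>])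
  have i: "integrable lborel ?i"
    using emeasure_bounded_finite[OF bounded_cball, of "0::'a" R] by (intro integrable_real_indicator) auto
  \<comment> \<open>In \<open>(1 + F x) * (?i x + ?i y)\<close> the mixed terms are at most
    \<open>2 * F x\<close>, as the two indicators add up to at most 2. Each remaining term is then
    the weight at \<open>y - x\<close> times a function of one variable.\<close>
  have "integrable lborel (\<lambda>x. ?i x + 2 * F x)" using i F(1) by simp
  from integrable_pair_lincomb[OF integrable_pair_diff_fst[OF w this] integrable_pair_diff_snd[OF w i]]
  have D: "integrable (lborel \<Otimes>\<^sub>M lborel) (\<lambda>(x, y). C * (?w (y - x) * (?i x + 2 * F x) + ?w (y - x) * ?i y))" .
  show ?thesis
  proof (rule integrable_pair_bound[OF D])
    fix x y
    have "norm (norm (f x) * (norm (frac_kernel \<alpha> (y - x)) * norm (\<phi> y - \<phi> x)))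
        \<le> (1 + F x) * (C * ?w (y - x) * (?i x + ?i y))"
      using mult_mono[OF F(3)[of x] le[of y x]] F(2)[of x] by simp
    also have "\<dots> = C * ?w (y - x) * ((1 + F x) * (?i x + ?i y))" by simp
    also have "\<dots> \<le> C * ?w (y - x) * (?i x + ?i y + 2 * F x)"
    proof (rule mult_left_mono)
      have "F x * (?i x + ?i y) \<le> F x * 2" using F(2)[of x] by (intro mult_left_mono) (auto simp: indicator_def)
      then show "(1 + F x) * (?i x + ?i y) \<le> ?i x + ?i y + 2 * F x" by (simp add: distrib_right)
    qed (use C(1) frac_weight_nonneg[of 1 \<alpha> "y - x"] in simp)
    also have "\<dots> = C * (?w (y - x) * (?i x + 2 * F x) + ?w (y - x) * ?i y)" by (simp add: algebra_simps)
    finally show "norm (norm (f x) * (norm (frac_kernel \<alpha> (y - x)) * norm (\<phi> y - \<phi> x)))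
      \<le> C * (?w (y - x) * (?i x + 2 * F x) + ?w (y - x) * ?i y)" .
  qed measurable
qed

lemma frac_dvg_pair_integrable:
  fixes \<phi> :: "'a::euclidean_space \<Rightarrow> 'a" and f F :: "'a \<Rightarrow> real"
  assumes \<phi>: "\<phi> \<in> Cc_infinity" and f: "f \<in> borel_measurable borel"
    and F: "integrable lborel F" "\<And>x. 0 \<le> F x" "\<And>x. norm (f x) \<le> 1 + F x"
  shows "integrable (lborel \<Otimes>\<^sub>M lborel) (\<lambda>(x, y). f x * (frac_kernel \<alpha> (y - x) \<bullet> (\<phi> y - \<phi> x)))"
    and "integrable lborel (\<lambda>x. f x * frac_dvg \<alpha> \<phi> x)"
proof -
  note [measurable] = Cc_infinity_borel[OF \<phi>] f
  show *: "integrable (lborel \<Otimes>\<^sub>M lborel) (\<lambda>(x, y). f x * (frac_kernel \<alpha> (y - x) \<bullet> (\<phi> y - \<phi> x)))"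
    by (rule integrable_pair_bound[OF frac_increment_pair_integrable[OF assms]])
      (simp_all add: abs_mult mult_left_mono Cauchy_Schwarz_ineq2)
  from lborel_pair.integrable_fst[OF this] show "integrable lborel (\<lambda>x. f x * frac_dvg \<alpha> \<phi> x)"
    by (simp add: frac_dvg_def)
qed

lemma frac_dvg_integrable:
  fixes \<phi> :: "'a::euclidean_space \<Rightarrow> 'a"
  assumes \<phi>: "\<phi> \<in> Cc_infinity"
  shows "integrable lborel (frac_dvg \<alpha> \<phi>)"
  using frac_dvg_pair_integrable(2)[OF \<phi>, of "\<lambda>_. 1" "\<lambda>_. 0"] by simp

lemma frac_commutator_pair_integrable:
  fixes \<eta> f F :: "'a::euclidean_space \<Rightarrow> real"
  assumes \<eta>: "\<eta> \<in> Cc_infinity" and f: "f \<in> borel_measurable borel"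
    and F: "integrable lborel F" "\<And>x. 0 \<le> F x" "\<And>x. norm (f x) \<le> 1 + F x"
  shows "integrable (lborel \<Otimes>\<^sub>M lborel) (\<lambda>(x, y). (f x * (\<eta> x - \<eta> y)) *\<^sub>R frac_kernel \<alpha> (x - y))"
proof -
  note [measurable] = Cc_infinity_borel[OF \<eta>] f
  have "norm (frac_kernel \<alpha> (y - x)) = norm (frac_kernel \<alpha> (x - y))" for x y :: 'a
    using frac_kernel_minus[of \<alpha> "x - y"] by simp
  then show ?thesis
    by (intro integrable_pair_bound[OF frac_increment_pair_integrable[OF assms]])
      (simp_all add: abs_mult abs_minus_commute mult_ac)
qed

text \<open>The double integral of \<open>?Q\<close> is computed in both orders. With
  \<open>y\<close> inside, the product identity splits it into two divergences; with
  \<open>x\<close> inside, \<open>\<phi> y\<close> is constant and the commutator appears. Each half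
  of the split still contains an increment of a test field and therefore converges.\<close>

lemma frac_leibniz:
  fixes \<eta> f F :: "'a::euclidean_space \<Rightarrow> real" and \<phi> :: "'a \<Rightarrow> 'a"
  assumes \<eta>: "\<eta> \<in> Cc_infinity" and \<phi>: "\<phi> \<in> Cc_infinity" and f: "f \<in> borel_measurable borel"
    and F: "integrable lborel F" "\<And>x. 0 \<le> F x" "\<And>x. norm (f x) \<le> 1 + F x"
  shows "integrable lborel (\<lambda>y. frac_commutator \<alpha> \<eta> f y \<bullet> \<phi> y)" (is ?A)
    and "(\<integral>x. \<eta> x * f x * frac_dvg \<alpha> \<phi> x \<partial>lborel) =
      (\<integral>x. f x * frac_dvg \<alpha> (\<lambda>x. \<eta> x *\<^sub>R \<phi> x) x \<partial>lborel) -
      (\<integral>y. frac_commutator \<alpha> \<eta> f y \<bullet> \<phi> y \<partial>lborel)" (is ?B)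
proof -
  let ?K = "frac_kernel \<alpha>"
  let ?Q = "\<lambda>x y. ((f x * (\<eta> x - \<eta> y)) *\<^sub>R ?K (x - y)) \<bullet> \<phi> y"
  note [measurable] = Cc_infinity_borel[OF \<eta>] Cc_infinity_borel[OF \<phi>] f
  have \<eta>\<phi>: "(\<lambda>x. \<eta> x *\<^sub>R \<phi> x) \<in> Cc_infinity" by (rule Cc_infinity_scaleR[OF \<eta> \<phi>])
  note P = frac_commutator_pair_integrable[OF \<eta> f F]
  obtain M where M: "0 < M" "\<And>x. norm (\<phi> x) \<le> M" using Cc_infinity_bounded[OF \<phi>] by metis
  have "integrable (lborel \<Otimes>\<^sub>M lborel)
      (\<lambda>(x, y). M * norm ((f x * (\<eta> x - \<eta> y)) *\<^sub>R ?K (x - y)))"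
    using integrable_mult_right[OF integrable_norm[OF P], of M] by (simp only: case_prod_unfold)
  then have Q: "integrable (lborel \<Otimes>\<^sub>M lborel) (\<lambda>(x, y). ?Q x y)"
  proof (rule integrable_pair_bound)
    fix x y
    have "norm (?Q x y) \<le> norm ((f x * (\<eta> x - \<eta> y)) *\<^sub>R ?K (x - y)) * norm (\<phi> y)"
      unfolding real_norm_def by (rule Cauchy_Schwarz_ineq2)
    also have "\<dots> \<le> norm ((f x * (\<eta> x - \<eta> y)) *\<^sub>R ?K (x - y)) * M"
      by (rule mult_left_mono[OF M(2)]) simp
    finally show "norm (?Q x y) \<le> M * norm ((f x * (\<eta> x - \<eta> y)) *\<^sub>R ?K (x - y))" by (simp only: mult.commute)
  qed measurable
  \<comment> \<open>Only almost everywhere: Fubini guarantees convergence of the commutator integral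
    for almost every \<open>y\<close>, and moving the inner product with \<open>\<phi> y\<close>
    outside relies on it.\<close>
  have AE: "AE y in lborel. (\<integral>x. ?Q x y \<partial>lborel) = frac_commutator \<alpha> \<eta> f y \<bullet> \<phi> y"
    using lborel_pair.AE_integrable_snd[OF P]
  proof (rule AE_mp, intro AE_I2 impI)
    fix y assume "integrable lborel (\<lambda>x. (f x * (\<eta> x - \<eta> y)) *\<^sub>R ?K (x - y))"
    then show "(\<integral>x. ?Q x y \<partial>lborel) = frac_commutator \<alpha> \<eta> f y \<bullet> \<phi> y"
      unfolding frac_commutator_def by (intro integral_inner_left)
  qed
  show ?A
    using lborel_pair.integrable_snd[OF Q] by (rule integrable_cong_AE_imp) (use AE in \<open>auto elim: AE_mp\<close>)
  have comm: "(\<integral>y. \<integral>x. ?Q x y \<partial>lborel \<partial>lborel) = (\<integral>y. frac_commutator \<alpha> \<eta> f y \<bullet> \<phi> y \<partial>lborel)"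
    by (rule integral_cong_AE) (use AE in simp_all)
  have "\<eta> x * f x * frac_dvg \<alpha> \<phi> x = f x * frac_dvg \<alpha> (\<lambda>x. \<eta> x *\<^sub>R \<phi> x) x - (\<integral>y. ?Q x y \<partial>lborel)" for x
  proof -
    note i = frac_dvg_integrand_integrable[OF \<phi>, of x] frac_dvg_integrand_integrable[OF \<eta>\<phi>, of x]
    have "?Q x y = f x * (?K (y - x) \<bullet> (\<eta> y *\<^sub>R \<phi> y - \<eta> x *\<^sub>R \<phi> x)) - (\<eta> x * f x) * (?K (y - x) \<bullet> (\<phi> y - \<phi> x))" for y
      using frac_kernel_minus[of \<alpha> "y - x"] by (simp add: algebra_simps)
    then have "(\<integral>y. ?Q x y \<partial>lborel) = (\<integral>y. f x * (?K (y - x) \<bullet> (\<eta> y *\<^sub>R \<phi> y - \<eta> x *\<^sub>R \<phi> x))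
        - (\<eta> x * f x) * (?K (y - x) \<bullet> (\<phi> y - \<phi> x)) \<partial>lborel)"
      by (simp only:)
    also have "\<dots> = f x * frac_dvg \<alpha> (\<lambda>x. \<eta> x *\<^sub>R \<phi> x) x - \<eta> x * f x * frac_dvg \<alpha> \<phi> x"
      using i by (subst Bochner_Integration.integral_diff) (simp_all add: frac_dvg_def)
    finally show ?thesis by simp
  qed
  then have "(\<integral>x. \<eta> x * f x * frac_dvg \<alpha> \<phi> x \<partial>lborel) =
      (\<integral>x. f x * frac_dvg \<alpha> (\<lambda>x. \<eta> x *\<^sub>R \<phi> x) x - (\<integral>y. ?Q x y \<partial>lborel) \<partial>lborel)"
    by (simp only:)
  also have "\<dots> = (\<integral>x. f x * frac_dvg \<alpha> (\<lambda>x. \<eta> x *\<^sub>R \<phi> x) x \<partial>lborel) - (\<integral>x. \<integral>y. ?Q x y \<partial>lborel \<partial>lborel)"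
    by (rule Bochner_Integration.integral_diff[OF frac_dvg_pair_integrable(2)[OF \<eta>\<phi> f F] lborel_pair.integrable_fst[OF Q]])
  also have "(\<integral>x. \<integral>y. ?Q x y \<partial>lborel \<partial>lborel) = (\<integral>y. \<integral>x. ?Q x y \<partial>lborel \<partial>lborel)"
    by (rule lborel_pair.Fubini_integral[OF Q, symmetric])
  finally show ?B by (simp only: comm)
qed

text \<open>The integrand is symmetric in \<open>x\<close> and \<open>y\<close>, so exchanging them
  gives nothing. After the substitution \<open>y = x - z\<close> the kernel depends on
  \<open>z\<close> alone; integrating in \<open>x\<close> first leaves the integral of
  \<open>\<phi> (x - z) - \<phi> x\<close>, which vanishes by translation invariance.\<close>

lemma integral_frac_dvg_eq_0:
  fixes \<phi> :: "'a::euclidean_space \<Rightarrow> 'a"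
  assumes \<phi>: "\<phi> \<in> Cc_infinity"
  shows "(\<integral>x. frac_dvg \<alpha> \<phi> x \<partial>lborel) = 0"
proof -
  let ?w = "frac_weight \<alpha> 1 :: 'a \<Rightarrow> real" and ?K = "frac_kernel \<alpha> :: 'a \<Rightarrow> 'a"
  note [measurable] = Cc_infinity_borel[OF \<phi>]
  obtain C R where C: "0 < C" "\<And>x y. norm (\<phi> y - \<phi> x) \<le> C * min 1 (norm (y - x)) *
      (indicator (cball 0 R) x + indicator (cball 0 R) y)"
    using Cc_infinity_increment[OF \<phi>] by metis
  let ?i = "indicator (cball (0::'a) R) :: 'a \<Rightarrow> real"
  have w: "integrable lborel ?w" by (rule frac_weight_integrable_1[OF \<alpha>])
  have i: "integrable lborel ?i"
    using emeasure_bounded_finite[OF bounded_cball, of "0::'a" R] by (intro integrable_real_indicator) auto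
  from integrable_pair_lincomb[OF integrable_pair_product[OF w i] integrable_pair_shifted[OF w i]]
  have D: "integrable (lborel \<Otimes>\<^sub>M lborel) (\<lambda>(x, z). C * (?w z * ?i x + ?w z * ?i (x - z)))" .
  have int: "integrable (lborel \<Otimes>\<^sub>M lborel) (\<lambda>(x, z). ?K (- z) \<bullet> (\<phi> (x - z) - \<phi> x))"
  proof (rule integrable_pair_bound[OF D])
    fix x z
    have "norm (?K (- z) \<bullet> (\<phi> (x - z) - \<phi> x)) \<le> norm (?K (- z)) * norm (\<phi> (x - z) - \<phi> x)"
      unfolding real_norm_def by (rule Cauchy_Schwarz_ineq2)
    also have "\<dots> \<le> C * ?w (- z) * (?i x + ?i (x - z))"
      using C(2)[of "x - z" x] by (intro frac_kernel_times_increment) simp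
    finally show "norm (?K (- z) \<bullet> (\<phi> (x - z) - \<phi> x)) \<le> C * (?w z * ?i x + ?w z * ?i (x - z))"
      by (simp add: distrib_left mult.assoc)
  qed measurable
  have "frac_dvg \<alpha> \<phi> x = (\<integral>z. ?K (- z) \<bullet> (\<phi> (x - z) - \<phi> x) \<partial>lborel)" for x
    unfolding frac_dvg_def
    using integral_reflect(1)[of "\<lambda>y. ?K (y - x) \<bullet> (\<phi> y - \<phi> x)" x] by simp
  then have "(\<integral>x. frac_dvg \<alpha> \<phi> x \<partial>lborel) = (\<integral>x. \<integral>z. ?K (- z) \<bullet> (\<phi> (x - z) - \<phi> x) \<partial>lborel \<partial>lborel)"
    by (simp only:)
  also have "\<dots> = (\<integral>z. \<integral>x. ?K (- z) \<bullet> (\<phi> (x - z) - \<phi> x) \<partial>lborel \<partial>lborel)"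
    by (rule lborel_pair.Fubini_integral[OF int, symmetric])
  also have "\<dots> = integral\<^sup>L lborel (\<lambda>z::'a. 0)"
  proof (rule Bochner_Integration.integral_cong)
    fix z
    note i\<phi> = Cc_infinity_integrable[OF \<phi>]
    have i1: "integrable lborel (\<lambda>x. \<phi> (- z + x))" using i\<phi> integral_shift(2)[of \<phi> "- z"] by simp
    have "(\<integral>x. \<phi> (- z + x) - \<phi> x \<partial>lborel) = 0"
      using Bochner_Integration.integral_diff[OF i1 i\<phi>] integral_shift(1)[of \<phi> "- z"] by simp
    moreover have "(\<integral>x. ?K (- z) \<bullet> (\<phi> (- z + x) - \<phi> x) \<partial>lborel) = ?K (- z) \<bullet> (\<integral>x. \<phi> (- z + x) - \<phi> x \<partial>lborel)"
      by (rule integral_inner_right) (intro Bochner_Integration.integrable_diff i1 i\<phi>)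
    ultimately show "(\<integral>x. ?K (- z) \<bullet> (\<phi> (x - z) - \<phi> x) \<partial>lborel) = 0" by simp
  qed simp
  finally show ?thesis by simp
qed

text \<open>Translation invariance of the kernel and Fubini. Translates of \<phi> obey the same
  increment bound, so for fixed \<open>x\<close> the majorant is a product of a function of
  \<open>u\<close> and a function of \<open>y\<close>.\<close>

lemma frac_dvg_convolution:
  fixes \<phi> :: "'a::euclidean_space \<Rightarrow> 'a"
  assumes \<rho>: "\<rho> \<in> Cc_infinity" and \<phi>: "\<phi> \<in> Cc_infinity"
  shows "frac_dvg \<alpha> (convolution \<rho> \<phi>) x = convolution \<rho> (frac_dvg \<alpha> \<phi>) x"
proof -
  let ?w = "frac_weight \<alpha> 1 :: 'a \<Rightarrow> real" and ?K = "frac_kernel \<alpha> :: 'a \<Rightarrow> 'a"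
  note [measurable] = Cc_infinity_borel[OF \<phi>] Cc_infinity_borel[OF \<rho>]
  note i\<rho> = Cc_infinity_integrable[OF \<rho>]
  obtain C where C: "0 < C" "\<And>x y. norm (\<phi> y - \<phi> x) \<le> C * min 1 (norm (y - x))"
    using Cc_infinity_increment_le[OF \<phi>] by metis
  have C2: "norm (\<phi> y - \<phi> x) \<le> C * min 1 (1 * norm (y - x)) * 1" for x y
    using C(2)[of y x] by simp
  have "integrable lborel (\<lambda>y. C * ?w (- x + y))"
    using integral_shift(2)[of ?w "- x"] frac_weight_integrable_1[OF \<alpha>, where ?'a = 'a]
    by (intro integrable_mult_right) simp
  then have D: "integrable (lborel \<Otimes>\<^sub>M lborel) (\<lambda>(y, u). norm (\<rho> u) * (C * ?w (- x + y)))"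
    by (rule integrable_pair_product[OF integrable_norm[OF i\<rho>]])
  have int: "integrable (lborel \<Otimes>\<^sub>M lborel) (\<lambda>(y, u). \<rho> u * (?K (y - x) \<bullet> (\<phi> (y - u) - \<phi> (x - u))))"
  proof (rule integrable_pair_bound[OF D])
    fix y u
    have "\<bar>?K (y - x) \<bullet> (\<phi> (y - u) - \<phi> (x - u))\<bar> \<le> norm (?K (y - x)) * norm (\<phi> (y - u) - \<phi> (x - u))"
      by (rule Cauchy_Schwarz_ineq2)
    also have "\<dots> \<le> C * ?w (y - x) * 1"
      using C2[of "y - u" "x - u"] by (intro frac_kernel_times_increment) simp
    finally have "norm (\<rho> u) * \<bar>?K (y - x) \<bullet> (\<phi> (y - u) - \<phi> (x - u))\<bar> \<le> norm (\<rho> u) * (C * ?w (y - x) * 1)"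
      by (rule mult_left_mono) simp
    then show "norm (\<rho> u * (?K (y - x) \<bullet> (\<phi> (y - u) - \<phi> (x - u)))) \<le> norm (\<rho> u) * (C * ?w (- x + y))"
      by (simp add: abs_mult mult_ac)
  qed measurable
  have "convolution \<rho> \<phi> y - convolution \<rho> \<phi> x = (\<integral>u. \<rho> u *\<^sub>R (\<phi> (y - u) - \<phi> (x - u)) \<partial>lborel)" for y
    unfolding convolution_def scaleR_right_diff_distrib
    by (rule Bochner_Integration.integral_diff[symmetric])
      (rule integrable_convolution_smooth[OF i\<rho> \<phi>])+
  moreover have "integrable lborel (\<lambda>u. \<rho> u *\<^sub>R (\<phi> (y - u) - \<phi> (x - u)))" for y
    unfolding scaleR_right_diff_distrib
    by (intro Bochner_Integration.integrable_diff integrable_convolution_smooth[OF i\<rho> \<phi>])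
  ultimately have "?K (y - x) \<bullet> (convolution \<rho> \<phi> y - convolution \<rho> \<phi> x)
      = (\<integral>u. \<rho> u * (?K (y - x) \<bullet> (\<phi> (y - u) - \<phi> (x - u))) \<partial>lborel)" for y
    using integral_inner_right[of "?K (y - x)" lborel "\<lambda>u. \<rho> u *\<^sub>R (\<phi> (y - u) - \<phi> (x - u))"] by simp
  then have "frac_dvg \<alpha> (convolution \<rho> \<phi>) x
      = (\<integral>y. \<integral>u. \<rho> u * (?K (y - x) \<bullet> (\<phi> (y - u) - \<phi> (x - u))) \<partial>lborel \<partial>lborel)"
    by (simp only: frac_dvg_def)
  also have "\<dots> = (\<integral>u. \<integral>y. \<rho> u * (?K (y - x) \<bullet> (\<phi> (y - u) - \<phi> (x - u))) \<partial>lborel \<partial>lborel)"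
    by (rule lborel_pair.Fubini_integral[OF int, symmetric])
  also have "\<dots> = (\<integral>u. \<rho> u * frac_dvg \<alpha> \<phi> (x - u) \<partial>lborel)"
  proof (rule Bochner_Integration.integral_cong[OF refl])
    fix u
    have "(\<integral>y. ?K (y - (x - u)) \<bullet> (\<phi> y - \<phi> (x - u)) \<partial>lborel)
        = (\<integral>y. ?K ((- u + y) - (x - u)) \<bullet> (\<phi> (- u + y) - \<phi> (x - u)) \<partial>lborel)"
      by (rule integral_shift(1)[symmetric]) measurable
    then show "(\<integral>y. \<rho> u * (?K (y - x) \<bullet> (\<phi> (y - u) - \<phi> (x - u))) \<partial>lborel) = \<rho> u * frac_dvg \<alpha> \<phi> (x - u)"
      by (simp add: frac_dvg_def)
  qed
  finally show ?thesis by (simp add: convolution_def)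
qed

end

text \<open>The adjoint convolves with the reflected kernel. Inner products cover the scalar pairing
  with a divergence and the vector pairing with a gradient; \<open>\<psi>\<close> is taken
  integrable and bounded because a fractional divergence need not have compact support.\<close>

lemma convolution_adjoint:
  fixes f \<psi> :: "'a::euclidean_space \<Rightarrow> 'b::euclidean_space"
  assumes \<rho>: "\<rho> \<in> Cc_infinity" and f: "f \<in> Lp_borel p" and p: "1 \<le> p"
    and \<psi>: "integrable lborel \<psi>" "\<And>x. norm (\<psi> x) \<le> M"
  shows "(\<integral>x. convolution \<rho> f x \<bullet> \<psi> x \<partial>lborel) = (\<integral>y. f y \<bullet> convolution (\<lambda>u. \<rho> (- u)) \<psi> y \<partial>lborel)"
proof -
  note [measurable] = Cc_infinity_borel[OF \<rho>] Lp_borelD(1)[OF f]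
  have [measurable]: "\<psi> \<in> borel_measurable borel" using \<psi>(1) by (simp add: borel_measurable_integrable)
  have \<rho>': "(\<lambda>u. \<rho> (- u)) \<in> Cc_infinity" using Cc_infinity_affine[OF \<rho>, of "- 1" 0] by simp
  note i\<rho> = integrable_norm[OF Cc_infinity_integrable[OF \<rho>]] integrable_norm[OF Cc_infinity_integrable[OF \<rho>']]
  have "integrable lborel (\<lambda>y. M * norm (f y) powr p)" using Lp_borelD(2)[OF f] by simp
  from integrable_pair_lincomb[OF integrable_pair_diff_snd[OF i\<rho>(2) this]
      integrable_pair_diff_fst[OF i\<rho>(2) integrable_norm[OF \<psi>(1)]], of 1]
  have D: "integrable (lborel \<Otimes>\<^sub>M lborel)
      (\<lambda>(x, y). norm (\<rho> (x - y)) * (M * norm (f y) powr p) + norm (\<rho> (x - y)) * norm (\<psi> x))"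
    by simp
  let ?Q = "\<lambda>x y. \<rho> (x - y) * (f y \<bullet> \<psi> x)"
  have int: "integrable (lborel \<Otimes>\<^sub>M lborel) (\<lambda>(x, y). ?Q x y)"
  proof (rule integrable_pair_bound[OF D])
    fix x y
    have "\<bar>f y \<bullet> \<psi> x\<bar> \<le> norm (f y) * norm (\<psi> x)" by (rule Cauchy_Schwarz_ineq2)
    also have "\<dots> \<le> (1 + norm (f y) powr p) * norm (\<psi> x)"
      by (intro mult_right_mono le_one_plus_powr p) auto
    also have "\<dots> \<le> M * norm (f y) powr p + norm (\<psi> x)"
      using mult_right_mono[OF \<psi>(2)[of x], of "norm (f y) powr p"] by (simp add: algebra_simps)
    finally have "norm (\<rho> (x - y)) * \<bar>f y \<bullet> \<psi> x\<bar> \<le> norm (\<rho> (x - y)) * (M * norm (f y) powr p + norm (\<psi> x))"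
      by (rule mult_left_mono) simp
    then show "norm (?Q x y) \<le> norm (\<rho> (x - y)) * (M * norm (f y) powr p) + norm (\<rho> (x - y)) * norm (\<psi> x)"
      by (simp add: abs_mult distrib_left)
  qed measurable
  have 1: "convolution \<rho> f x \<bullet> \<psi> x = (\<integral>y. ?Q x y \<partial>lborel)" for x
  proof -
    have "convolution \<rho> f x \<bullet> \<psi> x = (\<integral>u. (\<rho> u *\<^sub>R f (x - u)) \<bullet> \<psi> x \<partial>lborel)"
      unfolding convolution_def
      by (rule integral_inner_left[symmetric], rule integrable_convolution[OF \<rho> f p])
    also have "\<dots> = (\<integral>y. (\<rho> (x - y) *\<^sub>R f (x - (x - y))) \<bullet> \<psi> x \<partial>lborel)"
      by (rule integral_reflect(1)[symmetric]) measurable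
    finally show ?thesis by simp
  qed
  have "\<psi> \<in> Lp_borel 1" using integrable_norm[OF \<psi>(1)] by (simp add: Lp_borel_def)
  note i\<psi> = integrable_convolution[OF \<rho>' this order_refl]
  have 2: "f y \<bullet> convolution (\<lambda>u. \<rho> (- u)) \<psi> y = (\<integral>x. ?Q x y \<partial>lborel)" for y
  proof -
    have "f y \<bullet> convolution (\<lambda>u. \<rho> (- u)) \<psi> y = (\<integral>u. f y \<bullet> (\<rho> (- u) *\<^sub>R \<psi> (y - u)) \<partial>lborel)"
      unfolding convolution_def by (rule integral_inner_right[symmetric], rule i\<psi>)
    also have "\<dots> = (\<integral>x. f y \<bullet> (\<rho> (- (y - x)) *\<^sub>R \<psi> (y - (y - x))) \<partial>lborel)"
      by (rule integral_reflect(1)[symmetric]) measurable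
    finally show ?thesis by simp
  qed
  show ?thesis unfolding 1 2 by (rule lborel_pair.Fubini_integral[OF int, symmetric])
qed

section \<open>Weak fractional gradients\<close>

lemma borel_imp_lebesgue_measurable:
  fixes f :: "'a::euclidean_space \<Rightarrow> 'b::euclidean_space"
  shows "f \<in> borel_measurable borel \<Longrightarrow> f \<in> borel_measurable lebesgue"
  by (intro measurable_completion) simp

lemma frac_div_eq_dvg:
  fixes \<phi> :: "real ^ 'n \<Rightarrow> real ^ 'n"
  assumes [measurable]: "\<phi> \<in> borel_measurable borel"
  shows "frac_div \<alpha> \<phi> x = frac_mu CARD('n) \<alpha> * frac_dvg \<alpha> \<phi> x"
proof -
  have "(\<integral>y. ((y - x) \<bullet> (\<phi> y - \<phi> x)) / norm (y - x) powr (real CARD('n) + \<alpha> + 1) \<partial>lebesgue)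
      = (\<integral>y. frac_kernel \<alpha> (y - x) \<bullet> (\<phi> y - \<phi> x) \<partial>lebesgue)"
    by (simp add: frac_kernel_def)
  also have "\<dots> = frac_dvg \<alpha> \<phi> x"
    unfolding frac_dvg_def by (rule integral_completion) simp
  finally show ?thesis by (simp add: frac_div_def)
qed

text \<open>The defining identity for Borel representatives, with the constant outside the integral.
  Local integrability of \<open>g\<close> is supplied separately, through
  \<open>g \<in> Lp_borel p\<close>.\<close>

definition borel_frac_grad :: "real \<Rightarrow> (real ^ 'n \<Rightarrow> real) \<Rightarrow> (real ^ 'n \<Rightarrow> real ^ 'n) \<Rightarrow> bool" where
  "borel_frac_grad \<alpha> f g \<longleftrightarrow> (\<forall>\<phi>\<in>Cc_infinity.
     frac_mu CARD('n) \<alpha> * (\<integral>x. f x * frac_dvg \<alpha> \<phi> x \<partial>lborel) = - (\<integral>x. g x \<bullet> \<phi> x \<partial>lborel))"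

lemma has_weak_frac_grad_iff_borel:
  fixes f f0 :: "real ^ 'n \<Rightarrow> real" and g g0 :: "real ^ 'n \<Rightarrow> real ^ 'n"
  assumes f: "f \<in> borel_measurable lebesgue" "f0 \<in> borel_measurable borel" "AE x in lebesgue. f x = f0 x"
    and g: "g \<in> L1_loc" "g0 \<in> borel_measurable borel" "AE x in lebesgue. g x = g0 x"
  shows "has_weak_frac_grad \<alpha> f g \<longleftrightarrow> borel_frac_grad \<alpha> f0 g0"
proof -
  have gm: "g \<in> borel_measurable lebesgue" using g(1) by (simp add: L1_loc_def)
  have "(\<integral>x. f x * frac_div \<alpha> \<phi> x \<partial>lebesgue) = frac_mu CARD('n) \<alpha> * (\<integral>x. f0 x * frac_dvg \<alpha> \<phi> x \<partial>lborel)"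
    and "(\<integral>x. g x \<bullet> \<phi> x \<partial>lebesgue) = (\<integral>x. g0 x \<bullet> \<phi> x \<partial>lborel)"
    if \<phi>: "\<phi> \<in> Cc_infinity" for \<phi> :: "real ^ 'n \<Rightarrow> real ^ 'n"
  proof -
    note [measurable] = Cc_infinity_borel[OF \<phi>] f(2) g(2)
    have \<phi>m: "\<phi> \<in> borel_measurable lebesgue" by (rule borel_imp_lebesgue_measurable) simp
    have "(\<integral>x. f x * frac_div \<alpha> \<phi> x \<partial>lebesgue) = (\<integral>x. f x * (frac_mu CARD('n) \<alpha> * frac_dvg \<alpha> \<phi> x) \<partial>lebesgue)"
      by (simp add: frac_div_eq_dvg)
    also have "\<dots> = (\<integral>x. f0 x * (frac_mu CARD('n) \<alpha> * frac_dvg \<alpha> \<phi> x) \<partial>lborel)"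
    proof (rule integral_borel_version(1))
      have "(\<lambda>x. frac_mu CARD('n) \<alpha> * frac_dvg \<alpha> \<phi> x) \<in> borel_measurable lebesgue"
        by (rule borel_imp_lebesgue_measurable) simp
      with f(1) show "(\<lambda>x. f x * (frac_mu CARD('n) \<alpha> * frac_dvg \<alpha> \<phi> x)) \<in> borel_measurable lebesgue"
        by (rule borel_measurable_times)
      show "AE x in lebesgue. f x * (frac_mu CARD('n) \<alpha> * frac_dvg \<alpha> \<phi> x) = f0 x * (frac_mu CARD('n) \<alpha> * frac_dvg \<alpha> \<phi> x)"
        using f(3) by eventually_elim simp
    qed simp
    also have "\<dots> = (\<integral>x. frac_mu CARD('n) \<alpha> * (f0 x * frac_dvg \<alpha> \<phi> x) \<partial>lborel)" by (simp only: mult.left_commute)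
    also have "\<dots> = frac_mu CARD('n) \<alpha> * (\<integral>x. f0 x * frac_dvg \<alpha> \<phi> x \<partial>lborel)"
      by (rule integral_mult_right_zero)
    finally show "(\<integral>x. f x * frac_div \<alpha> \<phi> x \<partial>lebesgue) = frac_mu CARD('n) \<alpha> * (\<integral>x. f0 x * frac_dvg \<alpha> \<phi> x \<partial>lborel)" .
    show "(\<integral>x. g x \<bullet> \<phi> x \<partial>lebesgue) = (\<integral>x. g0 x \<bullet> \<phi> x \<partial>lborel)"
    proof (rule integral_borel_version(1))
      show "(\<lambda>x. g x \<bullet> \<phi> x) \<in> borel_measurable lebesgue" using gm \<phi>m by (rule borel_measurable_inner)
      show "AE x in lebesgue. g x \<bullet> \<phi> x = g0 x \<bullet> \<phi> x" using g(3) by eventually_elim simp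
    qed simp
  qed
  then show ?thesis using g(1) by (simp add: has_weak_frac_grad_def borel_frac_grad_def)
qed

lemma Lp_borel_imp_Lp_space: "f \<in> Lp_borel p \<Longrightarrow> f \<in> Lp_space p"
  by (auto simp: Lp_borel_def Lp_space_def integrable_completion intro: borel_imp_lebesgue_measurable)

lemma Lp_space_imp_L1_loc:
  fixes f :: "'a::euclidean_space \<Rightarrow> 'b::euclidean_space"
  assumes f: "f \<in> Lp_space p" and p: "1 \<le> p"
  shows "f \<in> L1_loc"
proof -
  have fm: "f \<in> borel_measurable lebesgue" "integrable lebesgue (\<lambda>x. norm (f x) powr p)"
    using f by (auto simp: Lp_space_def)
  have le: "norm (f x) \<le> 1 + norm (f x) powr p" for x
    by (rule le_one_plus_powr[OF p norm_ge_zero])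
  have "integrable lebesgue (\<lambda>x. indicator K x *\<^sub>R f x)" if K: "compact K" for K
  proof (rule Bochner_Integration.integrable_bound)
    have Ks: "K \<in> sets borel" using compact_imp_closed[OF K] by simp
    have "integrable lborel (indicator K :: 'a \<Rightarrow> real)"
      using emeasure_bounded_finite[OF compact_imp_bounded[OF K]] Ks by (intro integrable_real_indicator) auto
    then have "integrable lebesgue (indicator K :: 'a \<Rightarrow> real)"
      using Ks by (subst integrable_completion) (auto intro: borel_measurable_indicator)
    then show "integrable lebesgue (\<lambda>x. indicator K x + norm (f x) powr p)" using fm(2) by simp
    show "(\<lambda>x. indicator K x *\<^sub>R f x) \<in> borel_measurable lebesgue"
      using fm(1) Ks by (intro borel_measurable_scaleR borel_measurable_indicator) auto
    show "AE x in lebesgue. norm (indicator K x *\<^sub>R f x) \<le> norm (indicator K x + norm (f x) powr p)"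
      using le by (intro AE_I2) (simp add: indicator_def)
  qed
  then show ?thesis using fm by (simp add: L1_loc_def set_integrable_def)
qed

lemma Lp_space_borel_version:
  fixes f :: "'a::euclidean_space \<Rightarrow> 'b::euclidean_space"
  assumes f: "f \<in> Lp_space p"
  obtains f0 where "f0 \<in> Lp_borel p" "AE x in lebesgue. f x = f0 x"
proof -
  have fm: "f \<in> borel_measurable lebesgue" "integrable lebesgue (\<lambda>x. norm (f x) powr p)"
    using f by (auto simp: Lp_space_def)
  obtain f0 where f0: "f0 \<in> borel_measurable borel" "AE x in lebesgue. f x = f0 x"
    using lebesgue_measurable_borel_version[OF fm(1)] by blast
  note [measurable] = f0(1)
  have "integrable lborel (\<lambda>x. norm (f0 x) powr p)"
  proof (rule integral_borel_version(2)[THEN iffD1])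
    show "AE x in lebesgue. norm (f x) powr p = norm (f0 x) powr p"
      using f0(2) by eventually_elim simp
  qed (use fm in \<open>auto dest: borel_measurable_integrable\<close>)
  with f0 show thesis by (intro that[of f0]) (auto simp: Lp_borel_def)
qed

lemma Lp_norm_eq_modular:
  fixes f f0 :: "'a::euclidean_space \<Rightarrow> 'b::euclidean_space"
  assumes f: "f \<in> borel_measurable lebesgue" and f0: "f0 \<in> borel_measurable borel"
    and eq: "AE x in lebesgue. f x = f0 x"
  shows "Lp_norm p f = Lp_modular p f0 powr (1 / p)"
proof -
  have "(\<integral>x. norm (f x) powr p \<partial>lebesgue) = (\<integral>x. norm (f0 x) powr p \<partial>lborel)"
  proof (rule integral_borel_version(1))
    show "(\<lambda>x. norm (f x) powr p) \<in> borel_measurable lebesgue"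
      using f by measurable
    show "AE x in lebesgue. norm (f x) powr p = norm (f0 x) powr p"
      using eq by eventually_elim simp
  qed (use f0 in measurable)
  then show ?thesis by (simp add: Lp_norm_def Lp_modular_def)
qed

lemma L1_loc_inner_integrable:
  fixes g \<phi> :: "'a::euclidean_space \<Rightarrow> 'b::euclidean_space"
  assumes g: "g \<in> L1_loc" and \<phi>: "\<phi> \<in> Cc_infinity"
  shows "integrable lebesgue (\<lambda>x. g x \<bullet> \<phi> x)"
proof -
  obtain M where M: "0 < M" "\<And>x. norm (\<phi> x) \<le> M" using Cc_infinity_bounded[OF \<phi>] by metis
  obtain R where R: "\<And>x. norm x > R \<Longrightarrow> \<phi> x = 0" using Cc_infinityE[OF \<phi>] by metis
  have "integrable lebesgue (\<lambda>x. indicator (cball 0 R) x *\<^sub>R g x)"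
    using g by (simp add: L1_loc_def set_integrable_def)
  note bound = integrable_mult_right[OF integrable_norm[OF this], of M]
  have "\<phi> \<in> borel_measurable lebesgue" by (intro borel_imp_lebesgue_measurable Cc_infinity_borel \<phi>)
  then have "(\<lambda>x. g x \<bullet> \<phi> x) \<in> borel_measurable lebesgue"
    using g by (intro borel_measurable_inner) (auto simp: L1_loc_def)
  from bound this show ?thesis
  proof (rule Bochner_Integration.integrable_bound, intro AE_I2)
    fix x
    show "norm (g x \<bullet> \<phi> x) \<le> norm (M * norm (indicator (cball 0 R) x *\<^sub>R g x))"
    proof (cases "norm x > R")
      case False
      have "norm (g x \<bullet> \<phi> x) \<le> norm (g x) * norm (\<phi> x)"
        unfolding real_norm_def by (rule Cauchy_Schwarz_ineq2)
      also have "\<dots> \<le> norm (g x) * M" by (intro mult_left_mono M) simp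
      finally show ?thesis using False M(1) by (simp add: abs_mult mult.commute)
    qed (simp add: R)
  qed
qed

text \<open>The difference of the two gradients annihilates every test field, and
  \<open>borel_AE_zero\<close> applies to a Borel version of it.\<close>

lemma weak_frac_grad_unique:
  fixes f :: "real ^ 'n \<Rightarrow> real"
  assumes g: "has_weak_frac_grad \<alpha> f g" and h: "has_weak_frac_grad \<alpha> f h"
  shows "AE x in lebesgue. g x = h x"
proof -
  have L: "g \<in> L1_loc" "h \<in> L1_loc" using g h by (auto simp: has_weak_frac_grad_def)
  then have dm: "(\<lambda>x. g x - h x) \<in> borel_measurable lebesgue" by (intro borel_measurable_diff) (auto simp: L1_loc_def)
  obtain d where d: "d \<in> borel_measurable borel" "AE x in lebesgue. g x - h x = d x"
    using lebesgue_measurable_borel_version[OF dm] by blast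
  note [measurable] = d(1)
  have "AE x in lborel. d x = 0"
  proof (rule borel_AE_zero[OF d(1)])
    fix R
    have "integrable lebesgue (\<lambda>x. indicator (cball 0 R) x *\<^sub>R g x - indicator (cball 0 R) x *\<^sub>R h x)"
      using L by (intro Bochner_Integration.integrable_diff) (auto simp: L1_loc_def set_integrable_def)
    then have i: "integrable lebesgue (\<lambda>x. indicator (cball 0 R) x *\<^sub>R (g x - h x))"
      by (simp only: scaleR_right_diff_distrib)
    show "integrable lborel (\<lambda>x. indicator (cball 0 R) x *\<^sub>R d x)"
    proof (rule integral_borel_version(2)[THEN iffD1, OF _ _ _ i])
      show "(\<lambda>x. indicator (cball 0 R) x *\<^sub>R d x) \<in> borel_measurable borel"
        by (intro borel_measurable_scaleR borel_measurable_indicator d) simp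
      show "AE x in lebesgue. indicator (cball 0 R) x *\<^sub>R (g x - h x) = indicator (cball 0 R) x *\<^sub>R d x"
        using d(2) by eventually_elim simp
    qed (rule borel_measurable_integrable[OF i])
  next
    fix \<phi> :: "real ^ 'n \<Rightarrow> real ^ 'n"
    assume \<phi>: "\<phi> \<in> Cc_infinity"
    note [measurable] = Cc_infinity_borel[OF \<phi>]
    note i = L1_loc_inner_integrable[OF L(1) \<phi>] L1_loc_inner_integrable[OF L(2) \<phi>]
    have "(\<integral>x. g x \<bullet> \<phi> x \<partial>lebesgue) = (\<integral>x. h x \<bullet> \<phi> x \<partial>lebesgue)"
      using g h \<phi> by (simp add: has_weak_frac_grad_def)
    then have "(\<integral>x. g x \<bullet> \<phi> x - h x \<bullet> \<phi> x \<partial>lebesgue) = 0"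
      using i by (simp add: Bochner_Integration.integral_diff)
    moreover have "(\<integral>x. g x \<bullet> \<phi> x - h x \<bullet> \<phi> x \<partial>lebesgue) = (\<integral>x. d x \<bullet> \<phi> x \<partial>lborel)"
    proof (rule integral_borel_version(1))
      show "(\<lambda>x. g x \<bullet> \<phi> x - h x \<bullet> \<phi> x) \<in> borel_measurable lebesgue"
        using i by (intro borel_measurable_integrable Bochner_Integration.integrable_diff)
      show "AE x in lebesgue. g x \<bullet> \<phi> x - h x \<bullet> \<phi> x = d x \<bullet> \<phi> x"
        using d(2) by eventually_elim (simp add: inner_diff_left[symmetric])
    qed simp
    ultimately show "(\<integral>x. d x \<bullet> \<phi> x \<partial>lborel) = 0" by simp
  qed
  then have "AE x in lebesgue. d x = 0" by (rule AE_completion)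
  with d(2) show ?thesis by eventually_elim simp
qed

lemma Lp_borel_inner_Cc_integrable:
  fixes g \<phi> :: "'a::euclidean_space \<Rightarrow> 'b::euclidean_space"
  assumes g: "g \<in> Lp_borel p" and \<phi>: "\<phi> \<in> Cc_infinity" and p: "1 \<le> p"
  shows "integrable lborel (\<lambda>x. g x \<bullet> \<phi> x)"
proof -
  note [measurable] = Lp_borelD(1)[OF g] Cc_infinity_borel[OF \<phi>]
  obtain M where M: "\<And>x. norm (\<phi> x) \<le> M" using Cc_infinity_bounded[OF \<phi>] by metis
  show ?thesis
    by (rule Lp_borel_times_bounded_integrable[OF g Cc_infinity_integrable[OF \<phi>] M p])
      (simp_all add: Cauchy_Schwarz_ineq2)
qed

lemma Cc_infinity_Lp_borel:
  fixes f :: "'a::euclidean_space \<Rightarrow> 'b::euclidean_space"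
  assumes f: "f \<in> Cc_infinity" and p: "1 \<le> p"
  shows "f \<in> Lp_borel p"
proof -
  obtain M where "\<And>x. norm (f x) \<le> M" using Cc_infinity_bounded[OF f] by metis
  from Lp_borel_of_bounded_integrable[OF Cc_infinity_integrable[OF f] this p] show ?thesis .
qed

section \<open>Weak gradients of differences, products and mollifications\<close>

context
  fixes \<alpha> p :: real
  assumes \<alpha>: "0 < \<alpha>" "\<alpha> < 1" and p: "1 \<le> p"
begin

lemma Lp_borel_frac_dvg_integrable:
  fixes f :: "'a::euclidean_space \<Rightarrow> real" and \<phi> :: "'a \<Rightarrow> 'a"
  assumes f: "f \<in> Lp_borel p" and \<phi>: "\<phi> \<in> Cc_infinity"
  shows "integrable lborel (\<lambda>x. f x * frac_dvg \<alpha> \<phi> x)"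
proof -
  note [measurable] = Lp_borelD(1)[OF f] Cc_infinity_borel[OF \<phi>]
  obtain M where M: "\<And>x. norm (frac_dvg \<alpha> \<phi> x) \<le> M" using frac_dvg_bounded[OF \<alpha> \<phi>] by metis
  show ?thesis
    by (rule Lp_borel_times_bounded_integrable[OF f frac_dvg_integrable[OF \<alpha> \<phi>] M p])
      (simp_all add: abs_mult)
qed

lemma borel_frac_grad_diff:
  fixes f1 f2 :: "real ^ 'n \<Rightarrow> real"
  assumes "borel_frac_grad \<alpha> f1 g1" "borel_frac_grad \<alpha> f2 g2"
    and "f1 \<in> Lp_borel p" "f2 \<in> Lp_borel p" "g1 \<in> Lp_borel p" "g2 \<in> Lp_borel p"
  shows "borel_frac_grad \<alpha> (\<lambda>x. f1 x - f2 x) (\<lambda>x. g1 x - g2 x)"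
  unfolding borel_frac_grad_def
proof
  fix \<phi> :: "real ^ 'n \<Rightarrow> real ^ 'n"
  assume \<phi>: "\<phi> \<in> Cc_infinity"
  have "(\<integral>x. (f1 x - f2 x) * frac_dvg \<alpha> \<phi> x \<partial>lborel)
      = (\<integral>x. f1 x * frac_dvg \<alpha> \<phi> x \<partial>lborel) - (\<integral>x. f2 x * frac_dvg \<alpha> \<phi> x \<partial>lborel)"
    unfolding left_diff_distrib
    by (intro Bochner_Integration.integral_diff Lp_borel_frac_dvg_integrable assms \<phi>)
  moreover have "(\<integral>x. (g1 x - g2 x) \<bullet> \<phi> x \<partial>lborel) = (\<integral>x. g1 x \<bullet> \<phi> x \<partial>lborel) - (\<integral>x. g2 x \<bullet> \<phi> x \<partial>lborel)"
    unfolding inner_diff_left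
    by (intro Bochner_Integration.integral_diff Lp_borel_inner_Cc_integrable[OF _ \<phi> p] assms)
  ultimately show "frac_mu CARD('n) \<alpha> * (\<integral>x. (f1 x - f2 x) * frac_dvg \<alpha> \<phi> x \<partial>lborel)
      = - (\<integral>x. (g1 x - g2 x) \<bullet> \<phi> x \<partial>lborel)"
    using assms(1,2) \<phi> by (simp add: borel_frac_grad_def right_diff_distrib)
qed

text \<open>\<open>\<eta> \<phi>\<close> is again a test field, so the gradient of \<open>f\<close>
  may be tested against it; \<open>frac_leibniz\<close> converts the divergence of
  \<open>\<eta> \<phi>\<close> into that of \<phi> at the price of the commutator.\<close>

lemma borel_frac_grad_cutoff:
  fixes f :: "real ^ 'n \<Rightarrow> real"
  assumes fg: "borel_frac_grad \<alpha> f g" and f: "f \<in> Lp_borel p" and g: "g \<in> Lp_borel p"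
    and \<eta>: "\<eta> \<in> Cc_infinity"
  shows "borel_frac_grad \<alpha> (\<lambda>x. \<eta> x * f x)
    (\<lambda>x. \<eta> x *\<^sub>R g x + frac_mu CARD('n) \<alpha> *\<^sub>R frac_commutator \<alpha> \<eta> f x)"
  unfolding borel_frac_grad_def
proof
  fix \<phi> :: "real ^ 'n \<Rightarrow> real ^ 'n"
  assume \<phi>: "\<phi> \<in> Cc_infinity"
  let ?\<mu> = "frac_mu CARD('n) \<alpha>"
  note \<eta>\<phi> = Cc_infinity_scaleR[OF \<eta> \<phi>]
  have "norm (f x) \<le> 1 + norm (f x) powr p" for x
    by (rule le_one_plus_powr[OF p norm_ge_zero])
  note L = frac_leibniz[OF \<alpha> \<eta> \<phi> Lp_borelD[OF f] powr_ge_zero this]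
  have "(\<integral>x. (\<eta> x *\<^sub>R g x + ?\<mu> *\<^sub>R frac_commutator \<alpha> \<eta> f x) \<bullet> \<phi> x \<partial>lborel)
      = (\<integral>x. g x \<bullet> (\<eta> x *\<^sub>R \<phi> x) + ?\<mu> * (frac_commutator \<alpha> \<eta> f x \<bullet> \<phi> x) \<partial>lborel)"
    by (simp add: inner_add_left)
  also have "\<dots> = (\<integral>x. g x \<bullet> (\<eta> x *\<^sub>R \<phi> x) \<partial>lborel) + (\<integral>x. ?\<mu> * (frac_commutator \<alpha> \<eta> f x \<bullet> \<phi> x) \<partial>lborel)"
    by (intro Bochner_Integration.integral_add Lp_borel_inner_Cc_integrable[OF g \<eta>\<phi> p] integrable_mult_right L(1))
  also have "\<dots> = - (?\<mu> * (\<integral>x. f x * frac_dvg \<alpha> (\<lambda>x. \<eta> x *\<^sub>R \<phi> x) x \<partial>lborel)) +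
      ?\<mu> * (\<integral>x. frac_commutator \<alpha> \<eta> f x \<bullet> \<phi> x \<partial>lborel)"
    using fg \<eta>\<phi> by (simp add: borel_frac_grad_def)
  finally show "?\<mu> * (\<integral>x. \<eta> x * f x * frac_dvg \<alpha> \<phi> x \<partial>lborel)
      = - (\<integral>x. (\<eta> x *\<^sub>R g x + ?\<mu> *\<^sub>R frac_commutator \<alpha> \<eta> f x) \<bullet> \<phi> x \<partial>lborel)"
    unfolding L(2) by (simp add: right_diff_distrib)
qed

text \<open>Replacing \<open>x\<close> by \<open>y - u\<close> brings the integral into the
  convolution form of \<open>young_modular\<close>, with weight
  \<open>C * frac_weight \<alpha> t\<close>. The steepness \<open>t\<close> of the cutoff enters
  only through the mass of that weight.\<close>

lemma frac_commutator_modular: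
  fixes \<eta> f :: "'a::euclidean_space \<Rightarrow> real"
  assumes f: "f \<in> Lp_borel p" and \<eta>: "\<eta> \<in> borel_measurable borel"
    and le: "\<And>x y. norm (\<eta> y - \<eta> x) \<le> C * min 1 (t * norm (y - x))"
    and C: "0 \<le> C" and t: "0 \<le> t" "t \<le> 1"
  shows "frac_commutator \<alpha> \<eta> f \<in> Lp_borel p"
    and "Lp_modular p (frac_commutator \<alpha> \<eta> f)
      \<le> (C * (\<integral>z. frac_weight \<alpha> t (z :: 'a) \<partial>lborel)) powr p * Lp_modular p f"
proof -
  let ?w = "frac_weight \<alpha> t :: 'a \<Rightarrow> real" and ?K = "frac_kernel \<alpha> :: 'a \<Rightarrow> 'a"
  note [measurable] = Lp_borelD(1)[OF f] \<eta>
  have w: "0 \<le> C * ?w u" "integrable lborel (\<lambda>u. C * ?w u)" for u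
    using C t frac_weight_nonneg[of t \<alpha> u] frac_weight_integrable[OF \<alpha> t] by auto
  have "norm (frac_commutator \<alpha> \<eta> f y) \<le> (\<integral>u. C * ?w u * norm (f (y - u)) \<partial>lborel)"
    if int: "integrable lborel (\<lambda>u. C * ?w u * norm (f (y - u)))" for y
  proof -
    have "frac_commutator \<alpha> \<eta> f y = (\<integral>u. (f (y - u) * (\<eta> (y - u) - \<eta> y)) *\<^sub>R ?K (y - u - y) \<partial>lborel)"
      unfolding frac_commutator_def by (rule integral_reflect(1)[symmetric]) measurable
    also have "norm \<dots> \<le> (\<integral>u. norm ((f (y - u) * (\<eta> (y - u) - \<eta> y)) *\<^sub>R ?K (y - u - y)) \<partial>lborel)"
      by (rule integral_norm_bound)
    also have "\<dots> \<le> (\<integral>u. C * ?w u * norm (f (y - u)) \<partial>lborel)"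
    proof (rule integral_mono'[OF int])
      fix u
      have "norm (?K (- u)) * norm (\<eta> (y - u) - \<eta> y) \<le> C * ?w (- u) * 1"
        using le[of "y - u" y] by (intro frac_kernel_times_increment) simp
      then have "norm (f (y - u)) * (norm (?K (- u)) * norm (\<eta> (y - u) - \<eta> y)) \<le> norm (f (y - u)) * (C * ?w u)"
        by (intro mult_left_mono) auto
      then show "norm ((f (y - u) * (\<eta> (y - u) - \<eta> y)) *\<^sub>R ?K (y - u - y)) \<le> C * ?w u * norm (f (y - u))"
        by (simp add: abs_mult mult_ac)
      show "0 \<le> C * ?w u * norm (f (y - u))" using w(1)[of u] by simp
    qed
    finally show ?thesis .
  qed
  note Y = young_modular[OF p w f _ this]
  show "frac_commutator \<alpha> \<eta> f \<in> Lp_borel p" by (rule Y(1)) measurable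
  have "Lp_modular p (frac_commutator \<alpha> \<eta> f) \<le> (\<integral>u. C * ?w u \<partial>lborel) powr p * Lp_modular p f"
    by (rule Y(2)) measurable
  then show "Lp_modular p (frac_commutator \<alpha> \<eta> f) \<le> (C * (\<integral>z. ?w z \<partial>lborel)) powr p * Lp_modular p f"
    by simp
qed

lemma Cc_infinity_borel_frac_grad:
  fixes \<eta> :: "real ^ 'n \<Rightarrow> real"
  assumes \<eta>: "\<eta> \<in> Cc_infinity"
  defines "g \<equiv> \<lambda>x. frac_mu CARD('n) \<alpha> *\<^sub>R frac_commutator \<alpha> \<eta> (\<lambda>_. 1) x"
  shows "borel_frac_grad \<alpha> \<eta> g" and "g \<in> Lp_borel p"
proof -
  let ?\<mu> = "frac_mu CARD('n) \<alpha>" and ?T = "frac_commutator \<alpha> \<eta> (\<lambda>_. 1)"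
  show "borel_frac_grad \<alpha> \<eta> g"
    unfolding borel_frac_grad_def
  proof
    fix \<phi> :: "real ^ 'n \<Rightarrow> real ^ 'n"
    assume \<phi>: "\<phi> \<in> Cc_infinity"
    have "(\<integral>x. \<eta> x * 1 * frac_dvg \<alpha> \<phi> x \<partial>lborel)
        = (\<integral>x. 1 * frac_dvg \<alpha> (\<lambda>x. \<eta> x *\<^sub>R \<phi> x) x \<partial>lborel) - (\<integral>x. ?T x \<bullet> \<phi> x \<partial>lborel)"
      by (rule frac_leibniz(2)[OF \<alpha> \<eta> \<phi>, where F = "\<lambda>_. 0"]) auto
    then show "?\<mu> * (\<integral>x. \<eta> x * frac_dvg \<alpha> \<phi> x \<partial>lborel) = - (\<integral>x. g x \<bullet> \<phi> x \<partial>lborel)"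
      using integral_frac_dvg_eq_0[OF \<alpha> Cc_infinity_scaleR[OF \<eta> \<phi>]] by (simp add: g_def)
  qed
  \<comment> \<open>Fubini makes the candidate gradient integrable; being bounded as well, it
    belongs to L^p.\<close>
  have "integrable (lborel \<Otimes>\<^sub>M lborel) (\<lambda>(x, y). (1 * (\<eta> x - \<eta> y)) *\<^sub>R frac_kernel \<alpha> (x - y))"
    by (rule frac_commutator_pair_integrable[OF \<alpha> \<eta>, where F = "\<lambda>_. 0"]) auto
  from lborel_pair.integrable_snd[OF this] have int: "integrable lborel g"
    unfolding g_def frac_commutator_def by (rule integrable_scaleR_right)
  obtain B where B: "\<And>x. norm (?T x) \<le> B" using frac_commutator_one_bounded[OF \<alpha> \<eta>] by metis
  have "norm (g x) \<le> \<bar>?\<mu>\<bar> * B" for x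
    unfolding g_def norm_scaleR by (rule mult_left_mono[OF B]) simp
  from Lp_borel_of_bounded_integrable[OF int this p] show "g \<in> Lp_borel p" .
qed

text \<open>The mollifier moves to the test side, reflected, where it commutes with the divergence.
  The mollified \<phi> is again a test field, so the identity for \<open>f\<close> and
  \<open>g\<close> applies, and the mollifier then moves back onto \<open>g\<close>.\<close>

lemma borel_frac_grad_mollify:
  fixes f :: "real ^ 'n \<Rightarrow> real"
  assumes fg: "borel_frac_grad \<alpha> f g" and f: "f \<in> Lp_borel p" and g: "g \<in> Lp_borel p"
    and \<rho>: "\<rho> \<in> Cc_infinity"
  shows "borel_frac_grad \<alpha> (convolution \<rho> f) (convolution \<rho> g)"
  unfolding borel_frac_grad_def
proof
  fix \<phi> :: "real ^ 'n \<Rightarrow> real ^ 'n"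
  assume \<phi>: "\<phi> \<in> Cc_infinity"
  let ?\<mu> = "frac_mu CARD('n) \<alpha>" and ?\<rho> = "\<lambda>u. \<rho> (- u)"
  have \<rho>': "?\<rho> \<in> Cc_infinity" using Cc_infinity_affine[OF \<rho>, of "- 1" 0] by simp
  obtain R where R: "\<And>x. norm x > R \<Longrightarrow> ?\<rho> x = 0" using Cc_infinityE[OF \<rho>'] by metis
  have \<phi>': "convolution ?\<rho> \<phi> \<in> Cc_infinity"
    by (rule convolution_Cc_infinity[OF Cc_infinity_integrable[OF \<rho>'] R \<phi>])
  obtain B where B: "\<And>x. norm (frac_dvg \<alpha> \<phi> x) \<le> B" using frac_dvg_bounded[OF \<alpha> \<phi>] by metis
  obtain M where M: "\<And>x. norm (\<phi> x) \<le> M" using Cc_infinity_bounded[OF \<phi>] by metis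
  have "(\<integral>x. convolution \<rho> f x * frac_dvg \<alpha> \<phi> x \<partial>lborel) = (\<integral>x. f x * convolution ?\<rho> (frac_dvg \<alpha> \<phi>) x \<partial>lborel)"
    using convolution_adjoint[OF \<rho> f p frac_dvg_integrable[OF \<alpha> \<phi>] B] by simp
  also have "\<dots> = (\<integral>x. f x * frac_dvg \<alpha> (convolution ?\<rho> \<phi>) x \<partial>lborel)"
    by (simp only: frac_dvg_convolution[OF \<alpha> \<rho>' \<phi>])
  finally have "?\<mu> * (\<integral>x. convolution \<rho> f x * frac_dvg \<alpha> \<phi> x \<partial>lborel) = - (\<integral>x. g x \<bullet> convolution ?\<rho> \<phi> x \<partial>lborel)"
    using fg \<phi>' by (simp add: borel_frac_grad_def)
  also have "(\<integral>x. g x \<bullet> convolution ?\<rho> \<phi> x \<partial>lborel) = (\<integral>x. convolution \<rho> g x \<bullet> \<phi> x \<partial>lborel)"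
    by (rule convolution_adjoint[OF \<rho> g p Cc_infinity_integrable[OF \<phi>] M, symmetric])
  finally show "?\<mu> * (\<integral>x. convolution \<rho> f x * frac_dvg \<alpha> \<phi> x \<partial>lborel) = - (\<integral>x. convolution \<rho> g x \<bullet> \<phi> x \<partial>lborel)" .
qed

end

section \<open>Approximation\<close>

lemma convolution_commute:
  fixes f g :: "'a::euclidean_space \<Rightarrow> real"
  assumes [measurable]: "f \<in> borel_measurable borel" "g \<in> borel_measurable borel"
  shows "convolution f g x = convolution g f x"
proof -
  have "convolution f g x = (\<integral>u. f (x - u) * g (x - (x - u)) \<partial>lborel)"
    unfolding convolution_def real_scaleR_def by (rule integral_reflect(1)[symmetric]) measurable
  then show ?thesis by (simp add: convolution_def mult.commute)
qed

text \<open>Dilating one bump by \<open>Suc j\<close> keeps the constant \<open>C\<close> and puts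
  all dependence on \<open>j\<close> into the slope; these are the increment bounds that
  \<open>frac_commutator_modular\<close> expects.\<close>

lemma cutoff_sequence_exists:
  obtains \<eta> :: "nat \<Rightarrow> 'a::euclidean_space \<Rightarrow> real" and C :: real
  where "\<And>j. \<eta> j \<in> Cc_infinity" "\<And>j x. 0 \<le> \<eta> j x" "\<And>j x. \<eta> j x \<le> 1"
    "\<And>x. (\<lambda>j. \<eta> j x) \<longlonglongrightarrow> 1" "0 \<le> C"
    "\<And>j x y. norm (\<eta> j y - \<eta> j x) \<le> C * min 1 (1 / real (Suc j) * norm (y - x))"
proof -
  obtain \<eta> :: "'a \<Rightarrow> real" where \<eta>: "\<eta> \<in> Cc_infinity" "\<And>x. \<eta> x \<ge> 0" "\<And>x. \<eta> x \<le> 1" "\<eta> 0 = 1"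
    using smooth_bump_exists[where ?'a = 'a] by metis
  obtain C where C: "0 < C" "\<And>x y. norm (\<eta> y - \<eta> x) \<le> C * min 1 (norm (y - x))"
    using Cc_infinity_increment_le[OF \<eta>(1)] by metis
  let ?s = "\<lambda>j x. \<eta> (0 + (1 / real (Suc j)) *\<^sub>R x)"
  show thesis
  proof (rule that[of ?s "C"])
    show "?s j \<in> Cc_infinity" for j by (rule Cc_infinity_affine[OF \<eta>(1)]) simp
    show "(\<lambda>j. ?s j x) \<longlonglongrightarrow> 1" for x
    proof -
      have "(\<lambda>j. 0 + (1 / real (Suc j)) *\<^sub>R x) \<longlonglongrightarrow> 0 + 0 *\<^sub>R x"
        by (intro tendsto_intros LIMSEQ_Suc lim_1_over_n)
      then have "(\<lambda>j. 0 + (1 / real (Suc j)) *\<^sub>R x) \<longlonglongrightarrow> 0" by simp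
      moreover have "isCont \<eta> 0"
        using Cc_infinity_continuous[OF \<eta>(1), of UNIV] by (simp add: continuous_on_eq_continuous_at)
      ultimately show ?thesis using isCont_tendsto_compose[of 0 \<eta>] \<eta>(4) by metis
    qed
    show "norm (?s j y - ?s j x) \<le> C * min 1 (1 / real (Suc j) * norm (y - x))" for j x y
    proof -
      have "norm (0 + (1 / real (Suc j)) *\<^sub>R y - (0 + (1 / real (Suc j)) *\<^sub>R x)) = 1 / real (Suc j) * norm (y - x)"
        by (simp add: scaleR_right_diff_distrib[symmetric])
      with C(2)[of "0 + (1 / real (Suc j)) *\<^sub>R y" "0 + (1 / real (Suc j)) *\<^sub>R x"] show ?thesis by (simp only:)
    qed
  qed (use \<eta> C in auto)
qed

context
  fixes \<alpha> p :: real
  assumes \<alpha>: "0 < \<alpha>" "\<alpha> < 1" and p: "1 \<le> p"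
begin

lemma frac_grad_cutoff_approximation:
  fixes f :: "real ^ 'n \<Rightarrow> real" and g :: "real ^ 'n \<Rightarrow> real ^ 'n"
  assumes fg: "borel_frac_grad \<alpha> f g" and f: "f \<in> Lp_borel p" and g: "g \<in> Lp_borel p" and d: "0 < d"
  obtains \<eta> g1 where "\<eta> \<in> Cc_infinity" "(\<lambda>x. \<eta> x * f x) \<in> Lp_borel p" "g1 \<in> Lp_borel p"
    "borel_frac_grad \<alpha> (\<lambda>x. \<eta> x * f x) g1"
    "Lp_modular p (\<lambda>x. \<eta> x * f x - f x) < d" "Lp_modular p (\<lambda>x. g1 x - g x) < d"
proof -
  let ?\<mu> = "frac_mu CARD('n) \<alpha>" and ?c = "2 powr p"
  have p0: "0 \<le> p" using p by simp
  note [measurable] = Lp_borelD(1)[OF f] Lp_borelD(1)[OF g]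
  obtain \<eta> :: "nat \<Rightarrow> real ^ 'n \<Rightarrow> real" and C where \<eta>: "\<And>j. \<eta> j \<in> Cc_infinity"
      "\<And>j x. 0 \<le> \<eta> j x" "\<And>j x. \<eta> j x \<le> 1" "\<And>x. (\<lambda>j. \<eta> j x) \<longlonglongrightarrow> 1" and C: "0 \<le> C"
      "\<And>j x y. norm (\<eta> j y - \<eta> j x) \<le> C * min 1 (1 / real (Suc j) * norm (y - x))"
    using cutoff_sequence_exists[where ?'a = "real ^ 'n"] by metis
  note [measurable] = Cc_infinity_borel[OF \<eta>(1)]
  \<comment> \<open>Stated for arbitrary values \<open>v\<close>, to serve for the scalar
    \<open>f\<close> and for the vector field \<open>g\<close>.\<close>
  have diff: "\<eta> j x *\<^sub>R v - v = (\<eta> j x - 1) *\<^sub>R v" for j x and v :: "'b::real_vector"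
    by (simp add: scaleR_left_diff_distrib)
  have bd: "norm (\<eta> j x *\<^sub>R v - v) \<le> 1 * norm v" "norm (\<eta> j x *\<^sub>R v) \<le> 1 * norm v"
    for j x and v :: "'b::real_normed_vector"
    using \<eta>(2,3)[of j x] unfolding diff norm_scaleR by (intro mult_right_mono; simp)+
  have lim: "(\<lambda>j. \<eta> j x *\<^sub>R v - v) \<longlonglongrightarrow> 0" for x and v :: "'b::real_normed_vector"
  proof -
    have "(\<lambda>j. \<eta> j x *\<^sub>R v - v) \<longlonglongrightarrow> 1 *\<^sub>R v - v"
      by (intro tendsto_diff tendsto_scaleR \<eta>(4) tendsto_const)
    then show ?thesis by simp
  qed
  have "(\<lambda>j. Lp_modular p (\<lambda>x. \<eta> j x *\<^sub>R f x - f x)) \<longlonglongrightarrow> 0"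
    by (rule Lp_modular_tendsto_0[OF f p _ bd(1)[simplified mult_1_left] AE_I2[OF lim]]) measurable
  then have ev1: "\<forall>\<^sub>F j in sequentially. Lp_modular p (\<lambda>x. \<eta> j x *\<^sub>R f x - f x) < d"
    by (rule order_tendstoD(2)) (rule d)
  have d': "0 < d / (2 * ?c)" using d by simp
  have "(\<lambda>j. Lp_modular p (\<lambda>x. \<eta> j x *\<^sub>R g x - g x)) \<longlonglongrightarrow> 0"
    by (rule Lp_modular_tendsto_0[OF g p _ bd(1)[simplified mult_1_left] AE_I2[OF lim]]) measurable
  then have ev2: "\<forall>\<^sub>F j in sequentially. Lp_modular p (\<lambda>x. \<eta> j x *\<^sub>R g x - g x) < d / (2 * ?c)"
    by (rule order_tendstoD(2)) (rule d')
  \<comment> \<open>The gradient error has two parts: \<open>(\<eta> j - 1) g\<close>, controlled by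
    dominated convergence, and the commutator, controlled by the mass \<open>?I j\<close>. Each is
    allowed half of \<open>d / ?c\<close>.\<close>
  let ?I = "\<lambda>j. \<integral>z. frac_weight \<alpha> (1 / real (Suc j)) (z :: real ^ 'n) \<partial>lborel"
  let ?T = "\<lambda>j. frac_commutator \<alpha> (\<eta> j) f"
  have T: "?T j \<in> Lp_borel p" "Lp_modular p (?T j) \<le> (C * ?I j) powr p * Lp_modular p f" for j
    by (rule frac_commutator_modular[OF \<alpha> p f Cc_infinity_borel[OF \<eta>(1)] C(2) C(1)]; simp)+
  have \<mu>T: "(\<lambda>x. ?\<mu> *\<^sub>R ?T j x) \<in> Lp_borel p"
    "Lp_modular p (\<lambda>x. ?\<mu> *\<^sub>R ?T j x) \<le> \<bar>?\<mu>\<bar> powr p * Lp_modular p (?T j)" for j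
  proof -
    have m: "(\<lambda>x. ?\<mu> *\<^sub>R ?T j x) \<in> borel_measurable borel" using Lp_borelD(1)[OF T(1)] by simp
    have le: "norm (?\<mu> *\<^sub>R ?T j x) \<le> \<bar>?\<mu>\<bar> * norm (?T j x)" for x by simp
    show "(\<lambda>x. ?\<mu> *\<^sub>R ?T j x) \<in> Lp_borel p"
      "Lp_modular p (\<lambda>x. ?\<mu> *\<^sub>R ?T j x) \<le> \<bar>?\<mu>\<bar> powr p * Lp_modular p (?T j)"
      by (rule Lp_borel_bound[OF m le T(1) abs_ge_zero p0])+
  qed
  have I0: "0 \<le> ?I j" for j by (simp add: frac_weight_nonneg)
  have "(\<lambda>j. C * ?I j) \<longlonglongrightarrow> C * 0"
    by (intro tendsto_mult_left integral_frac_weight_tendsto_0 \<alpha>)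
  then have "(\<lambda>j. (C * ?I j) powr p) \<longlonglongrightarrow> 0 powr p"
    using C(1) I0 p by (intro tendsto_powr') (auto simp: zero_le_mult_iff intro!: always_eventually)
  then have "(\<lambda>j. \<bar>?\<mu>\<bar> powr p * ((C * ?I j) powr p * Lp_modular p f)) \<longlonglongrightarrow> \<bar>?\<mu>\<bar> powr p * (0 powr p * Lp_modular p f)"
    by (intro tendsto_mult_left tendsto_mult_right)
  then have "\<forall>\<^sub>F j in sequentially. \<bar>?\<mu>\<bar> powr p * ((C * ?I j) powr p * Lp_modular p f) < d / (2 * ?c)"
    by (rule order_tendstoD(2)) (use d' in simp)
  from eventually_conj[OF ev1 eventually_conj[OF ev2 this]]
  obtain j where j: "Lp_modular p (\<lambda>x. \<eta> j x *\<^sub>R f x - f x) < d"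
    "Lp_modular p (\<lambda>x. \<eta> j x *\<^sub>R g x - g x) < d / (2 * ?c)"
    "\<bar>?\<mu>\<bar> powr p * ((C * ?I j) powr p * Lp_modular p f) < d / (2 * ?c)"
    by (auto dest: eventually_happens)
  let ?g1 = "\<lambda>x. \<eta> j x *\<^sub>R g x + ?\<mu> *\<^sub>R ?T j x"
  have \<eta>f: "(\<lambda>x. \<eta> j x * f x) \<in> Lp_borel p"
  proof -
    have "(\<lambda>x. \<eta> j x *\<^sub>R f x) \<in> Lp_borel p"
      by (rule Lp_borel_bound(1)[OF _ bd(2) f zero_le_one p0]) measurable
    then show ?thesis by simp
  qed
  have \<eta>g: "(\<lambda>x. \<eta> j x *\<^sub>R g x) \<in> Lp_borel p"
    by (rule Lp_borel_bound(1)[OF _ bd(2) g zero_le_one p0]) measurable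
  have "Lp_modular p (\<lambda>x. ?\<mu> *\<^sub>R ?T j x) < d / (2 * ?c)"
    using \<mu>T(2)[of j] mult_left_mono[OF T(2)[of j], of "\<bar>?\<mu>\<bar> powr p"] j(3) by simp
  with j(2) have "?c * (Lp_modular p (\<lambda>x. \<eta> j x *\<^sub>R g x - g x) + Lp_modular p (\<lambda>x. ?\<mu> *\<^sub>R ?T j x))
      < ?c * (d / (2 * ?c) + d / (2 * ?c))"
    by (intro mult_strict_left_mono add_strict_mono) auto
  also have "\<dots> = d" by (simp add: field_simps)
  finally have "Lp_modular p (\<lambda>x. (\<eta> j x *\<^sub>R g x - g x) + ?\<mu> *\<^sub>R ?T j x) < d"
    using Lp_borel_add(2)[OF Lp_borel_diff(1)[OF \<eta>g g p0] \<mu>T(1)[of j] p0] by linarith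
  then have g1: "Lp_modular p (\<lambda>x. ?g1 x - g x) < d" by (simp only: diff_add_eq)
  show thesis
    by (rule that[OF \<eta>(1)[of j] \<eta>f Lp_borel_add(1)[OF \<eta>g \<mu>T(1) p0]
          borel_frac_grad_cutoff[OF \<alpha> p fg f g \<eta>(1)] _ g1]) (use j(1) in simp)
qed

lemma frac_grad_smooth_approximation:
  fixes f :: "real ^ 'n \<Rightarrow> real" and g :: "real ^ 'n \<Rightarrow> real ^ 'n"
  assumes fg: "borel_frac_grad \<alpha> f g" and f: "f \<in> Lp_borel p" and g: "g \<in> Lp_borel p" and d: "0 < d"
  obtains \<psi> G where "\<psi> \<in> Cc_infinity" "G \<in> Lp_borel p" "borel_frac_grad \<alpha> \<psi> G"
    "Lp_modular p (\<lambda>x. f x - \<psi> x) < d" "Lp_modular p (\<lambda>x. g x - G x) < d"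
proof -
  let ?c = "2 powr p"
  have p0: "0 \<le> p" using p by simp
  have d': "0 < d / (2 * ?c)" using d by simp
  obtain \<eta> g1 where \<eta>: "\<eta> \<in> Cc_infinity" and f1: "(\<lambda>x. \<eta> x * f x) \<in> Lp_borel p" and g1: "g1 \<in> Lp_borel p"
    and fg1: "borel_frac_grad \<alpha> (\<lambda>x. \<eta> x * f x) g1"
    and le1: "Lp_modular p (\<lambda>x. \<eta> x * f x - f x) < d / (2 * ?c)" "Lp_modular p (\<lambda>x. g1 x - g x) < d / (2 * ?c)"
    using frac_grad_cutoff_approximation[OF fg f g d'] by blast
  let ?f1 = "\<lambda>x. \<eta> x * f x"
  note [measurable] = Lp_borelD(1)[OF f] Cc_infinity_borel[OF \<eta>]
  obtain r1 where r1: "0 < r1" "\<And>r \<rho>. r \<le> r1 \<Longrightarrow> mollifier r \<rho> \<Longrightarrow>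
      Lp_modular p (\<lambda>x. convolution \<rho> ?f1 x - ?f1 x) < d / (2 * ?c)"
    using mollify_approximates[OF f1 p d'] by blast
  obtain r2 where r2: "0 < r2" "\<And>r \<rho>. r \<le> r2 \<Longrightarrow> mollifier r \<rho> \<Longrightarrow>
      Lp_modular p (\<lambda>x. convolution \<rho> g1 x - g1 x) < d / (2 * ?c)"
    using mollify_approximates[OF g1 p d'] by blast
  \<comment> \<open>One mollifier has to work for both, since the gradient of the mollified function
    is the mollified gradient with the same \<open>\<rho>\<close>.\<close>
  obtain \<rho> :: "real ^ 'n \<Rightarrow> real" where \<rho>: "mollifier (min r1 r2) \<rho>"
    using mollifier_exists[of "min r1 r2"] r1(1) r2(1) by auto
  then have \<rho>C: "\<rho> \<in> Cc_infinity" by (simp add: mollifier_def)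
  have close: "Lp_modular p (\<lambda>x. u x - w x) < d"
    if "u \<in> Lp_borel p" "v \<in> Lp_borel p" "w \<in> Lp_borel p"
      "Lp_modular p (\<lambda>x. v x - u x) < d / (2 * ?c)" "Lp_modular p (\<lambda>x. w x - v x) < d / (2 * ?c)"
    for u v w :: "real ^ 'n \<Rightarrow> 'b::euclidean_space"
  proof -
    note wv = Lp_borel_diff(1)[OF that(3) that(2) p0] and vu = Lp_borel_diff(1)[OF that(2) that(1) p0]
    have "Lp_modular p (\<lambda>x. u x - w x) = Lp_modular p (\<lambda>x. - ((w x - v x) + (v x - u x)))" by simp
    also have "\<dots> = Lp_modular p (\<lambda>x. (w x - v x) + (v x - u x))"
      by (rule Lp_borel_uminus(2)[OF Lp_borel_add(1)[OF wv vu p0]])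
    also have "\<dots> \<le> ?c * (Lp_modular p (\<lambda>x. w x - v x) + Lp_modular p (\<lambda>x. v x - u x))"
      by (rule Lp_borel_add(2)[OF wv vu p0])
    also have "\<dots> < ?c * (d / (2 * ?c) + d / (2 * ?c))"
      using that(4,5) by (intro mult_strict_left_mono add_strict_mono) auto
    also have "\<dots> = d" by (simp add: field_simps)
    finally show ?thesis .
  qed
  have conv: "convolution \<rho> ?f1 \<in> Lp_borel p" "convolution \<rho> g1 \<in> Lp_borel p"
    by (rule mollify_contraction(1)[OF \<rho> f1 p], rule mollify_contraction(1)[OF \<rho> g1 p])
  obtain M where M: "\<And>x. norm (\<eta> x) \<le> M" using Cc_infinity_bounded[OF \<eta>] by metis
  have int: "integrable lborel ?f1"
    by (rule Lp_borel_times_bounded_integrable[OF f Cc_infinity_integrable[OF \<eta>] M p])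
      (simp_all add: abs_mult)
  obtain R where "\<And>x. norm x > R \<Longrightarrow> \<eta> x = 0" using Cc_infinityE[OF \<eta>] by metis
  then have "\<And>x. norm x > R \<Longrightarrow> ?f1 x = 0" by simp
  note cc = convolution_Cc_infinity[OF int this \<rho>C]
  \<comment> \<open>Smoothness comes from the second factor in
    \<open>convolution_Cc_infinity\<close>, whereas mollification places \<open>\<rho>\<close>
    first.\<close>
  have "convolution \<rho> ?f1 = convolution ?f1 \<rho>"
    by (rule ext) (rule convolution_commute[OF Cc_infinity_borel[OF \<rho>C] Lp_borelD(1)[OF f1]])
  with cc have smooth: "convolution \<rho> ?f1 \<in> Cc_infinity" by (simp only:)
  show thesis
  proof (rule that[OF smooth conv(2) borel_frac_grad_mollify[OF \<alpha> p fg1 f1 g1 \<rho>C]])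
    show "Lp_modular p (\<lambda>x. f x - convolution \<rho> ?f1 x) < d"
      by (rule close[OF f f1 conv(1) le1(1) r1(2)[OF _ \<rho>]]) simp
    show "Lp_modular p (\<lambda>x. g x - convolution \<rho> g1 x) < d"
      by (rule close[OF g g1 conv(2) le1(2) r2(2)[OF _ \<rho>]]) simp
  qed
qed

lemma Cc_infinity_subset_frac_sobolev: "(Cc_infinity :: (real ^ 'n \<Rightarrow> real) set) \<subseteq> frac_sobolev \<alpha> p"
proof
  fix \<psi> :: "real ^ 'n \<Rightarrow> real"
  assume \<psi>: "\<psi> \<in> Cc_infinity"
  define g where "g = (\<lambda>x. frac_mu CARD('n) \<alpha> *\<^sub>R frac_commutator \<alpha> \<psi> (\<lambda>_. 1) x)"
  have g: "borel_frac_grad \<alpha> \<psi> g" "g \<in> Lp_borel p"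
    unfolding g_def by (rule Cc_infinity_borel_frac_grad[OF \<alpha> p \<psi>])+
  note \<psi>L = Cc_infinity_Lp_borel[OF \<psi> p]
  have "has_weak_frac_grad \<alpha> \<psi> g"
    using g(1) Lp_borelD(1)[OF \<psi>L] Lp_borelD(1)[OF g(2)]
    by (subst has_weak_frac_grad_iff_borel[of \<psi> \<psi> g g])
      (auto intro: borel_imp_lebesgue_measurable Lp_space_imp_L1_loc[OF Lp_borel_imp_Lp_space[OF g(2)] p])
  then show "\<psi> \<in> frac_sobolev \<alpha> p"
    using Lp_borel_imp_Lp_space[OF \<psi>L] Lp_borel_imp_Lp_space[OF g(2)] by (auto simp: frac_sobolev_def)
qed

text \<open>\<open>frac_grad\<close> is a choice with \<open>SOME\<close>. The gradient
  \<open>g0\<close> shows that the choice is a genuine weak gradient, and uniqueness makes it equal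
  to \<open>g0\<close> almost everywhere, so the norm can be read off from Borel
  representatives.\<close>

lemma frac_sobolev_norm_borel:
  fixes f f0 :: "real ^ 'n \<Rightarrow> real"
  assumes f: "f \<in> borel_measurable lebesgue" "AE x in lebesgue. f x = f0 x" "f0 \<in> Lp_borel p"
    and g: "borel_frac_grad \<alpha> f0 g0" "g0 \<in> Lp_borel p"
  shows "frac_sobolev_norm \<alpha> p f = Lp_modular p f0 powr (1 / p) + Lp_modular p g0 powr (1 / p)"
proof -
  note m = Lp_borelD(1)[OF f(3)] Lp_borelD(1)[OF g(2)]
  have "has_weak_frac_grad \<alpha> f g0"
    using g(1) f m
    by (subst has_weak_frac_grad_iff_borel[of f f0 g0 g0])
      (auto intro: Lp_space_imp_L1_loc[OF Lp_borel_imp_Lp_space[OF g(2)] p])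
  then have s: "has_weak_frac_grad \<alpha> f (frac_grad \<alpha> f)"
    unfolding frac_grad_def by (rule someI[where P = "has_weak_frac_grad \<alpha> f"])
  then have "frac_grad \<alpha> f \<in> borel_measurable lebesgue" by (simp add: has_weak_frac_grad_def L1_loc_def)
  from Lp_norm_eq_modular[OF this m(2) weak_frac_grad_unique[OF s \<open>has_weak_frac_grad \<alpha> f g0\<close>]]
    Lp_norm_eq_modular[OF f(1) m(1) f(2)]
  show ?thesis by (simp add: frac_sobolev_norm_def)
qed

end

theorem theoremA1:
  fixes \<alpha> p :: real
  assumes "0 < \<alpha>" and "\<alpha> < 1" and "1 \<le> p"
  shows "(Cc_infinity :: (real ^ 'n \<Rightarrow> real) set) \<subseteq> frac_sobolev \<alpha> p \<and>
    (\<forall>f \<in> (frac_sobolev \<alpha> p :: (real ^ 'n \<Rightarrow> real) set). \<forall>\<epsilon>>0. \<exists>\<psi>\<in>Cc_infinity.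
        frac_sobolev_norm \<alpha> p (\<lambda>x. f x - \<psi> x) < \<epsilon>)"
proof (intro conjI ballI allI impI)
  show "(Cc_infinity :: (real ^ 'n \<Rightarrow> real) set) \<subseteq> frac_sobolev \<alpha> p"
    by (rule Cc_infinity_subset_frac_sobolev[OF assms])
next
  fix f :: "real ^ 'n \<Rightarrow> real" and \<epsilon> :: real
  assume f: "f \<in> frac_sobolev \<alpha> p" and \<epsilon>: "0 < \<epsilon>"
  have p0: "0 \<le> p" "0 < p" using assms(3) by auto
  obtain g where g: "g \<in> Lp_space p" "has_weak_frac_grad \<alpha> f g" and fL: "f \<in> Lp_space p"
    using f by (auto simp: frac_sobolev_def)
  have fm: "f \<in> borel_measurable lebesgue" using fL by (simp add: Lp_space_def)
  obtain f0 where f0: "f0 \<in> Lp_borel p" "AE x in lebesgue. f x = f0 x"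
    using Lp_space_borel_version[OF fL] by blast
  obtain g0 where g0: "g0 \<in> Lp_borel p" "AE x in lebesgue. g x = g0 x"
    using Lp_space_borel_version[OF g(1)] by blast
  have fg0: "borel_frac_grad \<alpha> f0 g0"
    using has_weak_frac_grad_iff_borel[OF fm Lp_borelD(1)[OF f0(1)] f0(2)
        Lp_space_imp_L1_loc[OF g(1) assms(3)] Lp_borelD(1)[OF g0(1)] g0(2)] g(2) by simp
  \<comment> \<open>The p-th power of the norm allotted to each of the two summands;
    \<open>root\<close> turns modulars below \<open>d\<close> back into norms below
    \<open>\<epsilon> / 2\<close>.\<close>
  define d where "d = (\<epsilon> / 2) powr p"
  have d: "0 < d" using \<epsilon> by (simp add: d_def)
  have root: "m powr (1 / p) < \<epsilon> / 2" if "0 \<le> m" "m < d" for m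
  proof -
    have "m powr (1 / p) < d powr (1 / p)" using that p0 by (intro powr_less_mono2) auto
    also have "\<dots> = \<epsilon> / 2" using \<epsilon> p0 by (simp add: d_def powr_powr)
    finally show ?thesis .
  qed
  obtain \<psi> G where \<psi>: "\<psi> \<in> Cc_infinity" and G: "G \<in> Lp_borel p" "borel_frac_grad \<alpha> \<psi> G"
    and le: "Lp_modular p (\<lambda>x. f0 x - \<psi> x) < d" "Lp_modular p (\<lambda>x. g0 x - G x) < d"
    using frac_grad_smooth_approximation[OF assms fg0 f0(1) g0(1) d] by blast
  note \<psi>L = Cc_infinity_Lp_borel[OF \<psi> assms(3)]
  have "frac_sobolev_norm \<alpha> p (\<lambda>x. f x - \<psi> x)
      = Lp_modular p (\<lambda>x. f0 x - \<psi> x) powr (1 / p) + Lp_modular p (\<lambda>x. g0 x - G x) powr (1 / p)"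
  proof (rule frac_sobolev_norm_borel[OF assms])
    show "(\<lambda>x. f x - \<psi> x) \<in> borel_measurable lebesgue"
      by (intro borel_measurable_diff fm borel_imp_lebesgue_measurable Cc_infinity_borel \<psi>)
    show "AE x in lebesgue. f x - \<psi> x = f0 x - \<psi> x"
      using f0(2) by eventually_elim simp
    show "borel_frac_grad \<alpha> (\<lambda>x. f0 x - \<psi> x) (\<lambda>x. g0 x - G x)"
      by (rule borel_frac_grad_diff[OF assms fg0 G(2) f0(1) \<psi>L g0(1) G(1)])
  qed (intro Lp_borel_diff(1) f0 g0 \<psi>L G p0)+
  also have "\<dots> < \<epsilon> / 2 + \<epsilon> / 2"
    by (intro add_strict_mono root Lp_modular_nonneg le)
  finally show "\<exists>\<psi>\<in>Cc_infinity. frac_sobolev_norm \<alpha> p (\<lambda>x. f x - \<psi> x) < \<epsilon>"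
    using \<psi> by auto
qed

end
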